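(* Let $f=f(x,u,p,q)$ and consider the third-order ordinary differential equation $u'''=f(x,u,u',u'')$, with $p=u'$, $q=u''$. Write $D_x=\frac{\partial}{\partial x}+p\frac{\partial}{\partial u}+q\frac{\partial}{\partial p}+f\frac{\partial}{\partial q}$. The necessary and sufficient conditions for equivalence of the equation $u'''=f(x,u,u',u'')$ to the canonical form $\bar u'''=s\,\bar u'+\bar u$, $s=$ constant, with five point symmetries, via a point transformation $$\bar x=\phi(x,u),\quad \bar u=\psi(x,u),\quad \phi_x\psi_u-\phi_u\psi_x\neq 0,$$ are the identical vanishing of the relative invariants $$\begin{aligned} I_1&=f_{qqq},\\ I_2&=f_{qq}^2+6f_{pqq},\\ I_4&=J_q,\\ I_5&=f_{qq}\,J-6J_p,\\ I_6&=J_u-D_xJ_p,\\ I_7&=f_{qq}\left(9f_p+f_q^2-3D_xf_q\right)-9f_{pp}+18f_{uq}-6f_qf_{pq},\\ I_9&=K_q,\quad I_{10}=K_p,\quad I_{11}=K_u,\quad I_{12}=K_x, \end{aligned}$$ where $$\begin{aligned} I_3&=J^3=\frac{1}{54}\left(4f_q^3+18f_q\left(f_p-D_xf_q\right)+9D_x^2f_q-27D_xf_p+54f_u\right)\neq 0,\\ I_8&=\frac13\left(\left(f_q^2+3f_p-3D_xf_q\right)J^2+6J\,D_x^2J-9\left(D_xJ\right)^2\right),\\ K&=\frac{I_8}{J^4}. \end{aligned}$$ Given that all of the relative invariants $I_1,I_2,I_4,I_5,I_6,I_7,I_9,I_{10},I_{11},I_{12}$ are zero, the linearizing point transformation $\bar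 x=\phi(x,u)$, $\bar u=\psi(x,u)$ is defined by the system $$J=D_x\phi,\qquad \frac{D_xa_1}{a_1}=\frac13\left(\frac{3D_xJ-Jf_q}{J}\right),$$ where the auxiliary function is $a_1(x,u,p)=\frac{1}{J}\left(\phi_x\psi_u-\phi_u\psi_x\right)$. Finally, the constant $s$ of the resulting canonical form is given by $s=K$.
   Context: Functions are real and smooth, and equivalence is local. Here $(x,u,p,q)$ are local coordinates on the second-order jet space, with $p=u'$ and $q=u''$. Subscripts denote partial derivatives, so for example $f_{pqq}=\partial^3f/\partial p\,\partial q^2$, except that the numerical subscripts on $I$ and $a$, and the subscript of the operator $D_x$, are labels. $J$ is the real cube root of $I_3$. The operator $D_x$ acts on functions of $(x,u,p,q)$; for a function of $(x,u)$ only, $D_x\phi=\phi_x+p\,\phi_u$. A point transformation $\bar x=\phi(x,u)$, $\bar u=\psi(x,u)$ with $\phi_x\psi_u-\phi_u\psi_x\neq0$ acts on derivatives by standard prolongation: $\bar u'=D_x\psi/D_x\phi$, $\bar u''=D_x\bar u'/D_x\phi$, $\bar u'''=D_x\bar u''/D_x\phi$. Two third-order equations $u'''=f(x,u,u',u'')$ and $\bar u'''=\bar f(\bar x,\bar u,\bar u',\bar u'')$ are equivalent via the point transformation if its prolongation locally maps the first equation onto the second. A linearizing point transformation is one that maps $u'''=f(x,u,u',u'')$ to the canonical form $\bar u'''=s\,\bar u'+\bar u$.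
   Formalization: A solution (φ,ψ) of the system need not linearize: for f=sp+u, φ=x, ψ=u+h(x) solves it for every h. So it is proved that each linearizing transformation solves the system, and each solution linearizes, with s=K, after ψ is replaced by ψ+g(φ) for some smooth g. *)

theory Defs
  imports "HOL-Analysis.Analysis"
begin

primrec higher_differentiable_on ::
    "'a::real_normed_vector set \<Rightarrow> ('a \<Rightarrow> 'b::real_normed_vector) \<Rightarrow> nat \<Rightarrow> bool" where
  "higher_differentiable_on S f 0 \<longleftrightarrow> continuous_on S f"
| "higher_differentiable_on S f (Suc n) \<longleftrightarrow>
     (\<forall>x\<in>S. f differentiable (at x)) \<and>
     (\<forall>v. higher_differentiable_on S (\<lambda>x. frechet_derivative f (at x) v) n)"

text \<open>Only meant for open sets \<open>S\<close>: the derivatives are unrestricted ones.\<close>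
definition smooth_on ::
    "'a::real_normed_vector set \<Rightarrow> ('a \<Rightarrow> 'b::real_normed_vector) \<Rightarrow> bool" where
  "smooth_on S f \<longleftrightarrow> (\<forall>n. higher_differentiable_on S f n)"

text \<open>Points of the plane are pairs \<open>(x, u)\<close>; points of the second-order jet space are
  quadruples \<open>(x, u, p, q)\<close> with \<open>p = u'\<close>, \<open>q = u''\<close>.\<close>

type_synonym plane = "real \<times> real"
type_synonym jet = "real \<times> real \<times> real \<times> real"

definition pd_x :: "(jet \<Rightarrow> real) \<Rightarrow> jet \<Rightarrow> real" where
  "pd_x F = (\<lambda>(x, u, p, q). deriv (\<lambda>t. F (t, u, p, q)) x)"
definition pd_u :: "(jet \<Rightarrow> real) \<Rightarrow> jet \<Rightarrow> real" where
  "pd_u F = (\<lambda>(x, u, p, q). deriv (\<lambda>t. F (x, t, p, q)) u)"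
definition pd_p :: "(jet \<Rightarrow> real) \<Rightarrow> jet \<Rightarrow> real" where
  "pd_p F = (\<lambda>(x, u, p, q). deriv (\<lambda>t. F (x, u, t, q)) p)"
definition pd_q :: "(jet \<Rightarrow> real) \<Rightarrow> jet \<Rightarrow> real" where
  "pd_q F = (\<lambda>(x, u, p, q). deriv (\<lambda>t. F (x, u, p, t)) q)"

text \<open>\<open>Dx f\<close> is the total derivative along \<open>u''' = f\<close>. With a constant function
  \<open>\<lambda>_. r\<close> in place of \<open>f\<close> it is the total derivative at third-order jets \<open>(x, u, p, q, r)\<close>,
  \<open>r = u'''\<close>, where \<open>r\<close> is an independent coordinate.\<close>
definition Dx :: "(jet \<Rightarrow> real) \<Rightarrow> (jet \<Rightarrow> real) \<Rightarrow> jet \<Rightarrow> real" where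
  "Dx f F = (\<lambda>(x, u, p, q).
     pd_x F (x, u, p, q) + p * pd_u F (x, u, p, q) + q * pd_p F (x, u, p, q)
       + f (x, u, p, q) * pd_q F (x, u, p, q))"

definition lift :: "(plane \<Rightarrow> real) \<Rightarrow> jet \<Rightarrow> real" where
  "lift \<phi> = (\<lambda>(x, u, p, q). \<phi> (x, u))"

definition jacobian :: "(plane \<Rightarrow> real) \<Rightarrow> (plane \<Rightarrow> real) \<Rightarrow> plane \<Rightarrow> real" where
  "jacobian \<phi> \<psi> = (\<lambda>(x, u).
     deriv (\<lambda>t. \<phi> (t, u)) x * deriv (\<lambda>t. \<psi> (x, t)) u
       - deriv (\<lambda>t. \<phi> (x, t)) u * deriv (\<lambda>t. \<psi> (t, u)) x)"

definition point_transformation_near ::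
    "(plane \<Rightarrow> real) \<Rightarrow> (plane \<Rightarrow> real) \<Rightarrow> plane \<Rightarrow> bool" where
  "point_transformation_near \<phi> \<psi> w0 \<longleftrightarrow>
     (\<exists>V. open V \<and> w0 \<in> V \<and> smooth_on V \<phi> \<and> smooth_on V \<psi> \<and> (\<forall>w\<in>V. jacobian \<phi> \<psi> w \<noteq> 0))"

text \<open>The transformed derivatives \<open>\<bar>u'\<close>, \<open>\<bar>u''\<close>, \<open>\<bar>u'''\<close> of the standard prolongation.\<close>

definition prol1 :: "(jet \<Rightarrow> real) \<Rightarrow> (plane \<Rightarrow> real) \<Rightarrow> (plane \<Rightarrow> real) \<Rightarrow> jet \<Rightarrow> real" where
  "prol1 f \<phi> \<psi> = (\<lambda>z. Dx f (lift \<psi>) z / Dx f (lift \<phi>) z)"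
definition prol2 :: "(jet \<Rightarrow> real) \<Rightarrow> (plane \<Rightarrow> real) \<Rightarrow> (plane \<Rightarrow> real) \<Rightarrow> jet \<Rightarrow> real" where
  "prol2 f \<phi> \<psi> = (\<lambda>z. Dx f (prol1 f \<phi> \<psi>) z / Dx f (lift \<phi>) z)"
definition prol3 :: "(jet \<Rightarrow> real) \<Rightarrow> (plane \<Rightarrow> real) \<Rightarrow> (plane \<Rightarrow> real) \<Rightarrow> jet \<Rightarrow> real" where
  "prol3 f \<phi> \<psi> = (\<lambda>z. Dx f (prol2 f \<phi> \<psi>) z / Dx f (lift \<phi>) z)"

text \<open>Near the jet \<open>z0\<close>, the point transformation \<open>(\<phi>, \<psi>)\<close> maps \<open>u''' = f\<close> onto
  \<open>\<bar>u''' = g\<close>: the prolongation is defined, that is \<open>D\<^sub>x \<phi> \<noteq> 0\<close>, and a third-order jet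
  \<open>(z, r)\<close> with \<open>z\<close> near \<open>z0\<close> lies on the first equation iff its image lies on the second.
  Since the prolongation is a local diffeomorphism, this says that one equation is locally mapped onto the other.\<close>
definition equivalent_via ::
    "(jet \<Rightarrow> real) \<Rightarrow> (jet \<Rightarrow> real) \<Rightarrow> (plane \<Rightarrow> real) \<Rightarrow> (plane \<Rightarrow> real) \<Rightarrow> jet \<Rightarrow> bool" where
  "equivalent_via f g \<phi> \<psi> z0 \<longleftrightarrow>
     (case z0 of (x0, u0, p0, q0) \<Rightarrow> point_transformation_near \<phi> \<psi> (x0, u0)) \<and>
     (\<forall>\<^sub>F z in nhds z0.
        Dx f (lift \<phi>) z \<noteq> 0 \<and>
        (\<forall>r. r = f z \<longleftrightarrow>
           prol3 (\<lambda>_. r) \<phi> \<psi> z =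
             g (lift \<phi> z, lift \<psi> z, prol1 (\<lambda>_. r) \<phi> \<psi> z, prol2 (\<lambda>_. r) \<phi> \<psi> z)))"

definition canonical :: "real \<Rightarrow> jet \<Rightarrow> real" where
  "canonical s = (\<lambda>(x, u, p, q). s * p + u)"

definition linearizing :: "(jet \<Rightarrow> real) \<Rightarrow> real \<Rightarrow> (plane \<Rightarrow> real) \<Rightarrow> (plane \<Rightarrow> real) \<Rightarrow> jet \<Rightarrow> bool" where
  "linearizing f s \<phi> \<psi> z0 \<longleftrightarrow> equivalent_via f (canonical s) \<phi> \<psi> z0"

definition I3 :: "(jet \<Rightarrow> real) \<Rightarrow> jet \<Rightarrow> real" where
  "I3 f = (\<lambda>z. 1 / 54 *
     (4 * (pd_q f z)^3 + 18 * pd_q f z * (pd_p f z - Dx f (pd_q f) z)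
       + 9 * Dx f (Dx f (pd_q f)) z - 27 * Dx f (pd_p f) z + 54 * pd_u f z))"

text \<open>\<open>root 3\<close> is the real cube root, for arguments of either sign.\<close>
definition J :: "(jet \<Rightarrow> real) \<Rightarrow> jet \<Rightarrow> real" where
  "J f = (\<lambda>z. root 3 (I3 f z))"

definition I1 :: "(jet \<Rightarrow> real) \<Rightarrow> jet \<Rightarrow> real" where
  "I1 f = pd_q (pd_q (pd_q f))"
definition I2 :: "(jet \<Rightarrow> real) \<Rightarrow> jet \<Rightarrow> real" where
  "I2 f = (\<lambda>z. (pd_q (pd_q f) z)^2 + 6 * pd_q (pd_q (pd_p f)) z)"
definition I4 :: "(jet \<Rightarrow> real) \<Rightarrow> jet \<Rightarrow> real" where
  "I4 f = pd_q (J f)"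
definition I5 :: "(jet \<Rightarrow> real) \<Rightarrow> jet \<Rightarrow> real" where
  "I5 f = (\<lambda>z. pd_q (pd_q f) z * J f z - 6 * pd_p (J f) z)"
definition I6 :: "(jet \<Rightarrow> real) \<Rightarrow> jet \<Rightarrow> real" where
  "I6 f = (\<lambda>z. pd_u (J f) z - Dx f (pd_p (J f)) z)"
definition I7 :: "(jet \<Rightarrow> real) \<Rightarrow> jet \<Rightarrow> real" where
  "I7 f = (\<lambda>z.
     pd_q (pd_q f) z * (9 * pd_p f z + (pd_q f z)^2 - 3 * Dx f (pd_q f) z)
       - 9 * pd_p (pd_p f) z + 18 * pd_q (pd_u f) z - 6 * pd_q f z * pd_q (pd_p f) z)"
definition I8 :: "(jet \<Rightarrow> real) \<Rightarrow> jet \<Rightarrow> real" where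
  "I8 f = (\<lambda>z. 1 / 3 *
     (((pd_q f z)^2 + 3 * pd_p f z - 3 * Dx f (pd_q f) z) * (J f z)^2
       + 6 * J f z * Dx f (Dx f (J f)) z - 9 * (Dx f (J f) z)^2))"

definition K :: "(jet \<Rightarrow> real) \<Rightarrow> jet \<Rightarrow> real" where
  "K f = (\<lambda>z. I8 f z / (J f z)^4)"

definition I9 :: "(jet \<Rightarrow> real) \<Rightarrow> jet \<Rightarrow> real" where "I9 f = pd_q (K f)"
definition I10 :: "(jet \<Rightarrow> real) \<Rightarrow> jet \<Rightarrow> real" where "I10 f = pd_p (K f)"
definition I11 :: "(jet \<Rightarrow> real) \<Rightarrow> jet \<Rightarrow> real" where "I11 f = pd_u (K f)"
definition I12 :: "(jet \<Rightarrow> real) \<Rightarrow> jet \<Rightarrow> real" where "I12 f = pd_x (K f)"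

definition invariants_vanish_near :: "(jet \<Rightarrow> real) \<Rightarrow> jet \<Rightarrow> bool" where
  "invariants_vanish_near f z0 \<longleftrightarrow>
     (\<forall>\<^sub>F z in nhds z0. I3 f z \<noteq> 0 \<and>
        I1 f z = 0 \<and> I2 f z = 0 \<and> I4 f z = 0 \<and> I5 f z = 0 \<and> I6 f z = 0 \<and>
        I7 f z = 0 \<and> I9 f z = 0 \<and> I10 f z = 0 \<and> I11 f z = 0 \<and> I12 f z = 0)"

definition a1 :: "(jet \<Rightarrow> real) \<Rightarrow> (plane \<Rightarrow> real) \<Rightarrow> (plane \<Rightarrow> real) \<Rightarrow> jet \<Rightarrow> real" where
  "a1 f \<phi> \<psi> = (\<lambda>z. 1 / J f z * lift (jacobian \<phi> \<psi>) z)"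

definition transformation_system ::
    "(jet \<Rightarrow> real) \<Rightarrow> (plane \<Rightarrow> real) \<Rightarrow> (plane \<Rightarrow> real) \<Rightarrow> jet \<Rightarrow> bool" where
  "transformation_system f \<phi> \<psi> z \<longleftrightarrow>
     J f z = Dx f (lift \<phi>) z \<and>
     Dx f (a1 f \<phi> \<psi>) z / a1 f \<phi> \<psi> z = 1 / 3 * ((3 * Dx f (J f) z - J f z * pd_q f z) / J f z)"

end

theory Submission
  imports Defs
begin

text \<open>
  Write \<open>D\<close> for the total derivative along \<open>u''' = f\<close> and put \<open>j = D \<phi>\<close>, \<open>a = \<Delta> / j\<close> with the
  Jacobian \<open>\<Delta>\<close>, \<open>y = D j / j\<close>, \<open>e = D a / a\<close>. The prolonged variables satisfy
  \<open>D \<psi> = j P\<close>, \<open>D P = j Q\<close>, \<open>D Q = j R\<close>. Differentiating these equations by \<open>q\<close>, \<open>p\<close>, \<open>u\<close> and commuting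
  with \<open>D\<close> expresses all first derivatives of \<open>P\<close>, \<open>Q\<close>, \<open>R\<close> by \<open>f\<^sub>q\<close>, \<open>f\<^sub>p\<close>, \<open>f\<^sub>u\<close> and by \<open>j\<close>, \<open>a\<close>, \<open>e\<close>, \<open>y\<close>
  and their derivatives along \<open>D\<close> (lemma \<open>pd_R\<close>); no explicit formula for \<open>f\<close> is ever expanded.

  The transformation linearizes the equation iff the defect \<open>G = R - s P - \<psi>\<close> vanishes, and lemma \<open>pd_G\<close>
  splits the first-order part of this into three conditions: \<open>G\<^sub>q = 0\<close> iff
  \<open>f\<^sub>q = 3 (y - e)\<close>, which is the equation for \<open>a\<^sub>1\<close>; then \<open>G\<^sub>p = 0\<close> iff \<open>K = s\<close> (lemma \<open>K_eq\<close>); then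
  \<open>j G\<^sub>u = \<phi>\<^sub>u D G\<close> iff \<open>I\<^sub>3 = j\<^sup>3\<close> (lemma \<open>I3_eq\<close>). If \<open>G = 0\<close>, these give \<open>J = D \<phi>\<close>, the
  system for the transformation, \<open>s = K\<close>, and all the vanishing invariants. Conversely, if the system, \<open>K = s\<close> and
  \<open>I\<^sub>3 = J\<^sup>3\<close> hold, then \<open>G\<close> is a function \<open>\<kappa>(\<phi>)\<close>, and adding to \<open>\<psi>\<close> a
  solution \<open>\<gamma>(\<phi>)\<close> of \<open>\<gamma>''' = s \<gamma>' + \<gamma> - \<kappa>\<close> makes the defect zero.

  To solve the system, note that a function \<open>F\<close> with \<open>F\<^sub>q = 0\<close> and \<open>F\<^sub>u = D F\<^sub>p\<close> is locally the total
  derivative of a function of \<open>(x, u)\<close> (lemma \<open>total_derivative_of_function_of_x_u\<close>). For \<open>F = J\<close> these conditions are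
  \<open>I\<^sub>4 = 0\<close> and \<open>I\<^sub>6 = 0\<close>, which yields \<open>\<phi>\<close>. For \<open>F = 2 y - f\<^sub>q / 3\<close>, the value that
  \<open>D \<Delta> / \<Delta>\<close> has to take, they are \<open>I\<^sub>5 = 0\<close> and, \<open>K\<close> being constant, \<open>I\<^sub>7 = 0\<close> (lemma
  \<open>I7_eq\<close>), which yields \<open>\<Delta>\<close>; then \<open>\<psi>\<close> is found by solving a first-order linear equation with prescribed Jacobian.
\<close>

section \<open>Calculus of smooth functions\<close>

lemma frechet_derivative_eqI:
  "(f has_derivative f') (at x) \<Longrightarrow> frechet_derivative f (at x) = f'"
  by (simp add: frechet_derivative_at[symmetric])

lemma higher_differentiable_on_cong:
  assumes "open S" "\<And>x. x \<in> S \<Longrightarrow> f x = g x" "higher_differentiable_on S f n"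
  shows "higher_differentiable_on S g n"
  using assms(2,3)
proof (induction n arbitrary: f g)
  case 0
  then show ?case using continuous_on_cong by (metis higher_differentiable_on.simps(1))
next
  case (Suc n)
  have d: "(g has_derivative frechet_derivative f (at x)) (at x)" if "x \<in> S" for x
    using Suc.prems that assms(1)
    by (metis has_derivative_transform_within_open frechet_derivative_works higher_differentiable_on.simps(2))
  have "higher_differentiable_on S (\<lambda>x. frechet_derivative g (at x) v) n" for v
    by (rule Suc.IH[of "\<lambda>x. frechet_derivative f (at x) v"])
       (use Suc.prems frechet_derivative_eqI[OF d] in auto)
  then show ?case using d by (auto simp: differentiable_def)
qed

lemma higher_differentiable_on_SucI:
  assumes "open S" "\<And>x. x \<in> S \<Longrightarrow> (f has_derivative f' x) (at x)"
    and "\<And>v. higher_differentiable_on S (\<lambda>x. f' x v) n"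
  shows "higher_differentiable_on S f (Suc n)"
proof -
  have "higher_differentiable_on S (\<lambda>x. frechet_derivative f (at x) v) n" for v
    by (rule higher_differentiable_on_cong[OF assms(1) _ assms(3)[of v]])
       (simp add: frechet_derivative_eqI[OF assms(2)])
  then show ?thesis using assms(2) by (auto simp: differentiable_def)
qed

lemma higher_differentiable_on_SucD:
  assumes "higher_differentiable_on S f (Suc n)"
  shows "x \<in> S \<Longrightarrow> (f has_derivative frechet_derivative f (at x)) (at x)"
    and "higher_differentiable_on S (\<lambda>x. frechet_derivative f (at x) v) n"
  using assms by (auto simp: frechet_derivative_works[symmetric])

lemma higher_differentiable_on_pred:
  "higher_differentiable_on S f (Suc n) \<Longrightarrow> higher_differentiable_on S f n"
proof (induction n arbitrary: f)
  case 0
  then show ?case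
    by (auto intro!: differentiable_imp_continuous_on differentiable_at_imp_differentiable_on)
qed auto

lemma higher_differentiable_on_subset:
  "higher_differentiable_on S f n \<Longrightarrow> T \<subseteq> S \<Longrightarrow> higher_differentiable_on T f n"
  by (induction n arbitrary: f) (auto intro: continuous_on_subset)

lemma higher_differentiable_on_const: "open S \<Longrightarrow> higher_differentiable_on S (\<lambda>_. c) n"
proof (induction n arbitrary: c)
  case (Suc n)
  show ?case
    by (rule higher_differentiable_on_SucI[where f' = "\<lambda>_ _. 0"]) (use Suc in auto)
qed auto

lemma higher_differentiable_on_bounded_linear:
  assumes "open S" "bounded_linear f"
  shows "higher_differentiable_on S f n"
proof (cases n)
  case 0
  then show ?thesis using assms by (simp add: linear_continuous_on)
next
  case (Suc m)
  show ?thesis unfolding Suc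
    by (rule higher_differentiable_on_SucI[where f' = "\<lambda>_. f"])
       (auto intro: assms bounded_linear_imp_has_derivative higher_differentiable_on_const)
qed

lemma higher_differentiable_on_add:
  assumes "open S" "higher_differentiable_on S f n" "higher_differentiable_on S g n"
  shows "higher_differentiable_on S (\<lambda>x. f x + g x) n"
  using assms(2,3)
proof (induction n arbitrary: f g)
  case (Suc n)
  note D = Suc.prems[THEN higher_differentiable_on_SucD(1)]
    and H = Suc.prems[THEN higher_differentiable_on_SucD(2)]
  show ?case
    by (rule higher_differentiable_on_SucI[OF assms(1) has_derivative_add[OF D]])
       (auto intro!: Suc.IH H)
qed (auto intro: continuous_on_add)

lemma higher_differentiable_on_sum:
  assumes "open S" "finite I" "\<And>i. i \<in> I \<Longrightarrow> higher_differentiable_on S (f i) n"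
  shows "higher_differentiable_on S (\<lambda>x. \<Sum>i\<in>I. f i x) n"
  using assms(2,3)
  by (induction I) (auto intro!: higher_differentiable_on_const higher_differentiable_on_add assms(1))

lemma higher_differentiable_on_bilinear:
  assumes "bounded_bilinear B" "open S"
    "higher_differentiable_on S f n" "higher_differentiable_on S g n"
  shows "higher_differentiable_on S (\<lambda>x. B (f x) (g x)) n"
  using assms(3,4)
proof (induction n arbitrary: f g)
  case 0
  then show ?case using assms(1) by (auto intro: bounded_bilinear.continuous_on)
next
  case (Suc n)
  note D = Suc.prems[THEN higher_differentiable_on_SucD(1)]
    and H = Suc.prems[THEN higher_differentiable_on_SucD(2)]
  show ?case
    by (rule higher_differentiable_on_SucI[OF assms(2) bounded_bilinear.FDERIV[OF assms(1) D]])
       (auto intro!: Suc.IH H higher_differentiable_on_add assms Suc.prems[THEN higher_differentiable_on_pred])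
qed

text \<open>In an orthonormal basis, the derivative of a composition is a finite sum of products of
  directional derivatives of the outer function, composed with the inner one, and components of
  the derivative of the inner function; this is why the order can be raised by induction.\<close>

lemma higher_differentiable_on_compose:
  fixes g :: "'a::real_normed_vector \<Rightarrow> 'b::euclidean_space"
  assumes "open S" "open T" "g ` S \<subseteq> T"
    "higher_differentiable_on T f n" "higher_differentiable_on S g n"
  shows "higher_differentiable_on S (\<lambda>x. f (g x)) n"
  using assms(4,5)
proof (induction n arbitrary: f)
  case 0
  then show ?case using assms(3) by (auto intro: continuous_on_compose2)
next
  case (Suc n)
  note D = Suc.prems[THEN higher_differentiable_on_SucD(1)]
    and H = Suc.prems[THEN higher_differentiable_on_SucD(2)]
  let ?f' = "\<lambda>y. frechet_derivative f (at y)" and ?g' = "\<lambda>x. frechet_derivative g (at x)"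
  have "((\<lambda>x. f (g x)) has_derivative
      (\<lambda>v. \<Sum>b\<in>Basis. (?g' x v \<bullet> b) *\<^sub>R ?f' (g x) b)) (at x)" if x: "x \<in> S" for x
  proof -
    have lin: "linear (?f' (g x))"
      using D(1) assms(3) x by (meson has_derivative_linear image_subset_iff)
    have "?f' (g x) (?g' x v) = (\<Sum>b\<in>Basis. (?g' x v \<bullet> b) *\<^sub>R ?f' (g x) b)" for v
      by (subst euclidean_representation[symmetric])
         (simp add: linear_sum[OF lin] linear_cmul[OF lin])
    then show ?thesis
      using has_derivative_compose[OF D(2)[OF x] D(1)[of "g x"]] assms(3) x by auto
  qed
  then show ?case
  proof (rule higher_differentiable_on_SucI[OF assms(1)])
    fix v
    have "higher_differentiable_on S (\<lambda>x. ?g' x v \<bullet> b) n" for b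
      by (rule higher_differentiable_on_bilinear[OF bounded_bilinear_inner])
         (auto intro: assms(1) H higher_differentiable_on_const)
    then show "higher_differentiable_on S (\<lambda>x. \<Sum>b\<in>Basis. (?g' x v \<bullet> b) *\<^sub>R ?f' (g x) b) n"
      by (intro higher_differentiable_on_sum higher_differentiable_on_bilinear[OF bounded_bilinear_scaleR]
          assms(1) finite_Basis Suc.IH H Suc.prems[THEN higher_differentiable_on_pred])
  qed
qed

lemma higher_differentiable_on_Pair:
  fixes f :: "'a::real_normed_vector \<Rightarrow> 'b::real_normed_vector"
    and g :: "'a \<Rightarrow> 'c::real_normed_vector"
  assumes "open S" "higher_differentiable_on S f n" "higher_differentiable_on S g n"
  shows "higher_differentiable_on S (\<lambda>x. (f x, g x)) n"
  using assms(2,3)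
proof (induction n arbitrary: f g)
  case (Suc n)
  note D = Suc.prems[THEN higher_differentiable_on_SucD(1)]
    and H = Suc.prems[THEN higher_differentiable_on_SucD(2)]
  show ?case
    by (rule higher_differentiable_on_SucI[OF assms(1) has_derivative_Pair[OF D]])
       (auto intro!: Suc.IH H)
qed (auto intro: continuous_on_Pair)

lemma smooth_onD: "smooth_on S f \<Longrightarrow> higher_differentiable_on S f n"
  by (simp add: smooth_on_def)

lemma smooth_on_cong:
  assumes "open S" "\<And>x. x \<in> S \<Longrightarrow> f x = g x" "smooth_on S f"
  shows "smooth_on S g"
  unfolding smooth_on_def
  by (intro allI) (rule higher_differentiable_on_cong[OF assms(1,2) smooth_onD[OF assms(3)]])

lemma smooth_on_subset: "smooth_on S f \<Longrightarrow> T \<subseteq> S \<Longrightarrow> smooth_on T f"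
  using higher_differentiable_on_subset[of S f _ T] by (auto simp: smooth_on_def)

lemma smooth_on_has_derivative:
  assumes "smooth_on S f" "x \<in> S"
  shows "(f has_derivative frechet_derivative f (at x)) (at x)"
  by (rule higher_differentiable_on_SucD(1)[OF smooth_onD[OF assms(1), of "Suc 0"] assms(2)])

lemma smooth_on_frechet_derivative:
  assumes "smooth_on S f"
  shows "smooth_on S (\<lambda>x. frechet_derivative f (at x) v)"
  unfolding smooth_on_def
proof
  show "higher_differentiable_on S (\<lambda>x. frechet_derivative f (at x) v) n" for n
    by (rule higher_differentiable_on_SucD(2)[OF smooth_onD[OF assms, of "Suc n"]])
qed

lemma smooth_on_continuous_on: "smooth_on S f \<Longrightarrow> continuous_on S f"
  using smooth_onD[of S f 0] by simp

text \<open>For functions that occur in their own derivative (inverse, root, exponential, local inverses):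
  the order reached so far is passed on to the derivative, and so raised by one.\<close>

lemma smooth_on_bootstrap:
  assumes "open S" "\<And>x. x \<in> S \<Longrightarrow> (f has_derivative f' x) (at x)"
    and "\<And>n v. higher_differentiable_on S f n \<Longrightarrow> higher_differentiable_on S (\<lambda>x. f' x v) n"
  shows "smooth_on S f"
  unfolding smooth_on_def
proof
  fix n show "higher_differentiable_on S f n"
  proof (induction n)
    case 0
    have "continuous_on S f"
      by (rule has_derivative_continuous_on) (rule has_derivative_at_withinI[OF assms(2)])
    then show ?case by simp
  next
    case (Suc n)
    show ?case by (rule higher_differentiable_on_SucI[OF assms(1,2) assms(3)[OF Suc]])
  qed
qed

lemma smooth_on_const [simp]: "open S \<Longrightarrow> smooth_on S (\<lambda>_. c)"
  by (simp add: smooth_on_def higher_differentiable_on_const)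

lemma smooth_on_bounded_linear: "open S \<Longrightarrow> bounded_linear f \<Longrightarrow> smooth_on S f"
  by (simp add: smooth_on_def higher_differentiable_on_bounded_linear)

lemma smooth_on_add [simp]:
  "open S \<Longrightarrow> smooth_on S f \<Longrightarrow> smooth_on S g \<Longrightarrow> smooth_on S (\<lambda>x. f x + g x)"
  by (simp add: smooth_on_def higher_differentiable_on_add)

lemma smooth_on_bilinear:
  "bounded_bilinear B \<Longrightarrow> open S \<Longrightarrow> smooth_on S f \<Longrightarrow> smooth_on S g \<Longrightarrow>
   smooth_on S (\<lambda>x. B (f x) (g x))"
  by (simp add: smooth_on_def higher_differentiable_on_bilinear)

lemma smooth_on_mult [simp]:
  fixes f g :: "_ \<Rightarrow> 'b::real_normed_algebra"
  shows "open S \<Longrightarrow> smooth_on S f \<Longrightarrow> smooth_on S g \<Longrightarrow> smooth_on S (\<lambda>x. f x * g x)"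
  by (rule smooth_on_bilinear[OF bounded_bilinear_mult])

lemma smooth_on_compose:
  fixes g :: "'a::real_normed_vector \<Rightarrow> 'b::euclidean_space"
  assumes "open S" "open T" "g ` S \<subseteq> T" "smooth_on T f" "smooth_on S g"
  shows "smooth_on S (\<lambda>x. f (g x))"
  unfolding smooth_on_def
  by (intro allI)
     (rule higher_differentiable_on_compose[OF assms(1-3) assms(4,5)[THEN smooth_onD]])

lemma smooth_on_compose_bounded_linear:
  assumes "open S" "bounded_linear h" "smooth_on S f"
  shows "smooth_on S (\<lambda>x. h (f x))"
proof -
  have "higher_differentiable_on S (\<lambda>x. h (f x)) n" if "higher_differentiable_on S f n" for n f
    using that
  proof (induction n arbitrary: f)
    case 0
    then show ?case
      by (auto intro: bounded_linear.continuous_on[OF assms(2)])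
  next
    case (Suc n)
    show ?case
      by (rule higher_differentiable_on_SucI[OF assms(1)
            bounded_linear.has_derivative[OF assms(2) higher_differentiable_on_SucD(1)[OF Suc.prems]]])
         (auto intro!: Suc.IH higher_differentiable_on_SucD(2)[OF Suc.prems])
  qed
  with assms(3) show ?thesis by (simp add: smooth_on_def)
qed

lemma smooth_on_Pair [simp]:
  "open S \<Longrightarrow> smooth_on S f \<Longrightarrow> smooth_on S g \<Longrightarrow> smooth_on S (\<lambda>x. (f x, g x))"
  by (simp add: smooth_on_def higher_differentiable_on_Pair)

lemma smooth_on_minus [simp]: "open S \<Longrightarrow> smooth_on S f \<Longrightarrow> smooth_on S (\<lambda>x. - f x)"
  by (rule smooth_on_compose_bounded_linear[OF _ bounded_linear_minus[OF bounded_linear_ident]])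

lemma smooth_on_diff [simp]:
  "open S \<Longrightarrow> smooth_on S f \<Longrightarrow> smooth_on S g \<Longrightarrow> smooth_on S (\<lambda>x. f x - g x)"
  using smooth_on_add[of S f "\<lambda>x. - g x"] by simp

lemma smooth_on_power [simp]:
  fixes f :: "_ \<Rightarrow> 'b::{real_normed_algebra,monoid_mult}"
  shows "open S \<Longrightarrow> smooth_on S f \<Longrightarrow> smooth_on S (\<lambda>x. f x ^ n)"
  by (induction n) auto

lemma smooth_on_inverse:
  fixes f :: "'a::real_normed_vector \<Rightarrow> real"
  assumes "open S" "smooth_on S f" "\<And>x. x \<in> S \<Longrightarrow> f x \<noteq> 0"
  shows "smooth_on S (\<lambda>x. inverse (f x))"
proof (rule smooth_on_compose[OF assms(1) _ _ _ assms(2), of "- {0}"])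
  show "smooth_on (- {0::real}) inverse"
  proof (rule smooth_on_bootstrap[where f' = "\<lambda>x v. - (inverse x * v * inverse x)"])
    fix n and v :: real assume "higher_differentiable_on (- {0::real}) inverse n"
    then have "higher_differentiable_on (- {0::real}) (\<lambda>x. (- v) * (inverse x * inverse x)) n"
      by (intro higher_differentiable_on_bilinear[OF bounded_bilinear_mult]
          higher_differentiable_on_const) auto
    then show "higher_differentiable_on (- {0::real}) (\<lambda>x. - (inverse x * v * inverse x)) n"
      by (simp add: algebra_simps)
  qed (auto intro!: has_derivative_inverse')
qed (use assms(3) in auto)

lemma smooth_on_divide [simp]:
  fixes f g :: "'a::real_normed_vector \<Rightarrow> real"
  assumes "open S" "smooth_on S f" "smooth_on S g" "\<And>x. x \<in> S \<Longrightarrow> g x \<noteq> 0"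
  shows "smooth_on S (\<lambda>x. f x / g x)"
  using smooth_on_mult[OF assms(1,2) smooth_on_inverse[OF assms(1,3,4)]]
  by (simp add: divide_inverse)

lemma smooth_on_root3:
  fixes f :: "'a::real_normed_vector \<Rightarrow> real"
  assumes "open S" "smooth_on S f" "\<And>x. x \<in> S \<Longrightarrow> f x \<noteq> 0"
  shows "smooth_on S (\<lambda>x. root 3 (f x))"
proof (rule smooth_on_compose[OF assms(1) _ _ _ assms(2), of "- {0}"])
  show "smooth_on (- {0::real}) (root 3)"
  proof (rule smooth_on_bootstrap[where f' = "\<lambda>x v. inverse (3 * (root 3 x)^2) * v"])
    fix x :: real assume "x \<in> - {0}"
    then show "(root 3 has_derivative (*) (inverse (3 * (root 3 x)^2))) (at x)"
      using DERIV_odd_real_root[of 3 x] by (simp add: has_field_derivative_def)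
  next
    fix n and v :: real assume H: "higher_differentiable_on (- {0::real}) (root 3) n"
    have op: "open (- {0::real})" by auto
    have "smooth_on (- {0}) (\<lambda>x::real. inverse (3 * x^2))"
      by (rule smooth_on_inverse[OF op smooth_on_mult[OF op smooth_on_const[OF op] smooth_on_power[OF op
              smooth_on_bounded_linear[OF op bounded_linear_ident]]]]) auto
    then have "higher_differentiable_on (- {0}) (\<lambda>x::real. inverse (3 * (root 3 x)^2)) n"
      by (intro higher_differentiable_on_compose[OF op op _ smooth_onD H]) auto
    then show "higher_differentiable_on (- {0}) (\<lambda>x::real. inverse (3 * (root 3 x)^2) * v) n"
      by (intro higher_differentiable_on_bilinear[OF bounded_bilinear_mult]
          higher_differentiable_on_const) auto
  qed auto
qed (use assms(3) in auto)

text \<open>Equality of mixed derivatives, by the mean value theorem applied in both orders to the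
  second difference of \<open>f\<close> along \<open>v\<close> and \<open>w\<close>.\<close>

lemma second_difference_mean_value:
  fixes f :: "'a::real_normed_vector \<Rightarrow> real"
  assumes f: "smooth_on S f" and "h > 0"
    and S: "\<And>s t. 0 \<le> s \<Longrightarrow> s \<le> h \<Longrightarrow> 0 \<le> t \<Longrightarrow> t \<le> h \<Longrightarrow> z + s *\<^sub>R v + t *\<^sub>R w \<in> S"
  shows "\<exists>s t. 0 < s \<and> s < h \<and> 0 < t \<and> t < h \<and>
    f (z + h *\<^sub>R v + h *\<^sub>R w) - f (z + h *\<^sub>R v) - f (z + h *\<^sub>R w) + f z
      = h * h * frechet_derivative (\<lambda>x. frechet_derivative f (at x) v) (at (z + s *\<^sub>R v + t *\<^sub>R w)) w"
proof -
  let ?f' = "\<lambda>x. frechet_derivative f (at x)"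
  let ?g = "\<lambda>s. f (z + s *\<^sub>R v + h *\<^sub>R w) - f (z + s *\<^sub>R v)"
  have d: "((\<lambda>s. F (a + s *\<^sub>R b)) has_real_derivative frechet_derivative F (at (a + s *\<^sub>R b)) b) (at s)"
    if "smooth_on S F" "a + s *\<^sub>R b \<in> S" for F :: "'a \<Rightarrow> real" and a b s
  proof -
    note D = smooth_on_has_derivative[OF that]
    have "((\<lambda>s. F (a + s *\<^sub>R b)) has_derivative
        (\<lambda>t. frechet_derivative F (at (a + s *\<^sub>R b)) (t *\<^sub>R b))) (at s)"
      by (rule has_derivative_compose[where f = "\<lambda>s. a + s *\<^sub>R b" and g = F, OF _ D])
         (auto intro!: derivative_eq_intros)
    then show ?thesis
      by (simp add: has_field_derivative_def linear_cmul[OF has_derivative_linear[OF D]] mult_commute_abs)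
  qed
  have "\<exists>s. 0 < s \<and> s < h \<and> ?g h - ?g 0 = (h - 0) * (?f' (z + s *\<^sub>R v + h *\<^sub>R w) v - ?f' (z + s *\<^sub>R v) v)"
  proof (rule MVT2)
    fix s assume s: "0 \<le> s" "s \<le> h"
    have "(z + h *\<^sub>R w) + s *\<^sub>R v \<in> S" "z + s *\<^sub>R v \<in> S"
      using S[of s h] S[of s 0] s \<open>h > 0\<close> by (simp_all add: ac_simps)
    then have "((\<lambda>s. f ((z + h *\<^sub>R w) + s *\<^sub>R v)) has_real_derivative ?f' ((z + h *\<^sub>R w) + s *\<^sub>R v) v) (at s)"
      "((\<lambda>s. f (z + s *\<^sub>R v)) has_real_derivative ?f' (z + s *\<^sub>R v) v) (at s)"
      by (auto intro: d[OF f])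
    from DERIV_diff[OF this]
    show "(?g has_real_derivative (?f' (z + s *\<^sub>R v + h *\<^sub>R w) v - ?f' (z + s *\<^sub>R v) v)) (at s)"
      by (simp add: ac_simps)
  qed (use \<open>h > 0\<close> in auto)
  then obtain s where s: "0 < s" "s < h"
    "?g h - ?g 0 = h * (?f' (z + s *\<^sub>R v + h *\<^sub>R w) v - ?f' (z + s *\<^sub>R v) v)" by auto
  have "\<exists>t. 0 < t \<and> t < h \<and> ?f' ((z + s *\<^sub>R v) + h *\<^sub>R w) v - ?f' ((z + s *\<^sub>R v) + 0 *\<^sub>R w) v
      = (h - 0) * frechet_derivative (\<lambda>x. ?f' x v) (at ((z + s *\<^sub>R v) + t *\<^sub>R w)) w"
    by (rule MVT2) (use S s \<open>h > 0\<close> in \<open>auto intro!: d smooth_on_frechet_derivative f\<close>)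
  then obtain t where t: "0 < t" "t < h"
    "?f' (z + s *\<^sub>R v + h *\<^sub>R w) v - ?f' (z + s *\<^sub>R v) v
      = h * frechet_derivative (\<lambda>x. ?f' x v) (at (z + s *\<^sub>R v + t *\<^sub>R w)) w" by auto
  have "f (z + h *\<^sub>R v + h *\<^sub>R w) - f (z + h *\<^sub>R v) - f (z + h *\<^sub>R w) + f z = ?g h - ?g 0"
    by simp
  also have "\<dots> = h * h * frechet_derivative (\<lambda>x. ?f' x v) (at (z + s *\<^sub>R v + t *\<^sub>R w)) w"
    unfolding s(3) t(3) by simp
  finally show ?thesis using s(1,2) t(1,2) by blast
qed

lemma frechet_derivative_commute:
  fixes f :: "'a::real_normed_vector \<Rightarrow> real"
  assumes "open S" and f: "smooth_on S f" and z: "z \<in> S"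
  shows "frechet_derivative (\<lambda>x. frechet_derivative f (at x) v) (at z) w
       = frechet_derivative (\<lambda>x. frechet_derivative f (at x) w) (at z) v"
    (is "?A z = ?B z")
proof (rule ccontr)
  assume ne: "?A z \<noteq> ?B z"
  define \<epsilon> where "\<epsilon> = \<bar>?A z - ?B z\<bar> / 2"
  have "\<epsilon> > 0" using ne by (simp add: \<epsilon>_def)
  have "isCont ?A z" "isCont ?B z"
    using smooth_on_continuous_on[OF smooth_on_frechet_derivative[OF smooth_on_frechet_derivative[OF f]]]
      z \<open>open S\<close> by (simp_all add: continuous_on_eq_continuous_at)
  then have "(?A \<longlongrightarrow> ?A z) (nhds z)" "(?B \<longlongrightarrow> ?B z) (nhds z)"
    unfolding isCont_def tendsto_at_iff_tendsto_nhds[where g = ?A]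
      tendsto_at_iff_tendsto_nhds[where g = ?B] .
  then have "\<forall>\<^sub>F x in nhds z. dist (?A x) (?A z) < \<epsilon>" "\<forall>\<^sub>F x in nhds z. dist (?B x) (?B z) < \<epsilon>"
    using \<open>\<epsilon> > 0\<close> by (auto dest: tendstoD)
  moreover have "\<forall>\<^sub>F x in nhds z. x \<in> S"
    using \<open>open S\<close> z by (simp add: eventually_nhds_in_open)
  ultimately have "\<forall>\<^sub>F x in nhds z. dist (?A x) (?A z) < \<epsilon> \<and> dist (?B x) (?B z) < \<epsilon> \<and> x \<in> S"
    by eventually_elim auto
  then obtain d where "d > 0"
    and d: "\<And>x. dist x z < d \<Longrightarrow> dist (?A x) (?A z) < \<epsilon> \<and> dist (?B x) (?B z) < \<epsilon> \<and> x \<in> S"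
    by (auto simp: eventually_nhds_metric)
  define c where "c = norm v + norm w + 1"
  have "c > 0" by (simp add: c_def add_nonneg_pos)
  define h where "h = d / (2 * c)"
  have "h > 0" using \<open>d > 0\<close> \<open>c > 0\<close> by (simp add: h_def)
  have small: "dist (z + s *\<^sub>R v + t *\<^sub>R w) z < d" if "0 \<le> s" "s \<le> h" "0 \<le> t" "t \<le> h" for s t
  proof -
    have "dist (z + s *\<^sub>R v + t *\<^sub>R w) z \<le> norm (s *\<^sub>R v) + norm (t *\<^sub>R w)"
      by (metis add.assoc add_diff_cancel_left' dist_norm norm_triangle_ineq)
    also have "\<dots> \<le> h * norm v + h * norm w"
      using that by (auto intro!: add_mono mult_right_mono)
    also have "\<dots> \<le> h * c" using \<open>h > 0\<close> by (simp add: c_def algebra_simps)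
    also have "\<dots> = d / 2" using \<open>c > 0\<close> by (simp add: h_def)
    finally show ?thesis using \<open>d > 0\<close> by simp
  qed
  obtain s t where st: "0 < s" "s < h" "0 < t" "t < h"
    "f (z + h *\<^sub>R v + h *\<^sub>R w) - f (z + h *\<^sub>R v) - f (z + h *\<^sub>R w) + f z = h * h * ?A (z + s *\<^sub>R v + t *\<^sub>R w)"
    using second_difference_mean_value[OF f \<open>h > 0\<close>, of z v w] small d by blast
  obtain s' t' where st': "0 < s'" "s' < h" "0 < t'" "t' < h"
    "f (z + h *\<^sub>R w + h *\<^sub>R v) - f (z + h *\<^sub>R w) - f (z + h *\<^sub>R v) + f z = h * h * ?B (z + s' *\<^sub>R w + t' *\<^sub>R v)"
    using second_difference_mean_value[OF f \<open>h > 0\<close>, of z w v] small d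
    by (smt (verit, best) add.assoc add.commute)
  have "h * h * ?A (z + s *\<^sub>R v + t *\<^sub>R w) = h * h * ?B (z + s' *\<^sub>R w + t' *\<^sub>R v)"
    unfolding st(5)[symmetric] st'(5)[symmetric] by (simp add: algebra_simps)
  then have eq: "?A (z + s *\<^sub>R v + t *\<^sub>R w) = ?B (z + s' *\<^sub>R w + t' *\<^sub>R v)" using \<open>h > 0\<close> by simp
  have "dist (?A (z + s *\<^sub>R v + t *\<^sub>R w)) (?A z) < \<epsilon>"
    using d[OF small] st by simp
  moreover have "dist (?B (z + s' *\<^sub>R w + t' *\<^sub>R v)) (?B z) < \<epsilon>"
    using d[OF small[of t' s']] st' by (simp add: ac_simps)
  ultimately show False using eq by (simp add: dist_real_def \<epsilon>_def abs_if split: if_splits)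
qed

section \<open>Derivations of functions on the jet space\<close>

text \<open>Only the rules of differentiation are kept, so that the coordinate derivatives and the total
  derivative, whose coefficients vary, are calculated with in the same way.\<close>

locale derivation =
  fixes W :: "'a::real_normed_vector set" and d :: "('a \<Rightarrow> real) \<Rightarrow> 'a \<Rightarrow> real"
  assumes open_W: "open W"
    and smooth [simp]: "smooth_on W F \<Longrightarrow> smooth_on W (d F)"
    and cong: "\<lbrakk>smooth_on W F; \<And>z. z \<in> W \<Longrightarrow> F z = G z; z \<in> W\<rbrakk> \<Longrightarrow> d F z = d G z"
    and const [simp]: "z \<in> W \<Longrightarrow> d (\<lambda>_. c) z = 0"
    and add [simp]: "\<lbrakk>smooth_on W F; smooth_on W G; z \<in> W\<rbrakk> \<Longrightarrow> d (\<lambda>z. F z + G z) z = d F z + d G z"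
    and mult [simp]: "\<lbrakk>smooth_on W F; smooth_on W G; z \<in> W\<rbrakk> \<Longrightarrow>
      d (\<lambda>z. F z * G z) z = F z * d G z + d F z * G z"
begin

lemma zero: "\<lbrakk>\<And>z. z \<in> W \<Longrightarrow> F z = 0; z \<in> W\<rbrakk> \<Longrightarrow> d F z = 0"
  using cong[of "\<lambda>_. 0" F z] open_W by simp

lemma minus [simp]: "\<lbrakk>smooth_on W F; z \<in> W\<rbrakk> \<Longrightarrow> d (\<lambda>z. - F z) z = - d F z"
  using mult[of "\<lambda>_. - 1" F z] open_W by simp

lemma diff [simp]:
  "\<lbrakk>smooth_on W F; smooth_on W G; z \<in> W\<rbrakk> \<Longrightarrow> d (\<lambda>z. F z - G z) z = d F z - d G z"
  using add[of F "\<lambda>z. - G z" z] open_W by simp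

lemma square [simp]: "\<lbrakk>smooth_on W F; z \<in> W\<rbrakk> \<Longrightarrow> d (\<lambda>z. (F z)\<^sup>2) z = 2 * F z * d F z"
  using mult[of F F z] by (simp add: power2_eq_square)

lemma divide:
  assumes "smooth_on W F" "smooth_on W G" "\<And>z. z \<in> W \<Longrightarrow> G z \<noteq> 0" "z \<in> W"
  shows "d (\<lambda>z. F z / G z) z = (d F z * G z - F z * d G z) / (G z)\<^sup>2"
proof -
  have s: "smooth_on W (\<lambda>z. F z / G z)" using assms open_W by simp
  have "d F z = d (\<lambda>z. G z * (F z / G z)) z"
    by (rule cong) (use assms in auto)
  also have "\<dots> = G z * d (\<lambda>z. F z / G z) z + d G z * (F z / G z)"
    using mult[OF assms(2) s assms(4)] .
  finally show ?thesis using assms(3)[OF assms(4)] by (simp add: field_simps power2_eq_square)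
qed

end

text \<open>Ties a coordinate derivative, defined through a single variable, to the Frechet derivative in
  direction \<open>v\<close>; for nonsmooth functions the two may differ.\<close>

definition directional ::
    "'a::real_normed_vector set \<Rightarrow> 'a \<Rightarrow> (('a \<Rightarrow> real) \<Rightarrow> 'a \<Rightarrow> real) \<Rightarrow> bool" where
  "directional W v d \<longleftrightarrow>
     (\<forall>F z. smooth_on W F \<longrightarrow> z \<in> W \<longrightarrow> d F z = frechet_derivative F (at z) v)"

lemma directionalD:
  "\<lbrakk>directional W v d; smooth_on W F; z \<in> W\<rbrakk> \<Longrightarrow> d F z = frechet_derivative F (at z) v"
  by (simp add: directional_def)

lemma directional_smooth:
  assumes "open W" "directional W v d" "smooth_on W F"
  shows "smooth_on W (d F)"
  using smooth_on_cong[OF assms(1) _ smooth_on_frechet_derivative[OF assms(3)]]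
    directionalD[OF assms(2,3)] by simp

lemma directional_derivation:
  assumes W: "open W" and d: "directional W v d"
  shows "derivation W d"
proof
  show "open W" by (rule W)
  show "smooth_on W (d F)" if "smooth_on W F" for F
    by (rule directional_smooth[OF W d that])
  show "d (\<lambda>_. c) z = 0" if "z \<in> W" for c z
    using directionalD[OF d smooth_on_const[OF W] that] by simp
  fix F G :: "'a \<Rightarrow> real" and z assume F: "smooth_on W F" and z: "z \<in> W"
  show "d F z = d G z" if eq: "\<And>z. z \<in> W \<Longrightarrow> F z = G z"
  proof -
    have "smooth_on W G" by (rule smooth_on_cong[OF W eq F])
    moreover have "frechet_derivative F (at z) = frechet_derivative G (at z)"
      by (rule frechet_derivative_transform_within_open[OF _ W z eq])
         (rule differentiableI[OF smooth_on_has_derivative[OF F z]])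
    ultimately show ?thesis
      using directionalD[OF d F z] directionalD[OF d _ z, of G] by simp
  qed
  assume G: "smooth_on W G"
  note FG = F[THEN smooth_on_has_derivative, OF z] G[THEN smooth_on_has_derivative, OF z]
  note FG_eq = directionalD[OF d F z] directionalD[OF d G z]
  show "d (\<lambda>z. F z + G z) z = d F z + d G z"
    using directionalD[OF d smooth_on_add[OF W F G] z]
    unfolding FG_eq frechet_derivative_eqI[OF has_derivative_add[OF FG]] by simp
  show "d (\<lambda>z. F z * G z) z = F z * d G z + d F z * G z"
    using directionalD[OF d smooth_on_mult[OF W F G] z]
    unfolding FG_eq frechet_derivative_eqI[OF has_derivative_mult[OF FG]] by simp
qed

lemma directional_commute:
  assumes W: "open W" and d: "directional W v d" and e: "directional W w e"
    and F: "smooth_on W F" and z: "z \<in> W"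
  shows "d (e F) z = e (d F) z"
proof -
  have *: "b (c F) z = frechet_derivative (\<lambda>x. frechet_derivative F (at x) w) (at z) v"
    if "directional W v b" "directional W w c" for b c v w
  proof -
    have "b (c F) z = frechet_derivative (c F) (at z) v"
      by (rule directionalD[OF that(1) directional_smooth[OF W that(2) F] z])
    also have "frechet_derivative (c F) (at z) = frechet_derivative (\<lambda>x. frechet_derivative F (at x) w) (at z)"
      by (rule frechet_derivative_transform_within_open[OF _ W z directionalD[OF that(2) F]])
         (rule differentiableI[OF smooth_on_has_derivative[OF directional_smooth[OF W that(2) F] z]])
    finally show ?thesis .
  qed
  show ?thesis unfolding *[OF d e] *[OF e d] by (rule frechet_derivative_commute[OF W F z])
qed

lemma deriv_along_line:
  assumes "smooth_on W F" "z \<in> W" "c t0 = z" "(c has_derivative (\<lambda>h. h *\<^sub>R v)) (at t0)"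
  shows "((\<lambda>t. F (c t)) has_real_derivative frechet_derivative F (at z) v) (at t0)"
proof -
  note D = smooth_on_has_derivative[OF assms(1,2)]
  have "((\<lambda>t. F (c t)) has_derivative (\<lambda>h. frechet_derivative F (at z) (h *\<^sub>R v))) (at t0)"
    by (rule has_derivative_compose[where f = c and g = F, OF assms(4)]) (use D assms(3) in simp)
  then show ?thesis
    by (simp add: has_field_derivative_def linear_cmul[OF has_derivative_linear[OF D]] mult_commute_abs)
qed

lemma directional_pd:
  assumes "open W"
  shows "directional W (1, 0, 0, 0) pd_x" "directional W (0, 1, 0, 0) pd_u"
    "directional W (0, 0, 1, 0) pd_p" "directional W (0, 0, 0, 1) pd_q"
  unfolding directional_def pd_x_def pd_u_def pd_p_def pd_q_def
  by (auto intro!: DERIV_imp_deriv deriv_along_line derivative_eq_intros simp: zero_prod_def)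


locale jet_calculus =
  fixes W :: "jet set" and f :: "jet \<Rightarrow> real"
  assumes open_W [simp]: "open W" and smooth_f [simp]: "smooth_on W f"
begin

abbreviation D :: "(jet \<Rightarrow> real) \<Rightarrow> jet \<Rightarrow> real" where "D \<equiv> Dx f"

sublocale x: derivation W pd_x by (rule directional_derivation[OF open_W directional_pd(1)]) simp
sublocale u: derivation W pd_u by (rule directional_derivation[OF open_W directional_pd(2)]) simp
sublocale p: derivation W pd_p by (rule directional_derivation[OF open_W directional_pd(3)]) simp
sublocale q: derivation W pd_q by (rule directional_derivation[OF open_W directional_pd(4)]) simp

lemma Dx_eq:
  "D F = (\<lambda>z. pd_x F z + fst (snd (snd z)) * pd_u F z + snd (snd (snd z)) * pd_p F z + f z * pd_q F z)"
  by (auto simp: Dx_def)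

lemma smooth_coordinates [simp]:
  "smooth_on W (\<lambda>z. fst (snd (snd z)))" "smooth_on W (\<lambda>z. snd (snd (snd z)))"
  by (intro smooth_on_bounded_linear open_W bounded_linear_intros)+

sublocale D: derivation W D
proof
  fix F G :: "jet \<Rightarrow> real" and z assume F: "smooth_on W F" and z: "z \<in> W"
  show "D F z = D G z" if "\<And>z. z \<in> W \<Longrightarrow> F z = G z"
    using x.cong[OF F that z] u.cong[OF F that z] p.cong[OF F that z] q.cong[OF F that z]
    by (simp add: Dx_eq)
  assume G: "smooth_on W G"
  show "D (\<lambda>z. F z + G z) z = D F z + D G z" "D (\<lambda>z. F z * G z) z = F z * D G z + D F z * G z"
    using F G z by (simp_all add: Dx_eq algebra_simps)
qed (simp_all add: Dx_eq)

lemma pd_coordinates: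
  "pd_x (\<lambda>z. fst (snd (snd z))) z = 0" "pd_x (\<lambda>z. snd (snd (snd z))) z = 0"
  "pd_u (\<lambda>z. fst (snd (snd z))) z = 0" "pd_u (\<lambda>z. snd (snd (snd z))) z = 0"
  "pd_p (\<lambda>z. fst (snd (snd z))) z = 1" "pd_p (\<lambda>z. snd (snd (snd z))) z = 0"
  "pd_q (\<lambda>z. fst (snd (snd z))) z = 0" "pd_q (\<lambda>z. snd (snd (snd z))) z = 1"
  by (cases z; simp add: pd_x_def pd_u_def pd_p_def pd_q_def)+

lemma pd_commute:
  assumes "smooth_on W F" "z \<in> W"
  shows "pd_u (pd_x F) z = pd_x (pd_u F) z" "pd_p (pd_x F) z = pd_x (pd_p F) z"
    "pd_q (pd_x F) z = pd_x (pd_q F) z" "pd_p (pd_u F) z = pd_u (pd_p F) z"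
    "pd_q (pd_u F) z = pd_u (pd_q F) z" "pd_q (pd_p F) z = pd_p (pd_q F) z"
  using directional_commute[OF open_W _ _ assms] directional_pd[OF open_W] by simp_all

text \<open>Since \<open>D = \<partial>\<^sub>x + p \<partial>\<^sub>u + q \<partial>\<^sub>p + f \<partial>\<^sub>q\<close>, the commutator of \<open>D\<close> with a coordinate derivation
  differentiates the coefficients only.\<close>

lemma D_commute:
  assumes "smooth_on W F" "z \<in> W"
  shows "pd_u (D F) z = D (pd_u F) z + pd_u f z * pd_q F z"
    "pd_p (D F) z = D (pd_p F) z + pd_u F z + pd_p f z * pd_q F z"
    "pd_q (D F) z = D (pd_q F) z + pd_p F z + pd_q f z * pd_q F z"
  using assms by (simp_all add: Dx_eq pd_coordinates pd_commute algebra_simps)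

lemma smooth_lift:
  assumes "open V" "smooth_on V \<phi>" "\<And>x u p q. (x, u, p, q) \<in> W \<Longrightarrow> (x, u) \<in> V"
  shows "smooth_on W (lift \<phi>)"
proof -
  have "smooth_on W (\<lambda>z. \<phi> ((\<lambda>z. (fst z, fst (snd z))) z))"
    by (rule smooth_on_compose[OF open_W assms(1) _ assms(2)])
       (use assms(3) in \<open>auto intro!: smooth_on_bounded_linear bounded_linear_intros\<close>)
  moreover have "lift \<phi> = (\<lambda>z. \<phi> (fst z, fst (snd z)))" by (auto simp: lift_def)
  ultimately show ?thesis by simp
qed

end

lemma pd_lift [simp]: "pd_p (lift \<phi>) z = 0" "pd_q (lift \<phi>) z = 0"
  by (cases z; simp add: lift_def pd_p_def pd_q_def)+

lemma lift_jacobian: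
  "lift (jacobian \<phi> \<psi>) z = pd_x (lift \<phi>) z * pd_u (lift \<psi>) z - pd_u (lift \<phi>) z * pd_x (lift \<psi>) z"
  by (cases z) (simp add: lift_def jacobian_def pd_x_def pd_u_def)

section \<open>Structure equations of a prolonged point transformation\<close>

locale prolonged_transformation = jet_calculus +
  fixes \<phi> \<psi> :: "plane \<Rightarrow> real"
  assumes smooth_\<phi> [simp]: "smooth_on W (lift \<phi>)" and smooth_\<psi> [simp]: "smooth_on W (lift \<psi>)"
    and D\<phi>_nz: "z \<in> W \<Longrightarrow> D (lift \<phi>) z \<noteq> 0"
    and jacobian_nz: "z \<in> W \<Longrightarrow> lift (jacobian \<phi> \<psi>) z \<noteq> 0"
begin

definition "j = D (lift \<phi>)"
definition "h = pd_u (lift \<phi>)"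
definition "a = (\<lambda>z. lift (jacobian \<phi> \<psi>) z / j z)"
definition "y = (\<lambda>z. D j z / j z)"
definition "e = (\<lambda>z. D a z / a z)"
text \<open>These are \<open>a / j\<^sup>k\<close> for \<open>k = 1, 2, 3\<close>: the derivatives \<open>P\<^sub>p\<close> and \<open>Q\<^sub>q\<close>, and the slope of the
  transformed third derivative as a function of the original one.\<close>

definition "w1 = (\<lambda>z. a z / j z)"
definition "w2 = (\<lambda>z. w1 z / j z)"
definition "w3 = (\<lambda>z. w2 z / j z)"
abbreviation "P \<equiv> prol1 f \<phi> \<psi>"
abbreviation "Q \<equiv> prol2 f \<phi> \<psi>"
abbreviation "R \<equiv> prol3 f \<phi> \<psi>"

lemma j_nz [simp]: "z \<in> W \<Longrightarrow> j z \<noteq> 0"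
  by (simp add: j_def D\<phi>_nz)

lemma smooth_j [simp]: "smooth_on W j" and smooth_h [simp]: "smooth_on W h"
  by (simp_all add: j_def h_def)

lemma smooth_jacobian [simp]: "smooth_on W (lift (jacobian \<phi> \<psi>))"
  by (rule smooth_on_cong[OF open_W lift_jacobian[symmetric]]) simp

lemma smooth_a [simp]: "smooth_on W a" and a_nz [simp]: "z \<in> W \<Longrightarrow> a z \<noteq> 0"
  by (simp_all add: a_def jacobian_nz)

lemma smooth_y [simp]: "smooth_on W y" and smooth_e [simp]: "smooth_on W e"
  by (simp_all add: y_def e_def)

lemma smooth_w [simp]: "smooth_on W w1" "smooth_on W w2" "smooth_on W w3"
  by (simp_all add: w1_def w2_def w3_def)

lemma smooth_prol [simp]: "smooth_on W P" "smooth_on W Q" "smooth_on W R"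
  by (simp_all add: prol1_def prol2_def prol3_def D\<phi>_nz)

lemma D_j: "z \<in> W \<Longrightarrow> D j z = y z * j z" and D_a: "z \<in> W \<Longrightarrow> D a z = e z * a z"
  by (simp_all add: y_def e_def)

lemma D_prol:
  assumes "z \<in> W"
  shows "D (lift \<psi>) z = P z * j z" "D P z = Q z * j z" "D Q z = R z * j z"
  using D\<phi>_nz[OF assms] by (simp_all add: prol1_def prol2_def prol3_def j_def)

lemma pd_j:
  assumes "z \<in> W"
  shows "pd_q j z = 0" "pd_p j z = h z" "pd_u j z = D h z"
  using assms
  by (simp_all add: j_def h_def D_commute D.zero)

lemma pd_h:
  assumes "z \<in> W"
  shows "pd_q h z = 0" "pd_p h z = 0"
  using assms by (simp_all add: h_def pd_commute u.zero)

text \<open>\<open>a\<close> is also the characteristic of the vertical field \<open>\<partial>\<^sub>u\<close> in the new coordinates, that is, the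
  vertical displacement of the transformed curve when \<open>u\<close> is varied. This is why \<open>a\<close> and its
  derivatives along solutions govern the \<open>u\<close>-derivatives of the prolongation.\<close>

lemma a_eq: assumes z: "z \<in> W" shows "a z = pd_u (lift \<psi>) z - P z * h z"
proof -
  have "j z = pd_x (lift \<phi>) z + fst (snd (snd z)) * h z"
    "P z * j z = pd_x (lift \<psi>) z + fst (snd (snd z)) * pd_u (lift \<psi>) z"
    using D_prol(1)[OF z] by (simp_all add: j_def h_def Dx_eq)
  then have "(pd_u (lift \<psi>) z - P z * h z) * j z = lift (jacobian \<phi> \<psi>) z"
    unfolding lift_jacobian h_def[symmetric] by algebra
  then show ?thesis using z by (simp add: a_def field_simps)
qed

lemma w_j:
  assumes "z \<in> W"
  shows "w1 z * j z = a z" "w2 z * j z = w1 z" "w3 z * j z = w2 z"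
  using assms by (simp_all add: w1_def w2_def w3_def)

lemma w3_nz: "z \<in> W \<Longrightarrow> w3 z \<noteq> 0"
  by (simp add: w1_def w2_def w3_def)

lemma D_w:
  assumes z: "z \<in> W"
  shows "D w1 z = (e z - y z) * w1 z" "D w2 z = (e z - 2 * y z) * w2 z"
proof -
  have *: "D w1 z = (e z - y z) * w1 z" if "z \<in> W" for z
    using that by (simp add: w1_def D.divide D_j D_a field_simps power2_eq_square)
  show "D w1 z = (e z - y z) * w1 z" by (rule *[OF z])
  show "D w2 z = (e z - 2 * y z) * w2 z"
    using z by (simp add: w2_def D.divide D_j * field_simps power2_eq_square)
qed

text \<open>Each of the next three lemmas differentiates one equation of the chain \<open>D \<psi> = j P\<close>, \<open>D P = j Q\<close>,
  \<open>D Q = j R\<close> by \<open>q\<close>, \<open>p\<close> and \<open>u\<close>; commuting the derivative past \<open>D\<close> brings in the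
  derivatives of the preceding variable, and \<open>f\<close> enters at the last step only.\<close>

lemma pd_P:
  assumes z: "z \<in> W"
  shows "pd_q P z = 0" "pd_p P z = w1 z" "pd_u P z = h z * Q z + e z * w1 z"
proof -
  have eqI: "s = t" if "s * j z = t * j z" for s t using that z by simp
  have "pd_q (D (lift \<psi>)) z = pd_q (\<lambda>z. P z * j z) z"
    by (rule q.cong) (simp_all add: D_prol z)
  then show "pd_q P z = 0" using z by (simp add: D_commute pd_j D.zero)
  have "pd_p (D (lift \<psi>)) z = pd_p (\<lambda>z. P z * j z) z"
    by (rule p.cong) (simp_all add: D_prol z)
  then have "pd_p P z * j z = a z"
    using z by (simp add: D_commute pd_j D.zero a_eq)
  then show "pd_p P z = w1 z"
    using z by (simp add: w1_def field_simps)
  have "pd_u (D (lift \<psi>)) z = pd_u (\<lambda>z. P z * j z) z"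
    by (rule u.cong) (simp_all add: D_prol z)
  then have "D (pd_u (lift \<psi>)) z = P z * D h z + pd_u P z * j z"
    using z by (simp add: D_commute pd_j)
  moreover have "D a z = D (\<lambda>z. pd_u (lift \<psi>) z - P z * h z) z"
    by (rule D.cong) (simp_all add: a_eq z)
  then have "e z * (w1 z * j z) = D (pd_u (lift \<psi>)) z - (P z * D h z + Q z * j z * h z)"
    using z by (simp add: D_a D_prol w_j)
  ultimately show "pd_u P z = h z * Q z + e z * w1 z"
    by - (rule eqI, algebra)
qed

lemma pd_Q:
  assumes z: "z \<in> W"
  shows "pd_q Q z = w2 z" "pd_p Q z = (2 * e z - y z) * w2 z"
    "pd_u Q z = h z * R z + (D e z + (e z)\<^sup>2 - e z * y z) * w2 z"
proof -
  note w1_eq = w_j(2)[OF z, symmetric]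
  have eqI: "s = t" if "s * j z = t * j z" for s t using that z by simp
  have "pd_q (D P) z = pd_q (\<lambda>z. Q z * j z) z"
    by (rule q.cong) (simp_all add: D_prol z)
  then have "pd_q Q z * j z = w1 z"
    using z by (simp add: D_commute pd_j pd_P D.zero)
  then show "pd_q Q z = w2 z" unfolding w1_eq by (rule eqI)
  have "pd_p (D P) z = pd_p (\<lambda>z. Q z * j z) z"
    by (rule p.cong) (simp_all add: D_prol z)
  moreover have "D (pd_p P) z = D w1 z"
    by (rule D.cong) (simp_all add: pd_P z)
  ultimately have "(e z - y z) * w1 z + h z * Q z + e z * w1 z = Q z * h z + pd_p Q z * j z"
    using z by (simp add: D_commute pd_j pd_P D_w)
  then show "pd_p Q z = (2 * e z - y z) * w2 z"
    unfolding w1_eq by - (rule eqI, algebra)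
  have "pd_u (D P) z = pd_u (\<lambda>z. Q z * j z) z"
    by (rule u.cong) (simp_all add: D_prol z)
  moreover have "D (pd_u P) z = D (\<lambda>z. h z * Q z + e z * w1 z) z"
    by (rule D.cong) (simp_all add: pd_P z)
  ultimately have "h z * (R z * j z) + D h z * Q z + e z * ((e z - y z) * w1 z) + D e z * w1 z
      = Q z * D h z + pd_u Q z * j z"
    using z by (simp add: D_commute pd_j pd_P D_w D_prol)
  then show "pd_u Q z = h z * R z + (D e z + (e z)\<^sup>2 - e z * y z) * w2 z"
    unfolding w1_eq by - (rule eqI, algebra)
qed

lemma pd_R:
  assumes z: "z \<in> W"
  shows "pd_q R z = (pd_q f z + 3 * e z - 3 * y z) * w3 z"
    "pd_p R z = (pd_p f z + 3 * D e z - D y z + 3 * (e z)\<^sup>2 - 6 * e z * y z + 2 * (y z)\<^sup>2) * w3 z"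
    "pd_u R z = h z * (D R z / j z)
       + (pd_u f z + D (D e) z + 3 * e z * D e z - 3 * y z * D e z - e z * D y z
           + (e z)^3 - 3 * (e z)\<^sup>2 * y z + 2 * e z * (y z)\<^sup>2) * w3 z"
proof -
  note w2_eq = w_j(3)[OF z, symmetric]
  have eqI: "s = t" if "s * j z = t * j z" for s t using that z by simp
  have "pd_q (D Q) z = pd_q (\<lambda>z. R z * j z) z"
    by (rule q.cong) (simp_all add: D_prol z)
  moreover have "D (pd_q Q) z = D w2 z"
    by (rule D.cong) (simp_all add: pd_Q z)
  ultimately have "(e z - 2 * y z) * w2 z + (2 * e z - y z) * w2 z + pd_q f z * w2 z = pd_q R z * j z"
    using z by (simp add: D_commute pd_j pd_Q D_w)
  then show "pd_q R z = (pd_q f z + 3 * e z - 3 * y z) * w3 z"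
    unfolding w2_eq by - (rule eqI, algebra)
  have "pd_p (D Q) z = pd_p (\<lambda>z. R z * j z) z"
    by (rule p.cong) (simp_all add: D_prol z)
  moreover have "D (pd_p Q) z = D (\<lambda>z. (2 * e z - y z) * w2 z) z"
    by (rule D.cong) (simp_all add: pd_Q z)
  ultimately have "(2 * e z - y z) * ((e z - 2 * y z) * w2 z) + (2 * D e z - D y z) * w2 z
      + (h z * R z + (D e z + (e z)\<^sup>2 - e z * y z) * w2 z) + pd_p f z * w2 z
      = R z * h z + pd_p R z * j z"
    using z by (simp add: D_commute pd_j pd_Q D_w)
  then show "pd_p R z = (pd_p f z + 3 * D e z - D y z + 3 * (e z)\<^sup>2 - 6 * e z * y z + 2 * (y z)\<^sup>2) * w3 z"
    unfolding w2_eq by - (rule eqI, algebra)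
  have "pd_u (D Q) z = pd_u (\<lambda>z. R z * j z) z"
    by (rule u.cong) (simp_all add: D_prol z)
  moreover have "D (pd_u Q) z = D (\<lambda>z. h z * R z + (D e z + (e z)\<^sup>2 - e z * y z) * w2 z) z"
    by (rule D.cong) (simp_all add: pd_Q z)
  ultimately have "h z * D R z + D h z * R z
      + ((D e z + (e z)\<^sup>2 - e z * y z) * ((e z - 2 * y z) * w2 z)
         + (D (D e) z + 2 * e z * D e z - (e z * D y z + D e z * y z)) * w2 z) + pd_u f z * w2 z
      = R z * D h z + pd_u R z * j z"
    using z by (simp add: D_commute pd_j pd_Q D_w)
  moreover have "D R z = D R z / j z * j z" using z by simp
  ultimately show "pd_u R z = h z * (D R z / j z)
       + (pd_u f z + D (D e) z + 3 * e z * D e z - 3 * y z * D e z - e z * D y z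
           + (e z)^3 - 3 * (e z)\<^sup>2 * y z + 2 * e z * (y z)\<^sup>2) * w3 z"
    unfolding w2_eq by - (rule eqI, algebra)
qed

end

section \<open>The relative invariants in terms of logarithmic derivatives\<close>

text \<open>The formulas for \<open>I\<^sub>3\<close> and \<open>K\<close> depend only on the logarithmic derivatives \<open>y\<close> of \<open>j\<close> and \<open>e\<close> of
  \<open>a\<close>. They are derived without reference to a transformation, because in the proof of existence \<open>y\<close> and
  \<open>e\<close> come from \<open>J\<close> and \<open>f\<^sub>q\<close> before there is one.\<close>

locale logarithmic_frame = jet_calculus +
  fixes j y e :: "jet \<Rightarrow> real"
  assumes smooth_j [simp]: "smooth_on W j" and smooth_y [simp]: "smooth_on W y"
    and smooth_e [simp]: "smooth_on W e"
    and j_nz: "z \<in> W \<Longrightarrow> j z \<noteq> 0"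
    and D_j: "z \<in> W \<Longrightarrow> D j z = y z * j z"
    and f_q: "z \<in> W \<Longrightarrow> pd_q f z = 3 * (y z - e z)"
begin

lemma D_D_j: "z \<in> W \<Longrightarrow> D (D j) z = (D y z + (y z)\<^sup>2) * j z"
  using D.cong[of "D j" "\<lambda>z. y z * j z" z] by (simp add: D_j algebra_simps power2_eq_square)

lemma D_f_q: "z \<in> W \<Longrightarrow> D (pd_q f) z = 3 * (D y z - D e z)"
  using D.cong[of "pd_q f" "\<lambda>z. 3 * (y z - e z)" z] by (simp add: f_q)

lemma D_D_f_q: "z \<in> W \<Longrightarrow> D (D (pd_q f)) z = 3 * (D (D y) z - D (D e) z)"
  using D.cong[of "D (pd_q f)" "\<lambda>z. 3 * (D y z - D e z)" z] by (simp add: D_f_q)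

text \<open>For a transformation, the numerator is what \<open>s j\<^sup>2\<close> has to equal for the defect to be independent of \<open>p\<close>.\<close>

lemma K_eq:
  assumes J: "\<And>z. z \<in> W \<Longrightarrow> J f z = j z" and z: "z \<in> W"
  shows "K f z = (pd_p f z + 3 * D e z - D y z + 3 * (e z)\<^sup>2 - 6 * e z * y z + 2 * (y z)\<^sup>2) / (j z)\<^sup>2"
proof -
  have DJ: "D (J f) z = y z * j z" if "z \<in> W" for z
    using D.cong[OF smooth_j _ that, of "J f"] that by (simp add: J D_j)
  have DDJ: "D (D (J f)) z = D (D j) z"
    by (rule D.cong[symmetric]) (simp_all add: DJ D_j z)
  have "I8 f z = (pd_p f z + 3 * D e z - D y z + 3 * (e z)\<^sup>2 - 6 * e z * y z + 2 * (y z)\<^sup>2) * (j z)\<^sup>2"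
    unfolding I8_def D_f_q[OF z] DJ[OF z] DDJ D_D_j[OF z] f_q[OF z] J[OF z]
    by (simp add: algebra_simps power2_eq_square)
  then show ?thesis using j_nz[OF z] by (simp add: K_def J[OF z] field_simps power2_eq_square power4_eq_xxxx)
qed

text \<open>Setting the right-hand side equal to \<open>j\<^sup>3\<close> is the condition on \<open>f\<^sub>u\<close> in the \<open>u\<close>-derivative of the
  defect.\<close>

lemma I3_eq:
  assumes f_p: "\<And>z. z \<in> W \<Longrightarrow>
      pd_p f z = s * (j z)\<^sup>2 - (3 * D e z - D y z + 3 * (e z)\<^sup>2 - 6 * e z * y z + 2 * (y z)\<^sup>2)"
    and z: "z \<in> W"
  shows "I3 f z = pd_u f z + D (D e) z + 3 * e z * D e z - 3 * y z * D e z - e z * D y z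
           + (e z)^3 - 3 * (e z)\<^sup>2 * y z + 2 * e z * (y z)\<^sup>2 - s * (j z)\<^sup>2 * e z"
proof -
  have "D (pd_p f) z = D (\<lambda>z. s * (j z)\<^sup>2 -
      (3 * D e z - D y z + 3 * (e z)\<^sup>2 - 6 * (e z * y z) + 2 * (y z)\<^sup>2)) z"
    by (rule D.cong) (simp_all add: f_p z mult.assoc)
  also have "\<dots> = 2 * s * (j z)\<^sup>2 * y z - (3 * D (D e) z - D (D y) z + 6 * e z * D e z
      - 6 * (e z * D y z + D e z * y z) + 4 * y z * D y z)"
    using z by (simp add: D_j power2_eq_square)
  finally show ?thesis
    unfolding I3_def D_f_q[OF z] D_D_f_q[OF z] f_q[OF z] f_p[OF z]
    by (simp add: algebra_simps power2_eq_square power3_eq_cube)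
qed

end

text \<open>Here \<open>E = e + y\<close>. In the derivatives of \<open>f\<close> all terms except those of
  \<open>D E\<^sub>p - E\<^sub>u\<close> cancel, so \<open>I\<^sub>7\<close> is the integrability condition for writing \<open>E\<close> as the total
  derivative of a function of \<open>(x, u)\<close>.\<close>

lemma (in logarithmic_frame) I7_eq:
  assumes j_q: "\<And>z. z \<in> W \<Longrightarrow> pd_q j z = 0"
    and j_u: "\<And>z. z \<in> W \<Longrightarrow> pd_u j z = D (pd_p j) z"
    and E_q: "\<And>z. z \<in> W \<Longrightarrow> pd_q (\<lambda>z. e z + y z) z = 0"
    and f_p: "\<And>z. z \<in> W \<Longrightarrow>
      pd_p f z = s * (j z)\<^sup>2 - (3 * D e z - D y z + 3 * (e z)\<^sup>2 - 6 * e z * y z + 2 * (y z)\<^sup>2)"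
    and z: "z \<in> W"
  shows "I7 f z = 27 * (D (pd_p (\<lambda>z. e z + y z)) z - pd_u (\<lambda>z. e z + y z) z)"
    and "pd_q (pd_q f) z = 6 * (pd_p j z / j z)"
proof -
  define E where "E = (\<lambda>z. e z + y z)"
  have e: "e = (\<lambda>z. E z - y z)" by (simp add: E_def)
  have sE [simp]: "smooth_on W E" by (simp add: E_def)
  have E_q': "pd_q E z = 0" if "z \<in> W" for z using E_q[OF that] by (simp add: E_def)
  define b where "b = (\<lambda>z. pd_p j z / j z)"
  define v where "v = (\<lambda>z. pd_u j z / j z)"
  have [simp]: "smooth_on W b" "smooth_on W v" by (simp_all add: b_def v_def j_nz)
  have bj: "pd_p j z = b z * j z" and vj: "pd_u j z = v z * j z" if "z \<in> W" for z
    using j_nz[OF that] by (simp_all add: b_def v_def)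
  have eqI: "s = t" if "s * j z = t * j z" "z \<in> W" for s t z using that j_nz by simp
  have Db: "D b z = v z - y z * b z" if z: "z \<in> W" for z
    using z j_nz unfolding b_def v_def
    by (simp add: D.divide D_j j_u[symmetric] field_simps power2_eq_square)
  have Dv: "D (pd_u j) z = (D v z + v z * y z) * j z" if "z \<in> W" for z
    using D.cong[of "pd_u j" "\<lambda>z. v z * j z" z] that
    by (simp add: vj D_j algebra_simps)
  have y_q: "pd_q y z = b z" if z: "z \<in> W" for z
    using q.cong[of "D j" "\<lambda>z. y z * j z" z] z
    by - (rule eqI[OF _ z], auto simp: D_j D_commute j_q D.zero bj)
  have y_p: "pd_p y z = 2 * v z - y z * b z" if z: "z \<in> W" for z
    using p.cong[of "D j" "\<lambda>z. y z * j z" z] z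
    by - (rule eqI[OF _ z], simp add: D_j D_commute j_q j_u[symmetric] bj vj algebra_simps)
  have y_u: "pd_u y z = D v z" if z: "z \<in> W" for z
    using u.cong[of "D j" "\<lambda>z. y z * j z" z] z
    by - (rule eqI[OF _ z], auto simp: D_j D_commute j_q Dv vj algebra_simps)
  have Dy_p: "D (pd_p y) z = 2 * D v z - (y z * (v z - y z * b z) + D y z * b z)"
    using D.cong[of "pd_p y" "\<lambda>z. 2 * v z - y z * b z" z] z by (simp add: y_p Db)
  have fq: "pd_q f z = 6 * y z - 3 * E z" if "z \<in> W" for z
    using f_q[OF that] by (simp add: E_def)
  have f_qq: "pd_q (pd_q f) z = 6 * b z"
    using q.cong[of "pd_q f" "\<lambda>z. 6 * y z - 3 * E z" z] z by (simp add: fq y_q E_q')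
  then show "pd_q (pd_q f) z = 6 * (pd_p j z / j z)" by (simp add: b_def)
  have f_qp: "pd_q (pd_p f) z = 6 * (2 * v z - y z * b z) - 3 * pd_p E z"
    using p.cong[of "pd_q f" "\<lambda>z. 6 * y z - 3 * E z" z] z by (simp add: fq y_p pd_commute)
  have f_qu: "pd_q (pd_u f) z = 6 * D v z - 3 * pd_u E z"
    using u.cong[of "pd_q f" "\<lambda>z. 6 * y z - 3 * E z" z] z by (simp add: fq y_u pd_commute)
  have De: "D e z = D E z - D y z" if "z \<in> W" for z
    using that by (simp add: e)
  have fp: "pd_p f z = s * (j z)\<^sup>2 + 4 * D y z - 11 * (y z)\<^sup>2 + 12 * (y z * E z) - 3 * (E z)\<^sup>2 - 3 * D E z"
    if "z \<in> W" for z
    unfolding f_p[OF that] De[OF that] by (simp add: e algebra_simps power2_eq_square)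
  have "pd_p (pd_p f) z = pd_p (\<lambda>z. s * (j z)\<^sup>2 + 4 * D y z - 11 * (y z)\<^sup>2 + 12 * (y z * E z)
      - 3 * (E z)\<^sup>2 - 3 * D E z) z"
    by (rule p.cong) (simp_all add: fp z)
  also have "\<dots> = 2 * s * b z * (j z)\<^sup>2 + 4 * pd_p (D y) z - 22 * (y z * (2 * v z - y z * b z))
      + 12 * (y z * pd_p E z + (2 * v z - y z * b z) * E z) - 6 * (E z * pd_p E z) - 3 * pd_p (D E) z"
    using z by (simp add: y_p bj power2_eq_square)
  also have "pd_p (D y) z = D (pd_p y) z + pd_u y z + pd_p f z * b z"
    using z by (simp add: D_commute y_q)
  also have "pd_p (D E) z = D (pd_p E) z + pd_u E z"
    using z by (simp add: D_commute E_q')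
  finally have f_pp: "pd_p (pd_p f) z = 2 * s * b z * (j z)\<^sup>2
      + 4 * (2 * D v z - (y z * (v z - y z * b z) + D y z * b z) + D v z + pd_p f z * b z)
      - 22 * (y z * (2 * v z - y z * b z))
      + 12 * (y z * pd_p E z + (2 * v z - y z * b z) * E z) - 6 * (E z * pd_p E z)
      - 3 * (D (pd_p E) z + pd_u E z)"
    by (simp add: Dy_p y_u[OF z])
  have "D (pd_q f) z = 6 * D y z - 3 * D E z"
    using D.cong[of "pd_q f" "\<lambda>z. 6 * y z - 3 * E z" z] z by (simp add: fq)
  then have "I7 f z = 27 * (D (pd_p E) z - pd_u E z)"
    unfolding I7_def f_pp f_qq f_qp f_qu fq[OF z] fp[OF z] by algebra
  then show "I7 f z = 27 * (D (pd_p (\<lambda>z. e z + y z)) z - pd_u (\<lambda>z. e z + y z) z)"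
    by (simp add: E_def)
qed

text \<open>\<open>D g / g\<close> is the total derivative of \<open>ln \<bar>g\<bar>\<close>, a function of \<open>(x, u)\<close>.\<close>

lemma (in jet_calculus) logarithmic_derivative_closed:
  assumes sg: "smooth_on W g" and nz: "\<And>z. z \<in> W \<Longrightarrow> g z \<noteq> 0"
    and gp: "\<And>z. z \<in> W \<Longrightarrow> pd_p g z = 0" and gq: "\<And>z. z \<in> W \<Longrightarrow> pd_q g z = 0" and z: "z \<in> W"
  shows "pd_q (\<lambda>z. D g z / g z) z = 0"
    "D (pd_p (\<lambda>z. D g z / g z)) z = pd_u (\<lambda>z. D g z / g z) z"
proof -
  note [simp] = sg
  have D0: "D (pd_p g) z = 0" "D (pd_q g) z = 0" if "z \<in> W" for z
    using that by (auto intro!: D.zero gp gq)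
  show "pd_q (\<lambda>z. D g z / g z) z = 0"
    using z by (simp add: q.divide nz D_commute D0 gp gq)
  have "D (pd_p (\<lambda>z. D g z / g z)) z = D (\<lambda>z. pd_u g z / g z) z"
    using z by (intro D.cong) (simp_all add: p.divide nz D_commute D0 gp gq power2_eq_square)
  also have "\<dots> = pd_u (\<lambda>z. D g z / g z) z"
    using z by (simp add: D.divide u.divide nz D_commute gq)
  finally show "D (pd_p (\<lambda>z. D g z / g z)) z = pd_u (\<lambda>z. D g z / g z) z" .
qed

context prolonged_transformation
begin

text \<open>The defect of the transformed equation with respect to \<open>\<bar>u''' = s \<bar>u' + \<bar>u\<close>.\<close>

definition "G s = (\<lambda>z. R z - s * P z - lift \<psi> z)"

lemma smooth_G [simp]: "smooth_on W (G s)" by (simp add: G_def)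

lemma pd_G:
  assumes z: "z \<in> W"
  shows "pd_q (G s) z = (pd_q f z + 3 * e z - 3 * y z) * w3 z"
    "pd_p (G s) z = (pd_p f z + 3 * D e z - D y z + 3 * (e z)\<^sup>2 - 6 * e z * y z + 2 * (y z)\<^sup>2
        - s * (j z)\<^sup>2) * w3 z"
    "pd_u (G s) z = h z * (D (G s) z / j z)
       + (pd_u f z + D (D e) z + 3 * e z * D e z - 3 * y z * D e z - e z * D y z
           + (e z)^3 - 3 * (e z)\<^sup>2 * y z + 2 * e z * (y z)\<^sup>2 - s * (j z)\<^sup>2 * e z - (j z)^3) * w3 z"
proof -
  have w1: "w1 z = w3 z * j z * j z" and a: "a z = w3 z * j z * j z * j z"
    using w_j[OF z] by simp_all
  show "pd_q (G s) z = (pd_q f z + 3 * e z - 3 * y z) * w3 z"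
    using z by (simp add: G_def pd_R pd_P)
  have "pd_p (G s) z = pd_p R z - s * w1 z"
    using z by (simp add: G_def pd_P)
  then show "pd_p (G s) z = (pd_p f z + 3 * D e z - D y z + 3 * (e z)\<^sup>2 - 6 * e z * y z + 2 * (y z)\<^sup>2
        - s * (j z)\<^sup>2) * w3 z"
    unfolding pd_R(2)[OF z] w1 by algebra
  have "D (G s) z / j z = D R z / j z - s * Q z - P z"
    using z by (simp add: G_def D_prol diff_divide_distrib)
  moreover have "pd_u (G s) z = pd_u R z - s * (h z * Q z + e z * w1 z) - (a z + P z * h z)"
    using z by (simp add: G_def pd_P a_eq)
  ultimately show "pd_u (G s) z = h z * (D (G s) z / j z)
       + (pd_u f z + D (D e) z + 3 * e z * D e z - 3 * y z * D e z - e z * D y z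
           + (e z)^3 - 3 * (e z)\<^sup>2 * y z + 2 * e z * (y z)\<^sup>2 - s * (j z)\<^sup>2 * e z - (j z)^3) * w3 z"
    unfolding pd_R(3)[OF z] w1 a by algebra
qed

lemma e_plus_y:
  assumes z: "z \<in> W"
  shows "e z + y z = D (lift (jacobian \<phi> \<psi>)) z / lift (jacobian \<phi> \<psi>) z"
proof -
  have jac: "lift (jacobian \<phi> \<psi>) z = a z * j z" if "z \<in> W" for z
    using that by (simp add: a_def)
  have "D (lift (jacobian \<phi> \<psi>)) z = (e z + y z) * lift (jacobian \<phi> \<psi>) z"
    using D.cong[OF smooth_jacobian jac z] z by (simp add: jac D_a D_j algebra_simps)
  then show ?thesis using jacobian_nz[OF z] by simp
qed

text \<open>\<open>e + y\<close> is the logarithmic derivative of the Jacobian, which depends on \<open>(x, u)\<close> only.\<close>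

lemma E_closed:
  assumes z: "z \<in> W"
  shows "pd_q (\<lambda>z. e z + y z) z = 0" "D (pd_p (\<lambda>z. e z + y z)) z = pd_u (\<lambda>z. e z + y z) z"
proof -
  let ?E = "\<lambda>z. D (lift (jacobian \<phi> \<psi>)) z / lift (jacobian \<phi> \<psi>) z"
  note * = logarithmic_derivative_closed[of "lift (jacobian \<phi> \<psi>)", simplified, OF jacobian_nz]
  show "pd_q (\<lambda>z. e z + y z) z = 0"
    using q.cong[of "\<lambda>z. e z + y z" ?E z] *(1)[of z] z by (simp add: e_plus_y)
  have "D (pd_p (\<lambda>z. e z + y z)) z = D (pd_p ?E) z"
    by (rule D.cong) (use z p.cong[of "\<lambda>z. e z + y z" ?E _] in \<open>simp_all add: e_plus_y\<close>)
  moreover have "pd_u (\<lambda>z. e z + y z) z = pd_u ?E z"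
    by (rule u.cong) (use z in \<open>simp_all add: e_plus_y\<close>)
  ultimately show "D (pd_p (\<lambda>z. e z + y z)) z = pd_u (\<lambda>z. e z + y z) z"
    using *(2)[of z] z by simp
qed

text \<open>For a vanishing defect the derivatives of \<open>f\<close> are known: \<open>f\<^sub>q = 6 y - 3 E\<close> with \<open>E = e + y\<close>
  independent of \<open>q\<close> and \<open>y\<^sub>q = j\<^sub>p / j\<close>, so \<open>f\<^sub>q\<^sub>q = 6 j\<^sub>p / j\<close>, which gives \<open>I\<^sub>1\<close>, \<open>I\<^sub>2\<close> and
  \<open>I\<^sub>5\<close>; \<open>f\<^sub>p\<close> gives \<open>K\<close> and \<open>I\<^sub>7\<close>; and \<open>f\<^sub>u\<close> gives \<open>I\<^sub>3\<close>.\<close>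

lemma invariants_of_linearized:
  assumes lin: "\<And>z. z \<in> W \<Longrightarrow> R z = s * P z + lift \<psi> z" and z: "z \<in> W"
  shows "I3 f z = (j z)^3" "J f z = j z" "K f z = s"
    and "I1 f z = 0 \<and> I2 f z = 0 \<and> I4 f z = 0 \<and> I5 f z = 0 \<and> I6 f z = 0 \<and>
         I7 f z = 0 \<and> I9 f z = 0 \<and> I10 f z = 0 \<and> I11 f z = 0 \<and> I12 f z = 0"
    and "transformation_system f \<phi> \<psi> z"
proof -
  have G0: "G s z = 0" if "z \<in> W" for z using lin[OF that] by (simp add: G_def)
  have dG: "pd_q (G s) z = 0" "pd_p (G s) z = 0" "pd_u (G s) z = 0" "D (G s) z = 0" if "z \<in> W" for z
    using that G0 by (simp_all add: q.zero p.zero u.zero D.zero)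
  have f_q: "pd_q f z = 3 * (y z - e z)" if "z \<in> W" for z
    using pd_G(1)[OF that, of s] dG[OF that] w3_nz[OF that] by simp
  have f_p: "pd_p f z = s * (j z)\<^sup>2 - (3 * D e z - D y z + 3 * (e z)\<^sup>2 - 6 * e z * y z + 2 * (y z)\<^sup>2)"
    if "z \<in> W" for z
    using pd_G(2)[OF that, of s] dG[OF that] w3_nz[OF that] by simp
  interpret logarithmic_frame W f j y e
    by unfold_locales (use D_j f_q in auto)
  have I3: "I3 f z = (j z)^3" if "z \<in> W" for z
    using pd_G(3)[OF that, of s] dG[OF that] w3_nz[OF that] I3_eq[OF f_p that] by simp
  have J: "J f z = j z" if "z \<in> W" for z
    using I3[OF that] by (simp add: J_def odd_real_root_power_cancel)
  have K: "K f z = s" if "z \<in> W" for z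
    using j_nz[OF that] by (simp add: K_eq[OF J that] f_p[OF that])
  show "I3 f z = (j z)^3" "J f z = j z" "K f z = s" using I3 J K z by auto
  have sJ: "smooth_on W (J f)" by (rule smooth_on_cong[OF open_W _ smooth_j]) (simp add: J)
  have dJ: "pd_q (J f) z = 0" "pd_p (J f) z = h z" "pd_u (J f) z = D h z" "D (J f) z = D j z"
    if "z \<in> W" for z
    using that q.cong[OF sJ J that] p.cong[OF sJ J that] u.cong[OF sJ J that] D.cong[OF sJ J that]
    by (simp_all add: pd_j)
  have j_u: "pd_u j z = D (pd_p j) z" if "z \<in> W" for z
    using D.cong[of h "pd_p j" z] that by (simp add: pd_j)
  note I7 = I7_eq[OF pd_j(1) j_u E_closed(1) f_p]
  have f_qq: "pd_q (pd_q f) z = 6 * (h z / j z)" if "z \<in> W" for z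
    using I7(2)[OF _ _ _ _ that] that by (simp add: pd_j)
  have "pd_q (pd_q (pd_q f)) z = pd_q (\<lambda>z. 6 * (h z / j z)) z"
    using z by (intro q.cong) (simp_all add: f_qq)
  then have 1: "I1 f z = 0" using z by (simp add: I1_def q.divide pd_j pd_h)
  have "pd_q (pd_q (pd_p f)) z = pd_p (pd_q (pd_q f)) z"
    using z q.cong[of "pd_q (pd_p f)" "pd_p (pd_q f)" z] by (simp add: pd_commute)
  also have "\<dots> = pd_p (\<lambda>z. 6 * (h z / j z)) z"
    using z by (intro p.cong) (simp_all add: f_qq)
  finally have 2: "I2 f z = 0"
    using z by (simp add: I2_def f_qq p.divide pd_j pd_h power2_eq_square)
  have 6: "I6 f z = 0" using z D.cong[of h "pd_p (J f)" z] by (simp add: I6_def dJ)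
  show "I1 f z = 0 \<and> I2 f z = 0 \<and> I4 f z = 0 \<and> I5 f z = 0 \<and> I6 f z = 0 \<and>
         I7 f z = 0 \<and> I9 f z = 0 \<and> I10 f z = 0 \<and> I11 f z = 0 \<and> I12 f z = 0"
  proof (intro conjI 1 2 6)
    have sK: "smooth_on W (K f)" by (rule smooth_on_cong[OF open_W _ smooth_on_const[OF open_W]]) (simp add: K)
    show "I9 f z = 0" "I10 f z = 0" "I11 f z = 0" "I12 f z = 0"
      using q.cong[OF sK K z] p.cong[OF sK K z] u.cong[OF sK K z] x.cong[OF sK K z] z
      by (simp_all add: I9_def I10_def I11_def I12_def)
    show "I4 f z = 0" "I5 f z = 0"
      using z by (simp_all add: I4_def I5_def dJ f_qq J)
    show "I7 f z = 0" using I7(1)[OF _ _ _ _ z] E_closed(2)[OF z] by simp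
  qed
  have "a1 f \<phi> \<psi> z = a z" if "z \<in> W" for z by (simp add: a1_def a_def J[OF that])
  then have "a1 f \<phi> \<psi> z = a z" "D (a1 f \<phi> \<psi>) z = e z * a z"
    using z D.cong[of a "a1 f \<phi> \<psi>" z] by (simp_all add: D_a)
  then show "transformation_system f \<phi> \<psi> z"
    using z by (simp add: transformation_system_def J dJ f_q D_j j_def[symmetric] field_simps)
qed

end

section \<open>Local integration\<close>

lemma has_derivative_integral_parameter:
  fixes M :: "'a::euclidean_space \<times> real \<Rightarrow> 'b::euclidean_space"
  assumes "open S" and M: "smooth_on S M" and "open W" "W \<times> {0..1} \<subseteq> S" "w \<in> W"
  shows "((\<lambda>w. integral {0..1} (\<lambda>t. M (w, t))) has_derivative
    (\<lambda>v. integral {0..1} (\<lambda>t. frechet_derivative M (at (w, t)) (v, 0)))) (at w)"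
proof -
  obtain r where r: "r > 0" "ball w r \<subseteq> W" using \<open>open W\<close> \<open>w \<in> W\<close> openE by blast
  let ?U = "ball w r"
  have US: "(x, t) \<in> S" if "x \<in> ?U" "t \<in> cbox 0 1" for x t
  proof -
    have "(x, t) \<in> W \<times> {0..1}" using that r by auto
    then show ?thesis using assms(4) by blast
  qed
  define M' where "M' = (\<lambda>x t. Blinfun (\<lambda>v. frechet_derivative M (at (x, t)) (v, 0)))"
  have d: "((\<lambda>x. M (x, t)) has_derivative (\<lambda>v. frechet_derivative M (at (x, t)) (v, 0))) (at x)"
    if "x \<in> ?U" "t \<in> cbox 0 1" for x t
    by (rule has_derivative_compose[where f = "\<lambda>x. (x, t)" and g = M, OF _ smooth_on_has_derivative[OF M US[OF that]]])
       (auto intro!: derivative_eq_intros)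
  have M'_apply: "blinfun_apply (M' x t) = (\<lambda>v. frechet_derivative M (at (x, t)) (v, 0))"
    if "x \<in> ?U" "t \<in> cbox 0 1" for x t
    unfolding M'_def by (rule bounded_linear_Blinfun_apply[OF has_derivative_bounded_linear[OF d[OF that]]])
  have cM: "continuous_on (?U \<times> cbox 0 1) M"
    by (rule continuous_on_subset[OF smooth_on_continuous_on[OF M]]) (use US in auto)
  have cM': "continuous_on (?U \<times> cbox 0 1) (\<lambda>(x, t). M' x t)"
  proof (rule continuous_on_blinfun_componentwise)
    fix i :: 'a
    have "continuous_on (?U \<times> cbox 0 1) (\<lambda>z. frechet_derivative M (at z) (i, 0))"
      by (rule continuous_on_subset[OF smooth_on_continuous_on[OF smooth_on_frechet_derivative[OF M]]])
         (use US in auto)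
    then show "continuous_on (?U \<times> cbox 0 1) (\<lambda>z. blinfun_apply (case z of (x, t) \<Rightarrow> M' x t) i)"
      by (rule continuous_on_cong[THEN iffD1, rotated -1]) (auto simp: M'_apply)
  qed
  have leibniz: "((\<lambda>x. integral (cbox 0 1) (\<lambda>t. M (x, t))) has_derivative
      integral (cbox 0 1) (M' w)) (at w within ?U)"
  proof (rule leibniz_rule[OF _ _ cM'])
    show "((\<lambda>x. M (x, t)) has_derivative blinfun_apply (M' x t)) (at x within ?U)"
      if "x \<in> ?U" "t \<in> cbox 0 1" for x t
      unfolding M'_apply[OF that] by (rule has_derivative_at_withinI[OF d[OF that]])
    show "(\<lambda>t. M (x, t)) integrable_on cbox 0 1" if "x \<in> ?U" for x
      by (intro integrable_continuous continuous_on_compose2[OF cM] continuous_intros) (use that in auto)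
  qed (use r in auto)
  have *: "integral (cbox 0 1) (M' w) v = integral (cbox 0 1) (\<lambda>t. frechet_derivative M (at (w, t)) (v, 0))" for v
  proof -
    have "continuous_on (cbox 0 1) (M' w)"
      using continuous_on_compose2[OF cM', of "cbox 0 1" "\<lambda>t. (w, t)"] r
        continuous_on_Pair[OF continuous_on_const continuous_on_id, of "{0..1}" w]
      by (auto simp: image_subset_iff)
    then have "integral (cbox 0 1) ((\<lambda>b. blinfun_apply b v) \<circ> M' w) = integral (cbox 0 1) (M' w) v"
      by (intro integral_linear integrable_continuous bounded_linear_intros)
    then show ?thesis
      by (subst (asm) integral_cong[where g = "\<lambda>t. frechet_derivative M (at (w, t)) (v, 0)"])
         (use M'_apply r in auto)
  qed
  have "blinfun_apply (integral (cbox 0 1) (M' w)) = (\<lambda>v. integral {0..1} (\<lambda>t. frechet_derivative M (at (w, t)) (v, 0)))"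
    by (rule ext) (simp add: *[unfolded cbox_interval])
  then show ?thesis using leibniz r at_within_open[of w ?U] by simp
qed

lemma smooth_on_integral_parameter:
  fixes M :: "'a::euclidean_space \<times> real \<Rightarrow> 'b::euclidean_space"
  assumes "open S" "smooth_on S M" "open W" "W \<times> {0..1} \<subseteq> S"
  shows "smooth_on W (\<lambda>w. integral {0..1} (\<lambda>t. M (w, t)))"
proof -
  have "higher_differentiable_on W (\<lambda>w. integral {0..1} (\<lambda>t. M (w, t))) n" if "smooth_on S M"
    for n and M :: "'a \<times> real \<Rightarrow> 'b"
    using that
  proof (induction n arbitrary: M)
    case 0
    have "continuous_on W (\<lambda>w. integral {0..1} (\<lambda>t. M (w, t)))"
      by (rule has_derivative_continuous_on, rule has_derivative_at_withinI)
         (rule has_derivative_integral_parameter[OF assms(1) 0 assms(3,4)])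
    then show ?case by simp
  next
    case (Suc n)
    show ?case
      by (rule higher_differentiable_on_SucI[OF assms(3)
            has_derivative_integral_parameter[OF assms(1) Suc.prems assms(3,4)]])
         (auto intro!: Suc.IH smooth_on_frechet_derivative Suc.prems)
  qed
  with assms(2) show ?thesis by (simp add: smooth_on_def)
qed

abbreviation d1 :: "(real \<times> real \<Rightarrow> 'b::real_normed_vector) \<Rightarrow> real \<times> real \<Rightarrow> 'b" where
  "d1 F w \<equiv> frechet_derivative F (at w) (1, 0)"
abbreviation d2 :: "(real \<times> real \<Rightarrow> 'b::real_normed_vector) \<Rightarrow> real \<times> real \<Rightarrow> 'b" where
  "d2 F w \<equiv> frechet_derivative F (at w) (0, 1)"

lemma smooth_on_has_derivative_plane:
  assumes "smooth_on S F" "w \<in> S"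
  shows "(F has_derivative (\<lambda>v. fst v *\<^sub>R d1 F w + snd v *\<^sub>R d2 F w)) (at w)"
proof -
  note D = smooth_on_has_derivative[OF assms]
  have "frechet_derivative F (at w) v = fst v *\<^sub>R d1 F w + snd v *\<^sub>R d2 F w" for v
  proof -
    have "v = fst v *\<^sub>R (1, 0) + snd v *\<^sub>R (0, 1)" by (cases v) simp
    then have "frechet_derivative F (at w) v
        = frechet_derivative F (at w) (fst v *\<^sub>R (1, 0) + snd v *\<^sub>R (0, 1))" by simp
    then show ?thesis
      by (simp only: linear_add[OF has_derivative_linear[OF D]] linear_cmul[OF has_derivative_linear[OF D]])
  qed
  then have "frechet_derivative F (at w) = (\<lambda>v. fst v *\<^sub>R d1 F w + snd v *\<^sub>R d2 F w)" by (rule ext)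
  with D show ?thesis by simp
qed

lemma d1_d2_eqI:
  assumes "(F has_derivative (\<lambda>v. fst v *\<^sub>R a + snd v *\<^sub>R b)) (at w)"
  shows "d1 F w = a" "d2 F w = b"
  by (simp_all add: frechet_derivative_eqI[OF assms])

lemma d1_d2_vector_derivative:
  assumes "smooth_on S F"
  shows "(x, u) \<in> S \<Longrightarrow> ((\<lambda>t. F (t, u)) has_vector_derivative d1 F (x, u)) (at x)"
    and "(x, u) \<in> S \<Longrightarrow> ((\<lambda>t. F (x, t)) has_vector_derivative d2 F (x, u)) (at u)"
proof -
  assume S: "(x, u) \<in> S"
  note D = smooth_on_has_derivative_plane[OF assms S]
  show "((\<lambda>t. F (t, u)) has_vector_derivative d1 F (x, u)) (at x)"
    unfolding has_vector_derivative_def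
    by (rule has_derivative_eq_rhs[OF has_derivative_compose[where f = "\<lambda>t. (t, u)" and g = F, OF _ D]])
       (auto intro!: derivative_eq_intros)
  show "((\<lambda>t. F (x, t)) has_vector_derivative d2 F (x, u)) (at u)"
    unfolding has_vector_derivative_def
    by (rule has_derivative_eq_rhs[OF has_derivative_compose[where f = "\<lambda>t. (x, t)" and g = F, OF _ D]])
       (auto intro!: derivative_eq_intros)
qed

lemma ball_segment:
  fixes Y Y0 :: real
  assumes "Y \<in> ball Y0 r" "t \<in> {0..1}"
  shows "Y0 + t * (Y - Y0) \<in> ball Y0 r"
proof -
  have "\<bar>t * (Y - Y0)\<bar> \<le> 1 * \<bar>Y - Y0\<bar>" unfolding abs_mult by (rule mult_right_mono) (use assms in auto)
  then show ?thesis using assms by (auto simp: dist_real_def)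
qed

text \<open>The primitive is written as an integral over the fixed interval \<open>[0, 1]\<close>, so that both
  variables become parameters and smoothness follows by differentiating under the integral.\<close>

lemma primitive_second_variable:
  fixes m :: "real \<times> real \<Rightarrow> 'b::euclidean_space"
  assumes m: "smooth_on (ball X0 r \<times> ball Y0 r) m"
  shows "\<exists>\<Psi>. smooth_on (ball X0 r \<times> ball Y0 r) \<Psi> \<and> (\<forall>w \<in> ball X0 r \<times> ball Y0 r. d2 \<Psi> w = m w)"
proof -
  let ?T = "ball X0 r \<times> ball Y0 r"
  have T: "open ?T" by (intro open_Times open_ball)
  let ?c = "\<lambda>z :: (real \<times> real) \<times> real. (fst (fst z), Y0 + snd z * (snd (fst z) - Y0))"
  have sc: "smooth_on UNIV ?c"
    by (intro smooth_on_Pair smooth_on_add smooth_on_mult smooth_on_diff smooth_on_const open_UNIV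
        smooth_on_bounded_linear bounded_linear_intros)
  define S where "S = ?c -` ?T"
  have S: "open S" unfolding S_def
    by (rule open_vimage[OF T]) (rule smooth_on_continuous_on[OF sc])
  define M where "M = (\<lambda>z. (snd (fst z) - Y0) *\<^sub>R m (?c z))"
  have mc: "smooth_on S (\<lambda>z. m (?c z))"
    by (rule smooth_on_compose[OF S T _ m smooth_on_subset[OF sc]]) (auto simp: S_def)
  have sM: "smooth_on S M" unfolding M_def
    by (intro smooth_on_bilinear[OF bounded_bilinear_scaleR] S mc smooth_on_diff smooth_on_const
        smooth_on_bounded_linear bounded_linear_intros)
  have sub: "?T \<times> {0..1} \<subseteq> S"
  proof
    fix z :: "(real \<times> real) \<times> real" assume "z \<in> ?T \<times> {0..1}"
    then show "z \<in> S" using ball_segment[of "snd (fst z)" Y0 r "snd z"] by (auto simp: S_def)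
  qed
  define \<Psi> where "\<Psi> = (\<lambda>w. integral {0..1} (\<lambda>t. M (w, t)))"
  have "smooth_on ?T \<Psi>" unfolding \<Psi>_def by (rule smooth_on_integral_parameter[OF S sM T sub])
  moreover have "d2 \<Psi> w = m w" if w: "w \<in> ?T" for w
  proof -
    obtain X Y where XY: "w = (X, Y)" by (cases w)
    define k where "k = Y - Y0"
    let ?m' = "\<lambda>t. d2 m (X, Y0 + t * k)"
    have in_T: "(X, Y0 + t * k) \<in> ?T" if "t \<in> {0..1}" for t
      using w ball_segment[OF _ that, of Y Y0 r] by (auto simp: XY k_def)
    have "frechet_derivative M (at (w, t)) ((0, 1), 0) = m (X, Y0 + t * k) + (t * k) *\<^sub>R ?m' t"
      if t: "t \<in> {0..1}" for t
    proof -
      have D: "(m has_derivative (\<lambda>v. fst v *\<^sub>R d1 m (X, Y0 + t * k) + snd v *\<^sub>R ?m' t)) (at (?c (w, t)))"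
        using smooth_on_has_derivative_plane[OF m in_T[OF t]] by (simp add: XY k_def)
      have c: "(?c has_derivative (\<lambda>v. (fst (fst v), t * snd (fst v) + snd v * k))) (at (w, t))"
        by (auto intro!: derivative_eq_intros simp: XY k_def)
      have "((\<lambda>z. m (?c z)) has_derivative
          (\<lambda>v. fst (fst v) *\<^sub>R d1 m (X, Y0 + t * k) + (t * snd (fst v) + snd v * k) *\<^sub>R ?m' t)) (at (w, t))"
        using has_derivative_compose[OF c D] by simp
      then have "(M has_derivative (\<lambda>v. k *\<^sub>R (fst (fst v) *\<^sub>R d1 m (X, Y0 + t * k)
          + (t * snd (fst v) + snd v * k) *\<^sub>R ?m' t) + snd (fst v) *\<^sub>R m (X, Y0 + t * k))) (at (w, t))"
        unfolding M_def by (auto intro!: derivative_eq_intros simp: XY k_def)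
      then show ?thesis by (simp add: frechet_derivative_eqI mult.commute)
    qed
    then have "d2 \<Psi> w = integral {0..1} (\<lambda>t. m (X, Y0 + t * k) + (t * k) *\<^sub>R ?m' t)"
      unfolding \<Psi>_def frechet_derivative_eqI[OF has_derivative_integral_parameter[OF S sM T sub w]]
      by (intro integral_cong) simp
    also have "((\<lambda>t. m (X, Y0 + t * k) + (t * k) *\<^sub>R ?m' t) has_integral
        1 *\<^sub>R m (X, Y0 + 1 * k) - 0 *\<^sub>R m (X, Y0 + 0 * k)) {0..1}"
    proof (rule fundamental_theorem_of_calculus)
      fix t :: real assume t: "t \<in> {0..1}"
      have "((\<lambda>t. Y0 + t * k) has_vector_derivative k) (at t)"
        by (auto intro!: derivative_eq_intros simp: has_vector_derivative_def)
      from vector_diff_chain_at[where g = "\<lambda>Y. m (X, Y)", OF this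
          d1_d2_vector_derivative(2)[OF m in_T[OF t]]]
      have "((\<lambda>t. m (X, Y0 + t * k)) has_vector_derivative k *\<^sub>R ?m' t) (at t)"
        by (simp add: o_def)
      then have "((\<lambda>t. t *\<^sub>R m (X, Y0 + t * k)) has_vector_derivative
          (m (X, Y0 + t * k) + (t * k) *\<^sub>R ?m' t)) (at t)"
        by (auto intro!: derivative_eq_intros)
      then show "((\<lambda>t. t *\<^sub>R m (X, Y0 + t * k)) has_vector_derivative
          (m (X, Y0 + t * k) + (t * k) *\<^sub>R ?m' t)) (at t within {0..1})"
        by (rule has_vector_derivative_at_within)
    qed simp
    then have "integral {0..1} (\<lambda>t. m (X, Y0 + t * k) + (t * k) *\<^sub>R ?m' t) = m w"
      by (simp add: integral_unique XY k_def)
    finally show ?thesis .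
  qed
  ultimately show ?thesis by blast
qed

lemma primitive_interval:
  fixes g :: "real \<Rightarrow> 'b::euclidean_space"
  assumes r: "r > 0" and g: "smooth_on (ball X0 r) g"
  shows "\<exists>Y. smooth_on (ball X0 r) Y \<and> (\<forall>x \<in> ball X0 r. (Y has_vector_derivative g x) (at x))"
proof -
  \<comment> \<open>a primitive in the second variable, with a dummy first one\<close>
  have "smooth_on (ball 0 r \<times> ball X0 r) (\<lambda>w :: real \<times> real. g (snd w))"
    by (rule smooth_on_compose[OF _ _ _ g])
       (auto intro!: open_Times smooth_on_bounded_linear bounded_linear_intros)
  then obtain \<Psi> where \<Psi>: "smooth_on (ball 0 r \<times> ball X0 r) \<Psi>"
    "\<And>w. w \<in> ball 0 r \<times> ball X0 r \<Longrightarrow> d2 \<Psi> w = g (snd w)"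
    using primitive_second_variable by blast
  have "smooth_on (ball X0 r) (\<lambda>x. \<Psi> (0, x))"
    by (rule smooth_on_compose[OF _ _ _ \<Psi>(1)])
       (use r in \<open>auto intro!: open_Times smooth_on_bounded_linear bounded_linear_intros\<close>)
  moreover have "((\<lambda>x. \<Psi> (0, x)) has_vector_derivative g x) (at x)" if "x \<in> ball X0 r" for x
    using d1_d2_vector_derivative(2)[OF \<Psi>(1), of 0 x] \<Psi>(2)[of "(0, x)"] that r by simp
  ultimately show ?thesis by blast
qed

lemma derivation_d1_d2:
  assumes "open S"
  shows "derivation S d1" "derivation S d2"
  by (rule directional_derivation[OF assms, of "(1, 0)"], simp add: directional_def,
      rule directional_derivation[OF assms, of "(0, 1)"], simp add: directional_def)

lemma open_box: "open (ball (X0::real) r \<times> ball (Y0::real) r)"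
  by (intro open_Times open_ball)

lemma constant_in_second_variable:
  fixes c :: "real \<times> real \<Rightarrow> real"
  assumes r: "r > 0" and c: "smooth_on (ball X0 r \<times> ball Y0 r) c"
    and "\<And>w. w \<in> ball X0 r \<times> ball Y0 r \<Longrightarrow> d2 c w = 0"
    and "(X, Y) \<in> ball X0 r \<times> ball Y0 r"
  shows "c (X, Y) = c (X, Y0)"
proof -
  have "((\<lambda>t. c (X, t)) has_real_derivative 0) (at t within ball Y0 r)" if "t \<in> ball Y0 r" for t
    using d1_d2_vector_derivative(2)[OF c, of X t] that assms(3)[of "(X, t)"] assms(4)
    by (auto simp: has_real_derivative_iff_has_vector_derivative intro: has_vector_derivative_at_within)
  then have "\<exists>k. \<forall>t\<in>ball Y0 r. c (X, t) = k"
    by (intro has_field_derivative_zero_constant) auto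
  then show ?thesis using assms(4) r by auto
qed

text \<open>After subtracting a primitive of \<open>\<beta>\<close> in the second variable, closedness leaves a function of
  the first variable, which has a primitive of its own.\<close>

lemma potential:
  fixes \<alpha> \<beta> :: "real \<times> real \<Rightarrow> real"
  assumes r: "r > 0"
    and \<alpha>: "smooth_on (ball x0 r \<times> ball u0 r) \<alpha>" and \<beta>: "smooth_on (ball x0 r \<times> ball u0 r) \<beta>"
    and closed: "\<And>w. w \<in> ball x0 r \<times> ball u0 r \<Longrightarrow> d2 \<alpha> w = d1 \<beta> w"
  shows "\<exists>\<phi>. smooth_on (ball x0 r \<times> ball u0 r) \<phi> \<and>
    (\<forall>w \<in> ball x0 r \<times> ball u0 r. d1 \<phi> w = \<alpha> w \<and> d2 \<phi> w = \<beta> w)"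
proof -
  let ?T = "ball x0 r \<times> ball u0 r"
  note T = open_box[of x0 r u0]
  interpret a: derivation ?T d1 by (rule derivation_d1_d2[OF T])
  interpret b: derivation ?T d2 by (rule derivation_d1_d2[OF T])
  obtain \<Psi> where \<Psi> [simp]: "smooth_on ?T \<Psi>" and d\<Psi>: "\<And>w. w \<in> ?T \<Longrightarrow> d2 \<Psi> w = \<beta> w"
    using primitive_second_variable[OF \<beta>] by blast
  define c where "c = (\<lambda>w. \<alpha> w - d1 \<Psi> w)"
  have sc: "smooth_on ?T c" using \<alpha> T by (simp add: c_def)
  have "d2 c w = 0" if w: "w \<in> ?T" for w
  proof -
    have "d2 (d1 \<Psi>) w = d1 (d2 \<Psi>) w" by (rule frechet_derivative_commute[OF T \<Psi> w])
    also have "\<dots> = d1 \<beta> w" by (rule a.cong[OF _ d\<Psi> w]) simp_all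
    finally show ?thesis using \<alpha> w by (simp add: c_def closed)
  qed
  note c0 = constant_in_second_variable[OF r sc this]
  have "smooth_on (ball x0 r) (\<lambda>x. c (x, u0))"
    by (rule smooth_on_compose[OF _ T _ sc])
       (use r in \<open>auto intro!: smooth_on_Pair smooth_on_const smooth_on_bounded_linear[OF _ bounded_linear_ident]\<close>)
  from primitive_interval[OF r this] obtain \<Theta> where \<Theta>: "smooth_on (ball x0 r) \<Theta>"
    "\<And>x. x \<in> ball x0 r \<Longrightarrow> (\<Theta> has_vector_derivative c (x, u0)) (at x)" by blast
  have s\<Theta>: "smooth_on ?T (\<lambda>w. \<Theta> (fst w))"
    by (rule smooth_on_compose[OF T _ _ \<Theta>(1)])
       (auto intro!: smooth_on_bounded_linear bounded_linear_intros T)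
  have d\<Theta>: "d1 (\<lambda>w. \<Theta> (fst w)) w = c w" "d2 (\<lambda>w. \<Theta> (fst w)) w = 0" if w: "w \<in> ?T" for w
  proof -
    have "((\<lambda>w. \<Theta> (fst w)) has_derivative (\<lambda>v. fst v *\<^sub>R c (fst w, u0))) (at w)"
      by (rule has_derivative_compose[where f = fst and g = \<Theta>])
         (use \<Theta>(2)[of "fst w"] w in \<open>auto simp: has_vector_derivative_def intro!: derivative_eq_intros\<close>)
    then have "((\<lambda>w. \<Theta> (fst w)) has_derivative (\<lambda>v. fst v *\<^sub>R c (fst w, u0) + snd v *\<^sub>R 0)) (at w)"
      by simp
    from d1_d2_eqI[OF this] show "d1 (\<lambda>w. \<Theta> (fst w)) w = c w" "d2 (\<lambda>w. \<Theta> (fst w)) w = 0"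
      using c0[of "fst w" "snd w"] w by auto
  qed
  show ?thesis
    by (rule exI[of _ "\<lambda>w. \<Psi> w + \<Theta> (fst w)"]) (use s\<Theta> T in \<open>simp add: d\<Theta> d\<Psi>, simp add: c_def\<close>)
qed

lemma linear_ode_first_order:
  fixes g :: "real \<Rightarrow> complex"
  assumes r: "r > 0" and g: "smooth_on (ball X0 r) g"
  shows "\<exists>y. smooth_on (ball X0 r) y \<and>
    (\<forall>x \<in> ball X0 r. (y has_vector_derivative c * y x + g x) (at x))"
proof -
  have sexp: "smooth_on (ball X0 r) (\<lambda>x::real. exp (x *\<^sub>R k))" for k :: complex
  proof (rule smooth_on_bootstrap[where f' = "\<lambda>x v. v *\<^sub>R (exp (x *\<^sub>R k) * k)"])
    show "((\<lambda>x. exp (x *\<^sub>R k)) has_derivative (\<lambda>v. v *\<^sub>R (exp (x *\<^sub>R k) * k))) (at x)" for x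
      using exp_scaleR_has_vector_derivative_right[of k x UNIV] by (simp add: has_vector_derivative_def)
    show "higher_differentiable_on (ball X0 r) (\<lambda>x. v *\<^sub>R (exp (x *\<^sub>R k) * k)) n"
      if "higher_differentiable_on (ball X0 r) (\<lambda>x. exp (x *\<^sub>R k)) n" for n v
      by (intro higher_differentiable_on_bilinear[OF bounded_bilinear_scaleR]
          higher_differentiable_on_bilinear[OF bounded_bilinear_mult] higher_differentiable_on_const that open_ball)
  qed simp
  have "smooth_on (ball X0 r) (\<lambda>x. exp (x *\<^sub>R (- c)) * g x)"
    by (rule smooth_on_mult[OF open_ball sexp g])
  from primitive_interval[OF r this] obtain Y where Y: "smooth_on (ball X0 r) Y"
    "\<And>x. x \<in> ball X0 r \<Longrightarrow> (Y has_vector_derivative exp (x *\<^sub>R (- c)) * g x) (at x)" by blast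
  show ?thesis
  proof (intro exI[of _ "\<lambda>x. exp (x *\<^sub>R c) * Y x"] conjI ballI)
    show "smooth_on (ball X0 r) (\<lambda>x. exp (x *\<^sub>R c) * Y x)"
      by (rule smooth_on_mult[OF open_ball sexp Y(1)])
    fix x assume x: "x \<in> ball X0 r"
    have "((\<lambda>x. exp (x *\<^sub>R c) * Y x) has_vector_derivative
        exp (x *\<^sub>R c) * (exp (x *\<^sub>R (- c)) * g x) + exp (x *\<^sub>R c) * c * Y x) (at x)"
      by (rule has_vector_derivative_mult[OF exp_scaleR_has_vector_derivative_right Y(2)[OF x]])
    moreover have "exp (x *\<^sub>R c) * (exp (x *\<^sub>R (- c)) * g x) = (exp (x *\<^sub>R c) * exp (x *\<^sub>R (- c))) * g x"
      by (simp only: mult.assoc)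
    moreover have "exp (x *\<^sub>R c) * exp (x *\<^sub>R (- c)) = 1"
      by (simp add: exp_minus)
    moreover have "exp (x *\<^sub>R c) * c * Y x = c * (exp (x *\<^sub>R c) * Y x)"
      by (simp only: mult_ac)
    ultimately show "((\<lambda>x. exp (x *\<^sub>R c) * Y x) has_vector_derivative c * (exp (x *\<^sub>R c) * Y x) + g x) (at x)"
      by (simp only: mult_1 add.commute)
  qed
qed

text \<open>Two roots of the characteristic polynomial \<open>X\<^sup>3 - s X - 1\<close>, the third one being \<open>- c1 - c2\<close>. The
  second equation is the divided difference of the polynomial, which also makes sense for a double root.\<close>

lemma cubic_factorization:
  fixes s :: real
  shows "\<exists>c1 c2 :: complex. c1^3 = of_real s * c1 + 1 \<and> c1\<^sup>2 + c1 * c2 + c2\<^sup>2 = of_real s"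
proof -
  let ?p = "\<lambda>x::real. x^3 - s * x - 1" and ?M = "\<bar>s\<bar> + 2"
  have "1 * 1 \<le> ?M * (?M\<^sup>2 - s)"
  proof (rule mult_mono)
    have "?M\<^sup>2 = \<bar>s\<bar> * \<bar>s\<bar> + 4 * \<bar>s\<bar> + 4" by algebra
    moreover have "\<bar>s\<bar> * \<bar>s\<bar> \<ge> 0" by simp
    ultimately show "1 \<le> ?M\<^sup>2 - s" by linarith
  qed auto
  then have "0 \<le> ?p ?M" by (simp add: algebra_simps power2_eq_square power3_eq_cube)
  then have "\<exists>x\<ge>0. x \<le> ?M \<and> ?p x = 0"
    by (intro IVT' continuous_intros) auto
  then obtain t where t: "?p t = 0" by blast
  define c1 where "c1 = complex_of_real t"
  define c2 where "c2 = (csqrt (4 * of_real s - 3 * c1\<^sup>2) - c1) / 2"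
  have "2 * c2 + c1 = csqrt (4 * of_real s - 3 * c1\<^sup>2)" by (simp add: c2_def field_simps)
  then have "(2 * c2 + c1)\<^sup>2 = 4 * of_real s - 3 * c1\<^sup>2" by simp
  then have "c1\<^sup>2 + c1 * c2 + c2\<^sup>2 = of_real s" by algebra
  moreover have "c1^3 = of_real s * c1 + 1"
  proof -
    have "t^3 = s * t + 1" using t by simp
    then have "complex_of_real (t^3) = complex_of_real (s * t + 1)" by (rule arg_cong)
    then show ?thesis by (simp add: c1_def)
  qed
  ultimately show ?thesis by blast
qed

text \<open>The differential operator factors over the complex numbers into three first-order ones,
  which are inverted one after the other; the real part of the result solves the real equation.\<close>

lemma canonical_ode:
  fixes g :: "real \<Rightarrow> real"
  assumes r: "r > 0" and g: "smooth_on (ball X0 r) g"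
  shows "\<exists>\<gamma> \<gamma>1 \<gamma>2. smooth_on (ball X0 r) \<gamma> \<and> smooth_on (ball X0 r) \<gamma>1 \<and> smooth_on (ball X0 r) \<gamma>2 \<and>
    (\<forall>x \<in> ball X0 r. (\<gamma> has_real_derivative \<gamma>1 x) (at x) \<and> (\<gamma>1 has_real_derivative \<gamma>2 x) (at x) \<and>
      (\<gamma>2 has_real_derivative s * \<gamma>1 x + \<gamma> x + g x) (at x))"
proof -
  let ?I = "ball X0 r"
  obtain c1 c2 :: complex where c: "c1^3 = of_real s * c1 + 1" "c1\<^sup>2 + c1 * c2 + c2\<^sup>2 = of_real s"
    using cubic_factorization by blast
  define c3 where "c3 = - c1 - c2"
  have "smooth_on ?I (\<lambda>x. complex_of_real (g x))"
    by (rule smooth_on_compose_bounded_linear[OF open_ball bounded_linear_of_real g])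
  from linear_ode_first_order[OF r this, of c3] obtain y3 where y3: "smooth_on ?I y3"
    "\<And>x. x \<in> ?I \<Longrightarrow> (y3 has_vector_derivative c3 * y3 x + g x) (at x)" by blast
  from linear_ode_first_order[OF r y3(1), of c2] obtain y2 where y2: "smooth_on ?I y2"
    "\<And>x. x \<in> ?I \<Longrightarrow> (y2 has_vector_derivative c2 * y2 x + y3 x) (at x)" by blast
  from linear_ode_first_order[OF r y2(1), of c1] obtain y1 where y1: "smooth_on ?I y1"
    "\<And>x. x \<in> ?I \<Longrightarrow> (y1 has_vector_derivative c1 * y1 x + y2 x) (at x)" by blast
  define z1 where "z1 = (\<lambda>x. c1 * y1 x + y2 x)"
  define z2 where "z2 = (\<lambda>x. c1 * (c1 * y1 x + y2 x) + (c2 * y2 x + y3 x))"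
  have sz: "smooth_on ?I z1" "smooth_on ?I z2"
    using y1(1) y2(1) y3(1) by (simp_all add: z1_def z2_def)
  have Re: "((\<lambda>x. Re (h x)) has_real_derivative Re h') (at x)"
    if "(h has_vector_derivative h') (at x)" for h h' x
    using bounded_linear.has_vector_derivative[OF bounded_linear_Re that]
    by (simp add: has_real_derivative_iff_has_vector_derivative)
  have "((\<lambda>x. Re (y1 x)) has_real_derivative Re (z1 x)) (at x)"
    "((\<lambda>x. Re (z1 x)) has_real_derivative Re (z2 x)) (at x)"
    "((\<lambda>x. Re (z2 x)) has_real_derivative s * Re (z1 x) + Re (y1 x) + g x) (at x)"
    if x: "x \<in> ?I" for x
  proof -
    note d = y1(2)[OF x] y2(2)[OF x] y3(2)[OF x]
    show "((\<lambda>x. Re (y1 x)) has_real_derivative Re (z1 x)) (at x)"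
      using Re[OF d(1)] by (simp add: z1_def)
    have "(z1 has_vector_derivative z2 x) (at x)"
      unfolding z1_def z2_def by (intro has_vector_derivative_add has_vector_derivative_mult_right d)
    then show "((\<lambda>x. Re (z1 x)) has_real_derivative Re (z2 x)) (at x)" by (rule Re)
    have "(z2 has_vector_derivative (c1 * (c1 * (c1 * y1 x + y2 x) + (c2 * y2 x + y3 x))
        + (c2 * (c2 * y2 x + y3 x) + (c3 * y3 x + g x)))) (at x)"
      unfolding z2_def by (intro has_vector_derivative_add has_vector_derivative_mult_right d)
    moreover have "c1 * (c1 * (c1 * y1 x + y2 x) + (c2 * y2 x + y3 x)) + (c2 * (c2 * y2 x + y3 x) + (c3 * y3 x + g x))
        = of_real s * z1 x + y1 x + g x"
      unfolding z1_def c3_def using c by algebra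
    ultimately have "(z2 has_vector_derivative of_real s * z1 x + y1 x + g x) (at x)"
      by (simp only:)
    from Re[OF this] show "((\<lambda>x. Re (z2 x)) has_real_derivative s * Re (z1 x) + Re (y1 x) + g x) (at x)"
      by simp
  qed
  then show ?thesis
    by (intro exI[of _ "\<lambda>x. Re (y1 x)"] exI[of _ "\<lambda>x. Re (z1 x)"] exI[of _ "\<lambda>x. Re (z2 x)"] conjI ballI
        smooth_on_compose_bounded_linear[OF open_ball bounded_linear_Re] y1(1) sz)
qed

text \<open>The derivative of the inverse is given by Cramer's rule evaluated at the inverse itself, so
  smoothness follows by bootstrapping. The image is shrunk to a box for integration along the coordinate lines.\<close>

lemma smooth_local_inverse_plane:
  fixes \<phi> \<eta> :: "real \<times> real \<Rightarrow> real"
  assumes V: "open V" "w0 \<in> V" and \<phi>: "smooth_on V \<phi>" and \<eta>: "smooth_on V \<eta>"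
    and det: "\<And>w. w \<in> V \<Longrightarrow> d1 \<phi> w * d2 \<eta> w - d2 \<phi> w * d1 \<eta> w \<noteq> 0"
  obtains U r g where "open U" "w0 \<in> U" "U \<subseteq> V" "r > 0"
    "smooth_on (ball (\<phi> w0) r \<times> ball (\<eta> w0) r) g"
    "\<And>w. w \<in> U \<Longrightarrow> (\<phi> w, \<eta> w) \<in> ball (\<phi> w0) r \<times> ball (\<eta> w0) r \<and> g (\<phi> w, \<eta> w) = w"
    "\<And>y. y \<in> ball (\<phi> w0) r \<times> ball (\<eta> w0) r \<Longrightarrow> g y \<in> U \<and> (\<phi> (g y), \<eta> (g y)) = y"
proof -
  let ?F = "\<lambda>w. (\<phi> w, \<eta> w)"
  define det where "det = (\<lambda>w. d1 \<phi> w * d2 \<eta> w - d2 \<phi> w * d1 \<eta> w)"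
  define F' where "F' = (\<lambda>w v. (fst v * d1 \<phi> w + snd v * d2 \<phi> w, fst v * d1 \<eta> w + snd v * d2 \<eta> w))"
  define H where "H = (\<lambda>w v. ((d2 \<eta> w * fst v - d2 \<phi> w * snd v) / det w,
    (d1 \<phi> w * snd v - d1 \<eta> w * fst v) / det w))"
  have det_nz: "det w \<noteq> 0" if "w \<in> V" for w using det[OF that] by (simp add: det_def)
  have F: "(?F has_derivative F' w) (at w)" if "w \<in> V" for w
    using has_derivative_Pair[OF smooth_on_has_derivative_plane[OF \<phi> that]
        smooth_on_has_derivative_plane[OF \<eta> that]] by (simp add: F'_def)
  have HF: "H w (F' w v) = v" if "w \<in> V" for w v
  proof -
    have "d2 \<eta> w * fst (F' w v) - d2 \<phi> w * snd (F' w v) = fst v * det w"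
      "d1 \<phi> w * snd (F' w v) - d1 \<eta> w * fst (F' w v) = snd v * det w"
      by (simp_all add: F'_def det_def algebra_simps)
    then show ?thesis using det_nz[OF that] by (simp add: H_def)
  qed
  have FH: "F' w (H w v) = v" if "w \<in> V" for w v
  proof -
    have "(d2 \<eta> w * fst v - d2 \<phi> w * snd v) * d1 \<phi> w + (d1 \<phi> w * snd v - d1 \<eta> w * fst v) * d2 \<phi> w = fst v * det w"
      "(d2 \<eta> w * fst v - d2 \<phi> w * snd v) * d1 \<eta> w + (d1 \<phi> w * snd v - d1 \<eta> w * fst v) * d2 \<eta> w = snd v * det w"
      by (simp_all add: det_def algebra_simps)
    then show ?thesis using det_nz[OF that]
      by (simp add: H_def F'_def add_divide_distrib[symmetric])
  qed
  have blF: "bounded_linear (F' w)" for w unfolding F'_def by (intro bounded_linear_intros)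
  have blH: "bounded_linear (H w)" for w
    unfolding H_def divide_inverse by (intro bounded_linear_intros)
  define B where "B = (\<lambda>w. Blinfun (F' w))"
  have B: "blinfun_apply (B w) = F' w" for w by (simp add: B_def bounded_linear_Blinfun_apply blF)
  have cont: "continuous_on V (\<lambda>w. frechet_derivative f (at w) v)" if "smooth_on V f" for f :: "real \<times> real \<Rightarrow> real" and v
    by (rule smooth_on_continuous_on[OF smooth_on_frechet_derivative[OF that]])
  have cB: "continuous_on V B"
    by (rule continuous_on_blinfun_componentwise)
       (auto simp: B F'_def intro!: continuous_intros cont \<phi> \<eta>)
  have inv0: "Blinfun (H w0) o\<^sub>L B w0 = id_blinfun"
    by (rule blinfun_eqI) (simp add: B bounded_linear_Blinfun_apply blH HF V)
  have dF: "(?F has_derivative blinfun_apply (B w)) (at w)" if "w \<in> V" for w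
    using F[OF that] by (simp add: B)
  obtain U' V' g g' where U': "open U'" "U' \<subseteq> V" "w0 \<in> U'" and V': "open V'" "?F w0 \<in> V'"
    and hom: "homeomorphism U' V' ?F g"
    and g: "\<And>y. y \<in> V' \<Longrightarrow> (g has_derivative g' y) (at y)"
    and g': "\<And>y. y \<in> V' \<Longrightarrow> g' y = inv (blinfun_apply (B (g y)))"
    and "\<And>y. y \<in> V' \<Longrightarrow> bij (blinfun_apply (B (g y)))"
    by (rule inverse_function_theorem[OF V(1) dF cB V(2) inv0], assumption) (rule that; simp)
  have gU: "g y \<in> U'" "?F (g y) = y" if "y \<in> V'" for y
    using hom that by (auto simp: homeomorphism_def)
  have Fg: "?F w \<in> V'" "g (?F w) = w" if "w \<in> U'" for w
    using hom that by (auto simp: homeomorphism_def)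
  have g'_eq: "g' y = H (g y)" if "y \<in> V'" for y
    unfolding g'[OF that] B
  proof (rule inv_equality)
    have "g y \<in> V" using gU[OF that] U'(2) by blast
    then show "H (g y) (F' (g y) v) = v" "F' (g y) (H (g y) v) = v" for v
      by (simp_all only: HF FH)
  qed
  have sH: "smooth_on V (\<lambda>w. H w v)" for v
    unfolding H_def det_def
    using V(1) \<phi> \<eta> det by (simp add: smooth_on_frechet_derivative)
  have sg: "smooth_on V' g"
  proof (rule smooth_on_bootstrap[where f' = g'])
    show "higher_differentiable_on V' (\<lambda>y. g' y v) n" if "higher_differentiable_on V' g n" for n v
    proof (rule higher_differentiable_on_cong[OF V'(1)])
      show "higher_differentiable_on V' (\<lambda>y. H (g y) v) n"
        by (rule higher_differentiable_on_compose[OF V'(1) V(1) _ smooth_onD[OF sH] that])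
           (use gU U' in auto)
    qed (simp add: g'_eq)
  qed (use V' g in auto)
  obtain e where e: "e > 0" "ball (?F w0) e \<subseteq> V'" using V' openE by blast
  define r where "r = e / 2"
  have r: "r > 0" using e by (simp add: r_def)
  let ?T = "ball (\<phi> w0) r \<times> ball (\<eta> w0) r"
  have TV: "?T \<subseteq> V'"
  proof
    fix y assume y: "y \<in> ?T"
    have "dist (?F w0) y \<le> dist (\<phi> w0) (fst y) + dist (\<eta> w0) (snd y)"
      by (cases y) (auto simp: dist_Pair_Pair intro: sqrt_sum_squares_le_sum)
    also have "\<dots> < e" using y by (auto simp: r_def)
    finally show "y \<in> V'" using e by auto
  qed
  define U where "U = U' \<inter> ?F -` ?T"
  have "continuous_on U' ?F" using hom by (simp add: homeomorphism_def)
  then have "open U" unfolding U_def using continuous_open_preimage[OF _ U'(1) open_box] by blast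
  then show thesis
    by (rule that[of U r g])
       (use U' r TV gU Fg in \<open>auto simp: U_def intro: smooth_on_subset[OF sg]\<close>)
qed

text \<open>A linear function whose gradient at \<open>w0\<close> is the gradient of \<open>\<phi>\<close> turned by a right angle; this treats
  the cases \<open>\<phi>\<^sub>x \<noteq> 0\<close> and \<open>\<phi>\<^sub>u \<noteq> 0\<close> at once.\<close>

lemma transversal_function:
  fixes \<phi> :: "real \<times> real \<Rightarrow> real"
  assumes V: "open V" "w0 \<in> V" and \<phi>: "smooth_on V \<phi>" and nz: "d1 \<phi> w0 \<noteq> 0 \<or> d2 \<phi> w0 \<noteq> 0"
  obtains V' \<eta> where "open V'" "w0 \<in> V'" "V' \<subseteq> V" "smooth_on V' \<eta>"
    "\<And>w. w \<in> V' \<Longrightarrow> d1 \<phi> w * d2 \<eta> w - d2 \<phi> w * d1 \<eta> w \<noteq> (0::real)"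
proof -
  define a where "a = d1 \<phi> w0"
  define b where "b = d2 \<phi> w0"
  define \<eta> where "\<eta> = (\<lambda>w :: real \<times> real. a * snd w - b * fst w)"
  have s\<eta>: "smooth_on UNIV \<eta>" unfolding \<eta>_def
    by (intro smooth_on_bounded_linear open_UNIV bounded_linear_intros)
  have "(\<eta> has_derivative (\<lambda>v. fst v *\<^sub>R (- b) + snd v *\<^sub>R a)) (at w)" for w
    unfolding \<eta>_def by (auto intro!: derivative_eq_intros)
  note d\<eta> = d1_d2_eqI[OF this]
  define det where "det = (\<lambda>w. d1 \<phi> w * a + d2 \<phi> w * b)"
  have "continuous_on V det" unfolding det_def
    by (intro continuous_intros smooth_on_continuous_on[OF smooth_on_frechet_derivative[OF \<phi>]])
  then have o: "open (V \<inter> det -` (- {0}))"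
    using V(1) by (intro continuous_open_preimage) auto
  have "a * a + b * b > 0" using nz unfolding a_def b_def
    by (metis not_real_square_gt_zero add_pos_nonneg add_nonneg_pos zero_le_square)
  then have 0: "det w0 \<noteq> 0" by (auto simp: det_def simp flip: a_def b_def)
  show thesis
    by (rule that[OF o _ _ smooth_on_subset[OF s\<eta>]]) (use 0 V in \<open>auto simp: d\<eta> det_def\<close>)
qed

text \<open>In coordinates \<open>(\<phi>, \<eta>)\<close> the Jacobian of \<open>\<phi>\<close> and \<open>\<psi>\<close> is the derivative of \<open>\<psi>\<close> by \<open>\<eta>\<close> times
  a nonvanishing factor, so the equation is solved by a primitive.\<close>

lemma jacobian_equation_solvable:
  fixes \<phi> \<rho> :: "real \<times> real \<Rightarrow> real"
  assumes V: "open V" "w0 \<in> V" and \<phi>: "smooth_on V \<phi>" and nz: "d1 \<phi> w0 \<noteq> 0 \<or> d2 \<phi> w0 \<noteq> 0"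
    and \<rho>: "smooth_on V \<rho>"
  obtains U \<psi> where "open U" "w0 \<in> U" "U \<subseteq> V" "smooth_on U \<psi>"
    "\<And>w. w \<in> U \<Longrightarrow> d1 \<phi> w * d2 \<psi> w - d2 \<phi> w * d1 \<psi> w = \<rho> w"
proof -
  obtain V' \<eta> where V': "open V'" "w0 \<in> V'" "V' \<subseteq> V" and \<eta>: "smooth_on V' \<eta>"
    and det: "\<And>w. w \<in> V' \<Longrightarrow> d1 \<phi> w * d2 \<eta> w - d2 \<phi> w * d1 \<eta> w \<noteq> 0"
    using transversal_function[OF V \<phi> nz] by blast
  note \<phi>' = smooth_on_subset[OF \<phi> V'(3)] and \<rho>' = smooth_on_subset[OF \<rho> V'(3)]
  obtain U r g where U: "open U" "w0 \<in> U" "U \<subseteq> V'" and r: "r > 0"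
    and g: "smooth_on (ball (\<phi> w0) r \<times> ball (\<eta> w0) r) g"
    and fg: "\<And>w. w \<in> U \<Longrightarrow> (\<phi> w, \<eta> w) \<in> ball (\<phi> w0) r \<times> ball (\<eta> w0) r \<and> g (\<phi> w, \<eta> w) = w"
    and gf: "\<And>y. y \<in> ball (\<phi> w0) r \<times> ball (\<eta> w0) r \<Longrightarrow> g y \<in> U \<and> (\<phi> (g y), \<eta> (g y)) = y"
    by (rule smooth_local_inverse_plane[OF V'(1,2) \<phi>' \<eta> det]) (assumption, rule that)
  let ?T = "ball (\<phi> w0) r \<times> ball (\<eta> w0) r"
  define m where "m = (\<lambda>w. \<rho> w / (d1 \<phi> w * d2 \<eta> w - d2 \<phi> w * d1 \<eta> w))"
  have sm: "smooth_on V' m" unfolding m_def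
    using V'(1) \<rho>' \<phi>' \<eta> det by (simp add: smooth_on_frechet_derivative)
  have "smooth_on ?T (\<lambda>y. m (g y))"
    by (rule smooth_on_compose[OF open_box V'(1) _ sm g]) (use gf U in blast)
  then obtain \<Psi> where \<Psi>: "smooth_on ?T \<Psi>" "\<And>y. y \<in> ?T \<Longrightarrow> d2 \<Psi> y = m (g y)"
    using primitive_second_variable by blast
  note \<phi>U = smooth_on_subset[OF \<phi>' U(3)] and \<eta>U = smooth_on_subset[OF \<eta> U(3)]
  show thesis
  proof (rule that[of U "\<lambda>w. \<Psi> (\<phi> w, \<eta> w)"])
    show "smooth_on U (\<lambda>w. \<Psi> (\<phi> w, \<eta> w))"
      by (rule smooth_on_compose[OF U(1) open_box _ \<Psi>(1)]) (use fg U(1) \<phi>U \<eta>U in auto)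
    fix w assume w: "w \<in> U"
    let ?y = "(\<phi> w, \<eta> w)"
    have "((\<lambda>w. \<Psi> (\<phi> w, \<eta> w)) has_derivative
        (\<lambda>v. (fst v *\<^sub>R d1 \<phi> w + snd v *\<^sub>R d2 \<phi> w) *\<^sub>R d1 \<Psi> ?y
           + (fst v *\<^sub>R d1 \<eta> w + snd v *\<^sub>R d2 \<eta> w) *\<^sub>R d2 \<Psi> ?y)) (at w)"
      using has_derivative_compose[OF has_derivative_Pair[OF
            smooth_on_has_derivative_plane[OF \<phi>U w] smooth_on_has_derivative_plane[OF \<eta>U w]]
          smooth_on_has_derivative_plane[OF \<Psi>(1) conjunct1[OF fg[OF w]]]] by simp
    then have "((\<lambda>w. \<Psi> (\<phi> w, \<eta> w)) has_derivative
        (\<lambda>v. fst v *\<^sub>R (d1 \<phi> w * d1 \<Psi> ?y + d1 \<eta> w * d2 \<Psi> ?y)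
           + snd v *\<^sub>R (d2 \<phi> w * d1 \<Psi> ?y + d2 \<eta> w * d2 \<Psi> ?y))) (at w)"
      by (rule has_derivative_eq_rhs) (simp add: algebra_simps)
    note d = d1_d2_eqI[OF this]
    have "d2 \<Psi> ?y * (d1 \<phi> w * d2 \<eta> w - d2 \<phi> w * d1 \<eta> w) = \<rho> w"
      using \<Psi>(2)[of ?y] fg[OF w] det[of w] w U(3) by (auto simp: m_def)
    then show "d1 \<phi> w * d2 (\<lambda>w. \<Psi> (\<phi> w, \<eta> w)) w - d2 \<phi> w * d1 (\<lambda>w. \<Psi> (\<phi> w, \<eta> w)) w = \<rho> w"
      unfolding d by (simp add: algebra_simps)
  qed (use U V' in auto)
qed

text \<open>In coordinates \<open>(\<phi>, \<eta>)\<close> the hypothesis says that \<open>G\<close> has zero derivative by \<open>\<eta>\<close>.\<close>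

lemma functional_dependence:
  fixes \<phi> G :: "real \<times> real \<Rightarrow> real"
  assumes V: "open V" "w0 \<in> V" and \<phi>: "smooth_on V \<phi>" and nz: "d1 \<phi> w0 \<noteq> 0 \<or> d2 \<phi> w0 \<noteq> 0"
    and G: "smooth_on V G" and dep: "\<And>w. w \<in> V \<Longrightarrow> d1 \<phi> w * d2 G w = d2 \<phi> w * d1 G w"
  obtains U r \<gamma> where "open U" "w0 \<in> U" "U \<subseteq> V" "r > 0" "smooth_on (ball (\<phi> w0) r) (\<gamma> :: real \<Rightarrow> real)"
    "\<And>w. w \<in> U \<Longrightarrow> \<phi> w \<in> ball (\<phi> w0) r \<and> G w = \<gamma> (\<phi> w)"
proof -
  obtain V' \<eta> where V': "open V'" "w0 \<in> V'" "V' \<subseteq> V" and \<eta>: "smooth_on V' \<eta>"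
    and det: "\<And>w. w \<in> V' \<Longrightarrow> d1 \<phi> w * d2 \<eta> w - d2 \<phi> w * d1 \<eta> w \<noteq> 0"
    using transversal_function[OF V \<phi> nz] by blast
  note \<phi>' = smooth_on_subset[OF \<phi> V'(3)] and G' = smooth_on_subset[OF G V'(3)]
  obtain U r g where U: "open U" "w0 \<in> U" "U \<subseteq> V'" and r: "r > 0"
    and g: "smooth_on (ball (\<phi> w0) r \<times> ball (\<eta> w0) r) g"
    and fg: "\<And>w. w \<in> U \<Longrightarrow> (\<phi> w, \<eta> w) \<in> ball (\<phi> w0) r \<times> ball (\<eta> w0) r \<and> g (\<phi> w, \<eta> w) = w"
    and gf: "\<And>y. y \<in> ball (\<phi> w0) r \<times> ball (\<eta> w0) r \<Longrightarrow> g y \<in> U \<and> (\<phi> (g y), \<eta> (g y)) = y"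
    by (rule smooth_local_inverse_plane[OF V'(1,2) \<phi>' \<eta> det]) (assumption, rule that)
  let ?T = "ball (\<phi> w0) r \<times> ball (\<eta> w0) r"
  have gV: "g ` ?T \<subseteq> V'" using gf U by blast
  have sG: "smooth_on ?T (\<lambda>y. G (g y))" by (rule smooth_on_compose[OF open_box V'(1) gV G' g])
  have "d2 (\<lambda>y. G (g y)) y = 0" if y: "y \<in> ?T" for y
  proof -
    let ?w = "g y"
    define k where "k = frechet_derivative g (at y) (0, 1)"
    have w: "?w \<in> V'" using gV y by blast
    have chain: "d2 (\<lambda>y. F (g y)) y = fst k * d1 F ?w + snd k * d2 F ?w" if "smooth_on V' F" for F :: "real \<times> real \<Rightarrow> real"
      using frechet_derivative_eqI[OF has_derivative_compose[OF smooth_on_has_derivative[OF g y]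
            smooth_on_has_derivative_plane[OF that w]]] by (simp add: k_def)
    have "d2 (\<lambda>y. \<phi> (g y)) y = d2 fst y"
      by (rule frechet_derivative_transform_within_open[THEN fun_cong, OF _ open_box[of "\<phi> w0" r "\<eta> w0"] y])
         (use smooth_on_has_derivative[OF smooth_on_compose[OF open_box V'(1) gV \<phi>' g] y] gf
           in \<open>auto simp: differentiable_def prod_eq_iff\<close>)
    also have "\<dots> = 0" by (simp add: frechet_derivative_eqI[OF has_derivative_fst[OF has_derivative_ident]])
    finally have k: "fst k * d1 \<phi> ?w + snd k * d2 \<phi> ?w = 0" using chain[OF \<phi>'] by simp
    let ?s = "fst k * d1 G ?w + snd k * d2 G ?w"
    have "d1 \<phi> ?w * d2 G ?w = d2 \<phi> ?w * d1 G ?w" using dep w V'(3) by blast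
    then have "d1 \<phi> ?w * ?s = 0" "d2 \<phi> ?w * ?s = 0" using k by algebra+
    moreover have "d1 \<phi> ?w \<noteq> 0 \<or> d2 \<phi> ?w \<noteq> 0" using det[OF w] by auto
    ultimately have "?s = 0" by auto
    then show ?thesis using chain[OF G'] by simp
  qed
  note const = constant_in_second_variable[OF r sG this]
  have "smooth_on (ball (\<phi> w0) r) (\<lambda>x. (x, \<eta> w0))"
    by (rule smooth_on_Pair[OF open_ball smooth_on_bounded_linear[OF open_ball bounded_linear_ident]
          smooth_on_const[OF open_ball]])
  then have "smooth_on (ball (\<phi> w0) r) (\<lambda>x. G (g (x, \<eta> w0)))"
    by (rule smooth_on_compose[OF open_ball open_box _ sG, rotated]) (use r in auto)
  moreover have "\<phi> w \<in> ball (\<phi> w0) r \<and> G w = G (g (\<phi> w, \<eta> w0))" if "w \<in> U" for w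
    using fg[OF that] const[of "\<phi> w" "\<eta> w"] by auto
  ultimately show thesis
    by (intro that[OF U(1,2) _ r]) (use U V' in auto)
qed

section \<open>Functions of \<open>(x, u)\<close> on the jet space\<close>

abbreviation jet_box :: "real \<Rightarrow> real \<Rightarrow> real \<Rightarrow> real \<Rightarrow> real \<Rightarrow> jet set" where
  "jet_box x0 u0 p0 q0 r \<equiv> ball x0 r \<times> ball u0 r \<times> ball p0 r \<times> ball q0 r"

lemma open_jet_box: "open (jet_box x0 u0 p0 q0 r)"
  by (intro open_Times open_ball)

lemma eventually_nhds_jet_box:
  "(\<forall>\<^sub>F z in nhds (x0, u0, p0, q0). Pr z) \<longleftrightarrow> (\<exists>r>0. \<forall>z\<in>jet_box x0 u0 p0 q0 r. Pr z)"
proof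
  assume "\<forall>\<^sub>F z in nhds (x0, u0, p0, q0). Pr z"
  then obtain e where e: "e > 0" "\<And>z. dist z (x0, u0, p0, q0) < e \<Longrightarrow> Pr z"
    by (auto simp: eventually_nhds_metric)
  have "Pr z" if z: "z \<in> jet_box x0 u0 p0 q0 (e / 4)" for z
  proof (rule e(2))
    obtain x u p q where xupq: "z = (x, u, p, q)" by (cases z)
    have "dist (x, u, p, q) (x0, u0, p0, q0) \<le> dist x x0 + (dist u u0 + (dist p p0 + dist q q0))"
      unfolding dist_Pair_Pair by (intro order.trans[OF sqrt_sum_squares_le_sum] add_left_mono) auto
    also have "\<dots> < e" using z by (auto simp: xupq dist_commute)
    finally show "dist z (x0, u0, p0, q0) < e" by (simp add: xupq)
  qed
  then show "\<exists>r>0. \<forall>z\<in>jet_box x0 u0 p0 q0 r. Pr z" using e(1) by (intro exI[of _ "e / 4"]) auto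
next
  assume "\<exists>r>0. \<forall>z\<in>jet_box x0 u0 p0 q0 r. Pr z"
  then show "\<forall>\<^sub>F z in nhds (x0, u0, p0, q0). Pr z"
    unfolding eventually_nhds by (metis (no_types, lifting) open_jet_box centre_in_ball mem_Sigma_iff)
qed

lemma eventually_lift:
  fixes V :: "plane set"
  assumes "open V" "(x0, u0) \<in> V"
  shows "\<forall>\<^sub>F z in nhds (x0, u0, p0 :: real, q0 :: real). (fst z, fst (snd z)) \<in> V"
proof -
  have "continuous_on UNIV (\<lambda>z :: jet. (fst z, fst (snd z)))" by (intro continuous_intros)
  from open_vimage[OF assms(1) this]
  have "open ((\<lambda>z :: jet. (fst z, fst (snd z))) -` V)" .
  from eventually_nhds_in_open[OF this, of "(x0, u0, p0, q0)"] assms(2) show ?thesis by simp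
qed

lemma deriv_plane:
  fixes F :: "plane \<Rightarrow> real"
  assumes "smooth_on S F" "(x, u) \<in> S"
  shows "deriv (\<lambda>t. F (t, u)) x = d1 F (x, u)" "deriv (\<lambda>t. F (x, t)) u = d2 F (x, u)"
  using d1_d2_vector_derivative[OF assms(1)] assms(2)
  by (auto intro!: DERIV_imp_deriv simp: has_real_derivative_iff_has_vector_derivative)

lemma pd_lift_plane:
  assumes "smooth_on S F" "(x, u) \<in> S"
  shows "pd_x (lift F) (x, u, p, q) = d1 F (x, u)" "pd_u (lift F) (x, u, p, q) = d2 F (x, u)"
  using deriv_plane[OF assms] by (simp_all add: pd_x_def pd_u_def lift_def)

lemma jacobian_plane:
  assumes "smooth_on S \<phi>" "smooth_on S \<psi>" "w \<in> S"
  shows "jacobian \<phi> \<psi> w = d1 \<phi> w * d2 \<psi> w - d2 \<phi> w * d1 \<psi> w"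
  using deriv_plane[OF assms(1), of "fst w" "snd w"] deriv_plane[OF assms(2), of "fst w" "snd w"] assms(3)
  by (simp add: jacobian_def split_beta)

lemma (in jet_calculus) function_of_x_u:
  assumes W: "W = jet_box x0 u0 p0 q0 r" and r: "r > 0" and F: "smooth_on W F"
    and F_p: "\<And>z. z \<in> W \<Longrightarrow> pd_p F z = 0" and F_q: "\<And>z. z \<in> W \<Longrightarrow> pd_q F z = 0"
  obtains \<alpha> where "smooth_on (ball x0 r \<times> ball u0 r) \<alpha>" "\<And>z. z \<in> W \<Longrightarrow> F z = lift \<alpha> z"
proof -
  have 1: "F (x, u, p, q) = F (x, u, p0, q)" if "(x, u, p, q) \<in> W" for x u p q
  proof -
    have "((\<lambda>t. F (x, u, t, q)) has_real_derivative 0) (at t within ball p0 r)" if "t \<in> ball p0 r" for t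
    proof -
      have z: "(x, u, t, q) \<in> W" using that \<open>(x, u, p, q) \<in> W\<close> by (auto simp: W)
      have "((\<lambda>t. F (x, u, t, q)) has_real_derivative frechet_derivative F (at (x, u, t, q)) (0, 0, 1, 0)) (at t)"
        by (rule deriv_along_line[OF F z]) (auto intro!: derivative_eq_intros simp: zero_prod_def)
      then show ?thesis
        using F_p[OF z] directionalD[OF directional_pd(3)[OF open_W] F z]
        by (auto intro: DERIV_subset)
    qed
    then have "\<exists>c. \<forall>t\<in>ball p0 r. F (x, u, t, q) = c" by (intro has_field_derivative_zero_constant) auto
    then show ?thesis using that r by (auto simp: W)
  qed
  have 2: "F (x, u, p0, q) = F (x, u, p0, q0)" if "(x, u, p0, q) \<in> W" for x u q
  proof -
    have "((\<lambda>t. F (x, u, p0, t)) has_real_derivative 0) (at t within ball q0 r)" if "t \<in> ball q0 r" for t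
    proof -
      have z: "(x, u, p0, t) \<in> W" using that \<open>(x, u, p0, q) \<in> W\<close> by (auto simp: W)
      have "((\<lambda>t. F (x, u, p0, t)) has_real_derivative frechet_derivative F (at (x, u, p0, t)) (0, 0, 0, 1)) (at t)"
        by (rule deriv_along_line[OF F z]) (auto intro!: derivative_eq_intros simp: zero_prod_def)
      then show ?thesis
        using F_q[OF z] directionalD[OF directional_pd(4)[OF open_W] F z]
        by (auto intro: DERIV_subset)
    qed
    then have "\<exists>c. \<forall>t\<in>ball q0 r. F (x, u, p0, t) = c" by (intro has_field_derivative_zero_constant) auto
    then show ?thesis using that r by (auto simp: W)
  qed
  show thesis
  proof (rule that)
    have s: "smooth_on (ball x0 r \<times> ball u0 r) (\<lambda>w. (fst w, snd w, p0, q0))"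
      by (intro smooth_on_Pair smooth_on_const open_box smooth_on_bounded_linear[OF open_box bounded_linear_fst]
          smooth_on_bounded_linear[OF open_box bounded_linear_snd])
    show "smooth_on (ball x0 r \<times> ball u0 r) (\<lambda>w. F (fst w, snd w, p0, q0))"
      by (rule smooth_on_compose[OF open_box open_W _ F s]) (use r in \<open>auto simp: W\<close>)
    show "F z = lift (\<lambda>w. F (fst w, snd w, p0, q0)) z" if "z \<in> W" for z
      using that 1[of "fst z" "fst (snd z)" "fst (snd (snd z))" "snd (snd (snd z))"]
        2[of "fst z" "fst (snd z)" "snd (snd (snd z))"] r
      by (auto simp: lift_def W)
  qed
qed

text \<open>Differentiating \<open>F\<^sub>u = D F\<^sub>p\<close> by \<open>q\<close> gives \<open>F\<^sub>p\<^sub>p = 0\<close>. Hence \<open>F = \<alpha> + p \<beta>\<close> with functions of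
  \<open>(x, u)\<close>, and the hypothesis becomes \<open>\<alpha>\<^sub>u = \<beta>\<^sub>x\<close>.\<close>

lemma (in jet_calculus) total_derivative_of_function_of_x_u:
  assumes W: "W = jet_box x0 u0 p0 q0 r" and r: "r > 0" and F: "smooth_on W F"
    and F_q: "\<And>z. z \<in> W \<Longrightarrow> pd_q F z = 0" and F_u: "\<And>z. z \<in> W \<Longrightarrow> pd_u F z = D (pd_p F) z"
  obtains \<phi> where "smooth_on (ball x0 r \<times> ball u0 r) \<phi>" "\<And>z. z \<in> W \<Longrightarrow> F z = D (lift \<phi>) z"
proof -
  let ?T = "ball x0 r \<times> ball u0 r"
  note [simp] = F
  define H where "H = pd_p F"
  have sH [simp]: "smooth_on W H" by (simp add: H_def)
  have H_q: "pd_q H z = 0" if "z \<in> W" for z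
    using that F_q by (simp add: H_def pd_commute p.zero)
  have H_p: "pd_p H z = 0" if z: "z \<in> W" for z
  proof -
    have "pd_q (pd_u F) z = 0" using z F_q by (simp add: pd_commute u.zero)
    moreover have "pd_q (pd_u F) z = pd_q (D H) z"
      by (rule q.cong) (use z F_u in \<open>simp_all add: H_def\<close>)
    ultimately show ?thesis using z H_q by (simp add: D_commute D.zero)
  qed
  define A where "A = (\<lambda>z. F z - fst (snd (snd z)) * H z)"
  have sA [simp]: "smooth_on W A" by (simp add: A_def)
  have "pd_p A z = 0" "pd_q A z = 0" if "z \<in> W" for z
    using that H_q H_p F_q by (simp_all add: A_def pd_coordinates) (simp add: H_def)
  from function_of_x_u[OF W r sA this] obtain \<alpha> where \<alpha>: "smooth_on ?T \<alpha>" "\<And>z. z \<in> W \<Longrightarrow> A z = lift \<alpha> z"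
    by blast
  from function_of_x_u[OF W r sH H_p H_q] obtain \<beta> where \<beta>: "smooth_on ?T \<beta>" "\<And>z. z \<in> W \<Longrightarrow> H z = lift \<beta> z"
    by blast
  have "d2 \<alpha> w = d1 \<beta> w" if w: "w \<in> ?T" for w
  proof -
    obtain x u where xu: "w = (x, u)" by (cases w)
    let ?z = "(x, u, p0, q0)"
    have z: "?z \<in> W" using w r by (simp add: W xu)
    have "d2 \<alpha> w = pd_u A ?z"
      using u.cong[OF sA \<alpha>(2) z] pd_lift_plane(2)[OF \<alpha>(1)] w by (simp add: xu)
    also have "\<dots> = pd_x H ?z"
      using F_u[OF z] H_p[OF z] H_q[OF z] z
      by (simp add: A_def pd_coordinates) (simp add: H_def[symmetric] Dx_eq)
    also have "\<dots> = d1 \<beta> w"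
      using x.cong[OF sH \<beta>(2) z] pd_lift_plane(1)[OF \<beta>(1)] w by (simp add: xu)
    finally show ?thesis .
  qed
  from potential[OF r \<alpha>(1) \<beta>(1) this] obtain \<phi> where \<phi>: "smooth_on ?T \<phi>"
    "\<And>w. w \<in> ?T \<Longrightarrow> d1 \<phi> w = \<alpha> w \<and> d2 \<phi> w = \<beta> w" by blast
  have "F z = D (lift \<phi>) z" if z: "z \<in> W" for z
  proof -
    obtain x u p q where xupq: "z = (x, u, p, q)" by (cases z)
    have w: "(x, u) \<in> ?T" using z by (simp add: W xupq)
    have "F z = A z + p * H z" by (simp add: A_def xupq)
    also have "\<dots> = D (lift \<phi>) z"
      using \<alpha>(2)[OF z] \<beta>(2)[OF z] \<phi>(2)[OF w] pd_lift_plane[OF \<phi>(1) w]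
      by (simp add: xupq Dx_def) (simp add: lift_def)
    finally show ?thesis .
  qed
  with \<phi>(1) show thesis by (rule that)
qed

lemma directional_chain:
  assumes "open W" and d: "directional W v d" and F: "smooth_on W F"
    and "smooth_on W (\<lambda>z. \<gamma> (F z))" and \<gamma>: "(\<gamma> has_real_derivative c) (at (F z))" and z: "z \<in> W"
  shows "d (\<lambda>z. \<gamma> (F z)) z = c * d F z"
proof -
  have "((\<lambda>z. \<gamma> (F z)) has_derivative (\<lambda>v. c * frechet_derivative F (at z) v)) (at z)"
    by (rule has_derivative_compose[OF smooth_on_has_derivative[OF F z]])
       (use \<gamma> in \<open>simp add: has_field_derivative_def\<close>)
  from frechet_derivative_eqI[OF this] show ?thesis
    using directionalD[OF d assms(4) z] directionalD[OF d F z] by simp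
qed

lemma (in jet_calculus) D_chain:
  assumes "smooth_on W F" "smooth_on W (\<lambda>z. \<gamma> (F z))" "(\<gamma> has_real_derivative c) (at (F z))" "z \<in> W"
  shows "D (\<lambda>z. \<gamma> (F z)) z = c * D F z"
  by (simp add: Dx_eq algebra_simps directional_chain[OF open_W directional_pd(1)[OF open_W] assms]
      directional_chain[OF open_W directional_pd(2)[OF open_W] assms]
      directional_chain[OF open_W directional_pd(3)[OF open_W] assms]
      directional_chain[OF open_W directional_pd(4)[OF open_W] assms])

lemma (in jet_calculus) constant_if_pd_zero:
  assumes W: "W = jet_box x0 u0 p0 q0 r" and F: "smooth_on W F"
    and 0: "\<And>z. z \<in> W \<Longrightarrow> pd_x F z = 0 \<and> pd_u F z = 0 \<and> pd_p F z = 0 \<and> pd_q F z = 0"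
    and z: "z \<in> W" and z': "z' \<in> W"
  shows "F z = F z'"
proof -
  have "(F has_derivative (\<lambda>v. 0)) (at z within W)" if z: "z \<in> W" for z
  proof -
    note D = smooth_on_has_derivative[OF F z]
    have "frechet_derivative F (at z) v = 0" for v
    proof -
      obtain a b c d where v: "v = (a, b, c, d)" by (cases v)
      have "v = a *\<^sub>R (1, 0, 0, 0) + b *\<^sub>R (0, 1, 0, 0) + c *\<^sub>R (0, 0, 1, 0) + d *\<^sub>R (0, 0, 0, 1)"
        by (simp add: v)
      then show ?thesis
        using 0[OF z] directional_pd[OF open_W, THEN directionalD, OF F z]
        by (simp only: linear_add[OF has_derivative_linear[OF D]] linear_cmul[OF has_derivative_linear[OF D]]) simp
    qed
    then have "frechet_derivative F (at z) = (\<lambda>v. 0)" by (rule ext)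
    with D show ?thesis by (simp add: has_derivative_at_withinI)
  qed
  then have "\<exists>c. \<forall>z\<in>W. F z = c"
    by (intro has_derivative_zero_constant) (auto simp: W intro!: convex_Times)
  with z z' show ?thesis by auto
qed

lemma smooth_on_exp:
  assumes "open S" "smooth_on S f"
  shows "smooth_on S (\<lambda>x. exp (f x) :: real)"
proof (rule smooth_on_compose[OF assms(1) open_UNIV _ _ assms(2)])
  show "smooth_on UNIV (exp :: real \<Rightarrow> real)"
  proof (rule smooth_on_bootstrap[where f' = "\<lambda>x v. exp x * v"])
    show "(exp has_derivative (*) (exp x)) (at x)" for x :: real
      using DERIV_exp[of x] by (simp add: has_field_derivative_def)
    show "higher_differentiable_on UNIV (\<lambda>x. exp x * v) n"
      if "higher_differentiable_on UNIV (exp :: real \<Rightarrow> real) n" for n and v :: real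
      using higher_differentiable_on_bilinear[OF bounded_bilinear_mult open_UNIV that
          higher_differentiable_on_const[OF open_UNIV, of v]] .
  qed simp
qed simp

section \<open>Linearization on third-order jets\<close>

context prolonged_transformation
begin

text \<open>Replacing \<open>f\<close> by \<open>r\<close> in the total derivative of \<open>F\<close> adds \<open>(r - f) F\<^sub>q\<close> only. As \<open>\<phi>\<close>, \<open>\<psi>\<close>
  and \<open>P\<close> do not depend on \<open>q\<close>, a free third derivative is felt in the last prolongation only, with slope
  \<open>Q\<^sub>q / j \<noteq> 0\<close>.\<close>

lemma prol_free:
  assumes z: "z \<in> W"
  shows "prol1 (\<lambda>_. r) \<phi> \<psi> = P" "prol2 (\<lambda>_. r) \<phi> \<psi> z = Q z"
    "prol3 (\<lambda>_. r) \<phi> \<psi> z = R z + (r - f z) * w3 z"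
proof -
  interpret r: jet_calculus W "\<lambda>_. r" by unfold_locales simp_all
  have D_r: "Dx (\<lambda>_. r) F z = D F z + (r - f z) * pd_q F z" for F z
    by (simp add: Dx_eq r.Dx_eq algebra_simps)
  show 1: "prol1 (\<lambda>_. r) \<phi> \<psi> = P" by (simp add: prol1_def D_r)
  have 2: "prol2 (\<lambda>_. r) \<phi> \<psi> z = Q z" if "z \<in> W" for z
    using that by (simp add: prol2_def 1 D_r pd_P)
  then show "prol2 (\<lambda>_. r) \<phi> \<psi> z = Q z" using z .
  have "Dx (\<lambda>_. r) (prol2 (\<lambda>_. r) \<phi> \<psi>) z = Dx (\<lambda>_. r) Q z"
    by (rule r.D.cong[symmetric]) (simp_all add: 2 z)
  also have "\<dots> = R z * j z + (r - f z) * (w3 z * j z)"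
    using z by (simp add: D_r D_prol pd_Q w_j)
  also have "\<dots> = (R z + (r - f z) * w3 z) * j z" by algebra
  finally show "prol3 (\<lambda>_. r) \<phi> \<psi> z = R z + (r - f z) * w3 z"
    using z j_nz[OF z] by (simp add: prol3_def D_r j_def)
qed

text \<open>Because of the nonvanishing slope, the equivalence of the two equations on all third-order jets over \<open>z\<close> is a
  single equation on the jet prolonged by \<open>f\<close>.\<close>

lemma canonical_iff:
  assumes z: "z \<in> W"
  shows "(\<forall>r. r = f z \<longleftrightarrow> prol3 (\<lambda>_. r) \<phi> \<psi> z = canonical s
      (lift \<phi> z, lift \<psi> z, prol1 (\<lambda>_. r) \<phi> \<psi> z, prol2 (\<lambda>_. r) \<phi> \<psi> z))
    \<longleftrightarrow> R z = s * P z + lift \<psi> z"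
  unfolding prol_free[OF z] canonical_def prod.case using w3_nz[OF z]
  by (metis add_cancel_left_right add_left_cancel cancel_comm_monoid_add_class.diff_cancel
      eq_iff_diff_eq_0 mult_cancel_right mult_zero_left)

end

text \<open>Germs at \<open>z0\<close> are represented on one box, which is also the domain of all
  calculations with prolongations. The predicate \<open>Pr\<close> carries along the further conditions that hold near \<open>z0\<close>.\<close>

lemma prolonged_transformation_near:
  assumes \<Omega>: "open \<Omega>" "smooth_on \<Omega> f" "(x0, u0, p0, q0) \<in> \<Omega>"
    and "point_transformation_near \<phi> \<psi> (x0, u0)"
    and ev: "\<forall>\<^sub>F z in nhds (x0, u0, p0, q0). Dx f (lift \<phi>) z \<noteq> 0 \<and> Pr z"
  obtains r where "r > 0" "prolonged_transformation (jet_box x0 u0 p0 q0 r) f \<phi> \<psi>"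
    "smooth_on (ball x0 r \<times> ball u0 r) \<phi>" "smooth_on (ball x0 r \<times> ball u0 r) \<psi>"
    "\<And>z. z \<in> jet_box x0 u0 p0 q0 r \<Longrightarrow> Pr z"
proof -
  from assms(4) obtain V where V: "open V" "(x0, u0) \<in> V" "smooth_on V \<phi>" "smooth_on V \<psi>"
    "\<And>w. w \<in> V \<Longrightarrow> jacobian \<phi> \<psi> w \<noteq> 0" by (auto simp: point_transformation_near_def)
  have "\<forall>\<^sub>F z in nhds (x0, u0, p0, q0). (Dx f (lift \<phi>) z \<noteq> 0 \<and> Pr z) \<and> z \<in> \<Omega> \<and> (fst z, fst (snd z)) \<in> V"
    by (intro eventually_conj ev eventually_nhds_in_open \<Omega> eventually_lift V)
  then obtain r where r: "r > 0" and W: "\<And>z. z \<in> jet_box x0 u0 p0 q0 r \<Longrightarrow>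
      (Dx f (lift \<phi>) z \<noteq> 0 \<and> Pr z) \<and> z \<in> \<Omega> \<and> (fst z, fst (snd z)) \<in> V"
    unfolding eventually_nhds_jet_box by blast
  have TV: "ball x0 r \<times> ball u0 r \<subseteq> V"
  proof
    fix w assume "w \<in> ball x0 r \<times> ball u0 r"
    then show "w \<in> V" using W[of "(fst w, snd w, p0, q0)"] r by (cases w) auto
  qed
  interpret jet_calculus "jet_box x0 u0 p0 q0 r" f
    by unfold_locales (use open_jet_box smooth_on_subset[OF \<Omega>(2)] W in blast)+
  have inV: "(x, u) \<in> V" if "(x, u, p, q) \<in> jet_box x0 u0 p0 q0 r" for x u p q
    using W[OF that] by simp
  show thesis
  proof (rule that[OF r])
    show "prolonged_transformation (jet_box x0 u0 p0 q0 r) f \<phi> \<psi>"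
    proof unfold_locales
      show "smooth_on (jet_box x0 u0 p0 q0 r) (lift \<phi>)" by (rule smooth_lift[OF V(1,3) inV])
      show "smooth_on (jet_box x0 u0 p0 q0 r) (lift \<psi>)" by (rule smooth_lift[OF V(1,4) inV])
      fix z assume z: "z \<in> jet_box x0 u0 p0 q0 r"
      show "D (lift \<phi>) z \<noteq> 0" using W[OF z] by simp
      obtain x u p q where xupq: "z = (x, u, p, q)" by (cases z)
      show "lift (jacobian \<phi> \<psi>) z \<noteq> 0"
        using V(5)[OF inV[of x u p q]] z by (simp add: lift_def xupq)
    qed
    show "smooth_on (ball x0 r \<times> ball u0 r) \<phi>" "smooth_on (ball x0 r \<times> ball u0 r) \<psi>"
      using V TV smooth_on_subset by blast+
    show "Pr z" if "z \<in> jet_box x0 u0 p0 q0 r" for z using W[OF that] by simp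
  qed
qed

section \<open>Necessity\<close>

lemma linearizing_imp:
  assumes \<Omega>: "open \<Omega>" "smooth_on \<Omega> f" "(x0, u0, p0, q0) \<in> \<Omega>"
    and lin: "linearizing f s \<phi> \<psi> (x0, u0, p0, q0)"
  shows "invariants_vanish_near f (x0, u0, p0, q0)"
    and "\<forall>\<^sub>F z in nhds (x0, u0, p0, q0). transformation_system f \<phi> \<psi> z"
    and "\<forall>\<^sub>F z in nhds (x0, u0, p0, q0). K f z = s"
proof -
  have pt: "point_transformation_near \<phi> \<psi> (x0, u0)"
    and ev: "\<forall>\<^sub>F z in nhds (x0, u0, p0, q0). Dx f (lift \<phi>) z \<noteq> 0 \<and>
        (\<forall>r. r = f z \<longleftrightarrow> prol3 (\<lambda>_. r) \<phi> \<psi> z = canonical s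
          (lift \<phi> z, lift \<psi> z, prol1 (\<lambda>_. r) \<phi> \<psi> z, prol2 (\<lambda>_. r) \<phi> \<psi> z))"
    using lin by (auto simp: linearizing_def equivalent_via_def)
  obtain r where r: "r > 0" and pro: "prolonged_transformation (jet_box x0 u0 p0 q0 r) f \<phi> \<psi>"
    and eq: "\<And>z. z \<in> jet_box x0 u0 p0 q0 r \<Longrightarrow>
        \<forall>r. r = f z \<longleftrightarrow> prol3 (\<lambda>_. r) \<phi> \<psi> z = canonical s
          (lift \<phi> z, lift \<psi> z, prol1 (\<lambda>_. r) \<phi> \<psi> z, prol2 (\<lambda>_. r) \<phi> \<psi> z)"
    by (rule prolonged_transformation_near[OF \<Omega> pt ev]) (rule that)
  interpret prolonged_transformation "jet_box x0 u0 p0 q0 r" f \<phi> \<psi> by (rule pro)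
  have R: "R z = s * P z + lift \<psi> z" if "z \<in> jet_box x0 u0 p0 q0 r" for z
    using eq[OF that] unfolding canonical_iff[OF that] .
  note inv = invariants_of_linearized[OF R]
  have "I3 f z \<noteq> 0" if "z \<in> jet_box x0 u0 p0 q0 r" for z
    using inv(1)[OF _ that] j_nz[OF that] by simp
  then show "invariants_vanish_near f (x0, u0, p0, q0)"
    unfolding invariants_vanish_near_def eventually_nhds_jet_box
    using r inv(4) by (intro exI[of _ r]) simp
  show "\<forall>\<^sub>F z in nhds (x0, u0, p0, q0). transformation_system f \<phi> \<psi> z"
    "\<forall>\<^sub>F z in nhds (x0, u0, p0, q0). K f z = s"
    unfolding eventually_nhds_jet_box using r inv(3,5) by (auto intro!: exI[of _ r])
qed

section \<open>Sufficiency\<close>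

lemma (in jet_calculus) invariants_smooth:
  assumes "\<forall>z\<in>W. I3 f z \<noteq> 0"
  shows "smooth_on W (J f)" "smooth_on W (K f)" "z \<in> W \<Longrightarrow> J f z \<noteq> 0" "z \<in> W \<Longrightarrow> I3 f z = (J f z)^3"
proof -
  have "smooth_on W (I3 f)" by (simp add: I3_def)
  then show J: "smooth_on W (J f)"
    unfolding J_def by (rule smooth_on_root3[OF open_W]) (use assms in blast)
  show nz: "J f z \<noteq> 0" if "z \<in> W" for z using assms that by (simp add: J_def)
  show "smooth_on W (K f)" unfolding K_def I8_def using J nz by simp
  show "z \<in> W \<Longrightarrow> I3 f z = (J f z)^3" by (simp add: J_def odd_real_root_pow)
qed

context prolonged_transformation
begin

lemma gradient_nz: "(x, u, p, q) \<in> W \<Longrightarrow> smooth_on S \<phi> \<Longrightarrow> (x, u) \<in> S \<Longrightarrow> d1 \<phi> (x, u) \<noteq> 0 \<or> d2 \<phi> (x, u) \<noteq> 0"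
  using D\<phi>_nz[of "(x, u, p, q)"] pd_lift_plane[of S \<phi> x u p q] by (auto simp: Dx_def)

text \<open>The three conditions on the transformation, \<open>K\<close> and \<open>I\<^sub>3\<close> determine \<open>f\<^sub>q\<close>, \<open>f\<^sub>p\<close> and \<open>f\<^sub>u\<close>
  so that the formulas for the derivatives of the defect collapse; what remains is functional dependence of the defect on \<open>\<phi>\<close>.\<close>

lemma defect_of_system:
  assumes I3: "\<forall>z\<in>W. I3 f z \<noteq> 0" and K: "\<And>z. z \<in> W \<Longrightarrow> K f z = s"
    and sys: "\<And>z. z \<in> W \<Longrightarrow> transformation_system f \<phi> \<psi> z" and z: "z \<in> W"
  shows "pd_q (G s) z = 0" "pd_p (G s) z = 0"
    "pd_x (lift \<phi>) z * pd_u (G s) z = pd_u (lift \<phi>) z * pd_x (G s) z"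
proof -
  have J: "J f z = j z" if "z \<in> W" for z
    using sys[OF that] by (simp add: transformation_system_def j_def)
  note sm = invariants_smooth[OF I3]
  have a1: "a1 f \<phi> \<psi> z = a z" if "z \<in> W" for z by (simp add: a1_def a_def J[OF that])
  have f_q: "pd_q f z = 3 * (y z - e z)" if z: "z \<in> W" for z
  proof -
    have "D (a1 f \<phi> \<psi>) z = D a z" by (rule D.cong[symmetric]) (simp_all add: a1 z)
    moreover have "D (J f) z = D j z" by (rule D.cong[OF sm(1)]) (simp_all add: J z)
    ultimately have "e z = 1 / 3 * ((3 * (y z * j z) - j z * pd_q f z) / j z)"
      using sys[OF z] z by (simp add: transformation_system_def a1 J D_a D_j)
    then show ?thesis using j_nz[OF z] by (simp add: diff_divide_distrib)
  qed
  interpret logarithmic_frame W f j y e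
    by unfold_locales (use D_j f_q in auto)
  have f_p: "pd_p f z = s * (j z)\<^sup>2 - (3 * D e z - D y z + 3 * (e z)\<^sup>2 - 6 * e z * y z + 2 * (y z)\<^sup>2)"
    if "z \<in> W" for z
    using K_eq[OF J that] K[OF that] j_nz[OF that] by (simp add: field_simps)
  show q0: "pd_q (G s) z = 0" using pd_G(1)[OF z, of s] f_q[OF z] by simp
  show p0: "pd_p (G s) z = 0" using pd_G(2)[OF z, of s] f_p[OF z] by simp
  have "pd_u (G s) z = h z * (D (G s) z / j z)"
    using pd_G(3)[OF z, of s] sm(4)[OF z] I3_eq[OF f_p z] J[OF z] by simp
  then have "j z * pd_u (G s) z = h z * D (G s) z" using j_nz[OF z] by simp
  then show "pd_x (lift \<phi>) z * pd_u (G s) z = pd_u (lift \<phi>) z * pd_x (G s) z"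
    using q0 p0 by (simp add: j_def h_def Dx_eq) algebra
qed

end

text \<open>The system determines \<open>\<psi>\<close> only up to a function of \<open>\<phi>\<close>, since adding one leaves the Jacobian
  unchanged. This freedom absorbs the defect.\<close>

lemma system_imp_linearizing:
  assumes \<Omega>: "open \<Omega>" "smooth_on \<Omega> f" "(x0, u0, p0, q0) \<in> \<Omega>"
    and inv: "invariants_vanish_near f (x0, u0, p0, q0)"
    and pt: "point_transformation_near \<phi> \<psi> (x0, u0)"
    and sys: "\<forall>\<^sub>F z in nhds (x0, u0, p0, q0). transformation_system f \<phi> \<psi> z"
  shows "\<exists>T g. open T \<and> \<phi> (x0, u0) \<in> T \<and> smooth_on T (g :: real \<Rightarrow> real) \<and>
    linearizing f (K f (x0, u0, p0, q0)) \<phi> (\<lambda>w. \<psi> w + g (\<phi> w)) (x0, u0, p0, q0)"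
proof -
  let ?z0 = "(x0, u0, p0, q0)"
  define s where "s = K f ?z0"
  have "\<forall>\<^sub>F z in nhds ?z0. Dx f (lift \<phi>) z \<noteq> 0 \<and> (transformation_system f \<phi> \<psi> z \<and> I3 f z \<noteq> 0 \<and>
      I9 f z = 0 \<and> I10 f z = 0 \<and> I11 f z = 0 \<and> I12 f z = 0)"
    using sys inv unfolding invariants_vanish_near_def
    by eventually_elim (auto simp: transformation_system_def J_def)
  then obtain r where r: "r > 0" and pro: "prolonged_transformation (jet_box x0 u0 p0 q0 r) f \<phi> \<psi>"
    and s\<phi>: "smooth_on (ball x0 r \<times> ball u0 r) \<phi>" and s\<psi>: "smooth_on (ball x0 r \<times> ball u0 r) \<psi>"
    and ok: "\<And>z. z \<in> jet_box x0 u0 p0 q0 r \<Longrightarrow> transformation_system f \<phi> \<psi> z \<and> I3 f z \<noteq> 0 \<and>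
      I9 f z = 0 \<and> I10 f z = 0 \<and> I11 f z = 0 \<and> I12 f z = 0"
    by (rule prolonged_transformation_near[OF \<Omega> pt]) (rule that)
  let ?W = "jet_box x0 u0 p0 q0 r" and ?T = "ball x0 r \<times> ball u0 r"
  interpret prolonged_transformation ?W f \<phi> \<psi> by (rule pro)
  have z0: "?z0 \<in> ?W" and w0: "(x0, u0) \<in> ?T" using r by auto
  have I3: "\<forall>z\<in>?W. I3 f z \<noteq> 0" using ok by blast
  have K: "K f z = s" if "z \<in> ?W" for z
    unfolding s_def
    by (rule constant_if_pd_zero[OF refl invariants_smooth(2)[OF I3] _ that z0])
       (use ok in \<open>simp_all add: I9_def I10_def I11_def I12_def\<close>)
  have sys': "transformation_system f \<phi> \<psi> z" if "z \<in> ?W" for z using ok[OF that] by simp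
  have G_q: "pd_q (G s) z = 0" and G_p: "pd_p (G s) z = 0"
    and G_x_u: "pd_x (lift \<phi>) z * pd_u (G s) z = pd_u (lift \<phi>) z * pd_x (G s) z" if "z \<in> ?W" for z
    using defect_of_system[OF I3 K sys' that] by simp_all
  obtain G0 where G0: "smooth_on ?T G0" "\<And>z. z \<in> ?W \<Longrightarrow> G s z = lift G0 z"
    by (rule function_of_x_u[OF refl r smooth_G G_p G_q]) (assumption, assumption, rule that)
  have dep: "d1 \<phi> w * d2 G0 w = d2 \<phi> w * d1 G0 w" if w: "w \<in> ?T" for w
  proof -
    let ?z = "(fst w, snd w, p0, q0)"
    have z: "?z \<in> ?W" using w r by auto
    have "pd_x (G s) ?z = d1 G0 w" "pd_u (G s) ?z = d2 G0 w"
      using x.cong[OF smooth_G G0(2) z] u.cong[OF smooth_G G0(2) z] pd_lift_plane[OF G0(1), of "fst w" "snd w"] w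
      by simp_all
    then show ?thesis
      using G_x_u[OF z] pd_lift_plane[OF s\<phi>, of "fst w" "snd w"] w by simp
  qed
  obtain U \<rho> \<kappa> where U: "open U" "(x0, u0) \<in> U" "U \<subseteq> ?T" and \<rho>: "\<rho> > 0"
    and \<kappa>: "smooth_on (ball (\<phi> (x0, u0)) \<rho>) (\<kappa> :: real \<Rightarrow> real)"
    and G0_eq: "\<And>w. w \<in> U \<Longrightarrow> \<phi> w \<in> ball (\<phi> (x0, u0)) \<rho> \<and> G0 w = \<kappa> (\<phi> w)"
    by (rule functional_dependence[OF open_box w0 s\<phi> gradient_nz[OF z0 s\<phi> w0] G0(1) dep]) (assumption, rule that)
  let ?I = "ball (\<phi> (x0, u0)) \<rho>"
  \<comment> \<open>Adding \<open>\<gamma>(\<phi>)\<close> to \<open>\<psi>\<close> adds \<open>\<gamma>''' - s \<gamma>' - \<gamma>\<close>, taken at \<open>\<phi>\<close>, to the defect \<open>\<kappa>(\<phi>)\<close>.\<close>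
  have "smooth_on ?I (\<lambda>x. - \<kappa> x)" using \<kappa> by simp
  from canonical_ode[OF \<rho> this, of s] obtain \<gamma> \<gamma>1 \<gamma>2 where
    s\<gamma>: "smooth_on ?I \<gamma>" "smooth_on ?I \<gamma>1" "smooth_on ?I \<gamma>2" and
    d\<gamma>: "\<And>x. x \<in> ?I \<Longrightarrow> (\<gamma> has_real_derivative \<gamma>1 x) (at x) \<and> (\<gamma>1 has_real_derivative \<gamma>2 x) (at x) \<and>
      (\<gamma>2 has_real_derivative s * \<gamma>1 x + \<gamma> x + - \<kappa> x) (at x)" by blast
  define \<psi>' where "\<psi>' = (\<lambda>w. \<psi> w + \<gamma> (\<phi> w))"
  note s\<phi>U = smooth_on_subset[OF s\<phi> U(3)] and s\<psi>U = smooth_on_subset[OF s\<psi> U(3)]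
  have s\<gamma>\<phi>: "smooth_on U (\<lambda>w. \<gamma> (\<phi> w))"
    by (rule smooth_on_compose[OF U(1) open_ball _ s\<gamma>(1) s\<phi>U]) (use G0_eq in auto)
  have s\<psi>': "smooth_on U \<psi>'" unfolding \<psi>'_def by (rule smooth_on_add[OF U(1) s\<psi>U s\<gamma>\<phi>])
  have jac: "jacobian \<phi> \<psi>' w = jacobian \<phi> \<psi> w" if w: "w \<in> U" for w
  proof -
    have "((\<lambda>w. \<gamma> (\<phi> w)) has_derivative
        (\<lambda>v. \<gamma>1 (\<phi> w) * (fst v *\<^sub>R d1 \<phi> w + snd v *\<^sub>R d2 \<phi> w))) (at w)"
      by (rule has_derivative_compose[OF smooth_on_has_derivative_plane[OF s\<phi>U w]])
         (use d\<gamma> G0_eq[OF w] in \<open>simp add: has_field_derivative_def\<close>)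
    from has_derivative_add[OF smooth_on_has_derivative_plane[OF s\<psi>U w] this]
    have "(\<psi>' has_derivative (\<lambda>v. fst v *\<^sub>R (d1 \<psi> w + \<gamma>1 (\<phi> w) * d1 \<phi> w)
        + snd v *\<^sub>R (d2 \<psi> w + \<gamma>1 (\<phi> w) * d2 \<phi> w))) (at w)"
      unfolding \<psi>'_def by (rule has_derivative_eq_rhs) (simp add: algebra_simps)
    note d = d1_d2_eqI[OF this]
    show ?thesis
      unfolding jacobian_plane[OF s\<phi>U s\<psi>' w] jacobian_plane[OF s\<phi>U s\<psi>U w] d by algebra
  qed
  have pt': "point_transformation_near \<phi> \<psi>' (x0, u0)"
  proof -
    have "jacobian \<phi> \<psi>' w \<noteq> 0" if w: "w \<in> U" for w
      using jacobian_nz[of "(fst w, snd w, p0, q0)"] w U(3) r by (auto simp: jac lift_def)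
    then show ?thesis
      unfolding point_transformation_near_def using U s\<phi>U s\<psi>' by blast
  qed
  have "\<forall>\<^sub>F z in nhds ?z0. Dx f (lift \<phi>) z \<noteq> 0 \<and> (z \<in> ?W \<and> (fst z, fst (snd z)) \<in> U)"
    using eventually_nhds_in_open[OF open_jet_box z0] eventually_lift[OF U(1,2), of p0 q0]
    by eventually_elim (use D\<phi>_nz in auto)
  then obtain r' where r': "r' > 0" and pro': "prolonged_transformation (jet_box x0 u0 p0 q0 r') f \<phi> \<psi>'"
    and in_U: "\<And>z. z \<in> jet_box x0 u0 p0 q0 r' \<Longrightarrow> z \<in> ?W \<and> (fst z, fst (snd z)) \<in> U"
    by (rule prolonged_transformation_near[OF \<Omega> pt']) (rule that)
  let ?W' = "jet_box x0 u0 p0 q0 r'"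
  interpret n: prolonged_transformation ?W' f \<phi> \<psi>' by (rule pro')
  have sW': "smooth_on ?W' F" if "smooth_on ?W F" for F :: "jet \<Rightarrow> real"
    using smooth_on_subset[OF that] in_U by blast
  have \<phi>I: "lift \<phi> z \<in> ?I" if "z \<in> ?W'" for z
    using in_U[OF that] G0_eq by (auto simp: lift_def split_beta)
  have s\<gamma>': "smooth_on ?W' (\<lambda>z. \<gamma> (lift \<phi> z))" "smooth_on ?W' (\<lambda>z. \<gamma>1 (lift \<phi> z))"
    "smooth_on ?W' (\<lambda>z. \<gamma>2 (lift \<phi> z))"
    using \<phi>I by (auto intro!: smooth_on_compose[OF n.open_W open_ball _ s\<gamma>(1) n.smooth_\<phi>]
        smooth_on_compose[OF n.open_W open_ball _ s\<gamma>(2) n.smooth_\<phi>]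
        smooth_on_compose[OF n.open_W open_ball _ s\<gamma>(3) n.smooth_\<phi>])
  have R: "n.R z = s * n.P z + lift \<psi>' z" if z: "z \<in> ?W'" for z
  proof -
    note [simp] = s\<gamma>' sW'[OF smooth_prol(1)] sW'[OF smooth_prol(2)] sW'[OF smooth_\<psi>]
    have lift': "lift \<psi>' = (\<lambda>z. lift \<psi> z + \<gamma> (lift \<phi> z))"
      by (auto simp: lift_def \<psi>'_def)
    have nz: "D (lift \<phi>) z \<noteq> 0" if "z \<in> ?W'" for z using n.D\<phi>_nz[OF that] .
    have chain: "D (\<lambda>z. \<gamma> (lift \<phi> z)) z = \<gamma>1 (lift \<phi> z) * D (lift \<phi>) z"
      "D (\<lambda>z. \<gamma>1 (lift \<phi> z)) z = \<gamma>2 (lift \<phi> z) * D (lift \<phi>) z"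
      "D (\<lambda>z. \<gamma>2 (lift \<phi> z)) z = (s * \<gamma>1 (lift \<phi> z) + \<gamma> (lift \<phi> z) - \<kappa> (lift \<phi> z)) * D (lift \<phi>) z"
      if z: "z \<in> ?W'" for z
      using d\<gamma>[OF \<phi>I[OF z]] z by (simp_all add: n.D_chain)
    have P': "n.P z = P z + \<gamma>1 (lift \<phi> z)" if "z \<in> ?W'" for z
      using that nz[OF that] by (simp add: prol1_def lift' chain add_divide_distrib)
    have Q': "n.Q z = Q z + \<gamma>2 (lift \<phi> z)" if z: "z \<in> ?W'" for z
    proof -
      have "D n.P z = D (\<lambda>z. P z + \<gamma>1 (lift \<phi> z)) z"
        by (rule n.D.cong[OF _ P' z]) simp
      then show ?thesis
        using z nz[OF z] by (simp add: prol2_def chain add_divide_distrib)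
    qed
    have "D n.Q z = D (\<lambda>z. Q z + \<gamma>2 (lift \<phi> z)) z"
      by (rule n.D.cong[OF _ Q' z]) simp
    then have "n.R z = R z + (s * \<gamma>1 (lift \<phi> z) + \<gamma> (lift \<phi> z) - \<kappa> (lift \<phi> z))"
      using z nz[OF z] by (simp add: prol3_def chain add_divide_distrib)
    moreover have "R z - s * P z - lift \<psi> z = \<kappa> (lift \<phi> z)"
      using G0(2)[of z] in_U[OF z] G0_eq[of "(fst z, fst (snd z))"] by (simp add: G_def lift_def split_beta)
    ultimately show ?thesis
      unfolding P'[OF z] lift' by (simp add: algebra_simps)
  qed
  have "linearizing f s \<phi> \<psi>' ?z0"
    unfolding linearizing_def equivalent_via_def prod.case eventually_nhds_jet_box
    using r' n.D\<phi>_nz R n.canonical_iff pt' by (intro conjI exI[of _ r'] ballI) auto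
  then show ?thesis
    using s\<gamma>(1) \<rho> unfolding s_def \<psi>'_def by (intro exI[of _ ?I] exI[of _ \<gamma>]) auto
qed

text \<open>The Jacobian is sought as \<open>exp l\<close>, where \<open>D l = e + y\<close>; here \<open>e\<close> is defined by \<open>f\<^sub>q = 3 (y - e)\<close>, so
  that the equation for \<open>a\<^sub>1 = exp l / J\<close> holds by construction.\<close>

lemma system_solvable:
  assumes \<Omega>: "open \<Omega>" "smooth_on \<Omega> f" "(x0, u0, p0, q0) \<in> \<Omega>"
    and inv: "invariants_vanish_near f (x0, u0, p0, q0)"
  shows "\<exists>\<phi> \<psi>. point_transformation_near \<phi> \<psi> (x0, u0) \<and>
    (\<forall>\<^sub>F z in nhds (x0, u0, p0, q0). transformation_system f \<phi> \<psi> z)"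
proof -
  let ?z0 = "(x0, u0, p0, q0)"
  have "\<forall>\<^sub>F z in nhds ?z0. z \<in> \<Omega> \<and> I3 f z \<noteq> 0 \<and> I4 f z = 0 \<and> I5 f z = 0 \<and> I6 f z = 0 \<and>
      I7 f z = 0 \<and> I9 f z = 0 \<and> I10 f z = 0 \<and> I11 f z = 0 \<and> I12 f z = 0"
    using inv eventually_nhds_in_open[OF \<Omega>(1,3)] unfolding invariants_vanish_near_def
    by eventually_elim auto
  then obtain r where r: "r > 0" and ok: "\<And>z. z \<in> jet_box x0 u0 p0 q0 r \<Longrightarrow>
      z \<in> \<Omega> \<and> I3 f z \<noteq> 0 \<and> I4 f z = 0 \<and> I5 f z = 0 \<and> I6 f z = 0 \<and>
      I7 f z = 0 \<and> I9 f z = 0 \<and> I10 f z = 0 \<and> I11 f z = 0 \<and> I12 f z = 0"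
    unfolding eventually_nhds_jet_box by blast
  let ?W = "jet_box x0 u0 p0 q0 r" and ?T = "ball x0 r \<times> ball u0 r"
  have z0: "?z0 \<in> ?W" and w0: "(x0, u0) \<in> ?T" using r by auto
  interpret jet_calculus ?W f
    by unfold_locales (use open_jet_box smooth_on_subset[OF \<Omega>(2)] ok in blast)+
  have I3: "\<forall>z\<in>?W. I3 f z \<noteq> 0" using ok by blast
  note sm = invariants_smooth[OF I3]
  note [simp] = sm(1)
  have J_q: "pd_q (J f) z = 0" and J_p: "pd_q (pd_q f) z * J f z = 6 * pd_p (J f) z"
    and J_u: "pd_u (J f) z = D (pd_p (J f)) z" if "z \<in> ?W" for z
    using ok[OF that] by (simp_all add: I4_def I5_def I6_def)
  obtain \<phi> where \<phi>: "smooth_on ?T \<phi>" "\<And>z. z \<in> ?W \<Longrightarrow> J f z = D (lift \<phi>) z"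
    by (rule total_derivative_of_function_of_x_u[OF refl r sm(1) J_q J_u]) (assumption, assumption, rule that)
  define y where "y = (\<lambda>z. D (J f) z / J f z)"
  define e where "e = (\<lambda>z. y z - pd_q f z / 3)"
  have sy [simp]: "smooth_on ?W y" unfolding y_def by (rule smooth_on_divide) (use sm(3) in auto)
  have se [simp]: "smooth_on ?W e" by (simp add: e_def)
  interpret logarithmic_frame ?W f "J f" y e
    by unfold_locales (use sm(3) in \<open>auto simp: e_def y_def\<close>)
  define s where "s = K f ?z0"
  have K: "K f z = s" if "z \<in> ?W" for z
    unfolding s_def
    by (rule constant_if_pd_zero[OF refl sm(2) _ that z0])
       (use ok in \<open>simp_all add: I9_def I10_def I11_def I12_def\<close>)
  have f_p: "pd_p f z = s * (J f z)\<^sup>2 - (3 * D e z - D y z + 3 * (e z)\<^sup>2 - 6 * e z * y z + 2 * (y z)\<^sup>2)"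
    if "z \<in> ?W" for z
    using K_eq[OF refl that] K[OF that] sm(3)[OF that] by (simp add: field_simps)
  let ?E = "\<lambda>z. e z + y z"
  have E_q: "pd_q ?E z = 0" if z: "z \<in> ?W" for z
  proof -
    have "pd_q (D (J f)) z = pd_p (J f) z"
      using z by (simp add: D_commute J_q D.zero)
    then have "pd_q y z = pd_p (J f) z / J f z"
      using z sm(3) unfolding y_def by (simp add: q.divide J_q field_simps power2_eq_square)
    moreover have "pd_q ?E z = 2 * pd_q y z - pd_q (pd_q f) z / 3"
      using z unfolding e_def by (simp add: q.divide)
    moreover have "pd_q (pd_q f) z = 6 * (pd_p (J f) z / J f z)"
      using J_p[OF z] sm(3)[OF z] by (simp add: field_simps)
    ultimately show ?thesis by simp
  qed
  have E_u: "pd_u ?E z = D (pd_p ?E) z" if z: "z \<in> ?W" for z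
    using I7_eq(1)[OF J_q J_u E_q f_p z] ok[OF z] by simp
  have sE: "smooth_on ?W ?E" by simp
  obtain l where l: "smooth_on ?T l" "\<And>z. z \<in> ?W \<Longrightarrow> ?E z = D (lift l) z"
    by (rule total_derivative_of_function_of_x_u[OF refl r sE E_q E_u]) (assumption, assumption, rule that)
  have nz: "d1 \<phi> (x0, u0) \<noteq> 0 \<or> d2 \<phi> (x0, u0) \<noteq> 0"
    using \<phi>(2)[OF z0] sm(3)[OF z0] pd_lift_plane[OF \<phi>(1) w0] by (auto simp: Dx_def)
  obtain U \<psi> where U: "open U" "(x0, u0) \<in> U" "U \<subseteq> ?T" and \<psi>: "smooth_on U \<psi>"
    and jac: "\<And>w. w \<in> U \<Longrightarrow> d1 \<phi> w * d2 \<psi> w - d2 \<phi> w * d1 \<psi> w = exp (l w)"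
    by (rule jacobian_equation_solvable[OF open_box w0 \<phi>(1) nz smooth_on_exp[OF open_box l(1)]]) (rule that)
  note \<phi>U = smooth_on_subset[OF \<phi>(1) U(3)]
  have jacobian: "jacobian \<phi> \<psi> w = exp (l w)" if "w \<in> U" for w
    unfolding jacobian_plane[OF \<phi>U \<psi> that] by (rule jac[OF that])
  have pt: "point_transformation_near \<phi> \<psi> (x0, u0)"
    unfolding point_transformation_near_def using U \<phi>U \<psi> jacobian by (intro exI[of _ U]) auto
  define S where "S = ?W \<inter> (\<lambda>z. (fst z, fst (snd z))) -` U"
  have "open S" unfolding S_def
    by (intro open_Int open_jet_box open_vimage U(1) continuous_intros)
  interpret n: jet_calculus S f
    by unfold_locales (use \<open>open S\<close> smooth_on_subset[OF smooth_f, of S] in \<open>auto simp: S_def\<close>)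
  have sub: "S \<subseteq> ?W" by (simp add: S_def)
  have sJ: "smooth_on S (J f)" by (rule smooth_on_subset[OF sm(1) sub])
  have sl: "smooth_on S (lift l)"
    by (rule n.smooth_lift[OF open_box l(1)]) (use U(3) in \<open>auto simp: S_def\<close>)
  have sys: "transformation_system f \<phi> \<psi> z" if z: "z \<in> S" for z
  proof -
    have zW: "z \<in> ?W" using z sub by blast
    have a1: "a1 f \<phi> \<psi> z = exp (lift l z) / J f z" if "z \<in> S" for z
      using that jacobian[of "(fst z, fst (snd z))"] by (simp add: a1_def lift_def split_beta S_def)
    have sexp: "smooth_on S (\<lambda>z. exp (lift l z))" by (rule smooth_on_exp[OF \<open>open S\<close> sl])
    have Jnz: "J f z \<noteq> 0" if "z \<in> S" for z using sm(3) that sub by blast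
    have sq: "smooth_on S (\<lambda>z. exp (lift l z) / J f z)"
      by (rule smooth_on_divide[OF \<open>open S\<close> sexp sJ Jnz])
    have "D (a1 f \<phi> \<psi>) z = D (\<lambda>z. exp (lift l z) / J f z) z"
      by (rule n.D.cong[symmetric, OF sq _ z]) (simp add: a1)
    also have "\<dots> = (D (\<lambda>z. exp (lift l z)) z * J f z - exp (lift l z) * D (J f) z) / (J f z)\<^sup>2"
      by (rule n.D.divide[OF sexp sJ Jnz z])
    also have "D (\<lambda>z. exp (lift l z)) z = exp (lift l z) * (e z + y z)"
      using n.D_chain[OF sl sexp DERIV_exp z] l(2)[OF zW] by simp
    finally have "D (a1 f \<phi> \<psi>) z / a1 f \<phi> \<psi> z = e z"
      using Jnz[OF z] D_j[OF zW] by (simp add: a1[OF z] field_simps power2_eq_square)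
    then have "D (a1 f \<phi> \<psi>) z / a1 f \<phi> \<psi> z = y z - pd_q f z / 3"
      by (simp only: e_def)
    moreover have "1 / 3 * ((3 * D (J f) z - J f z * pd_q f z) / J f z) = y z - pd_q f z / 3"
      using Jnz[OF z] D_j[OF zW] by (simp add: diff_divide_distrib)
    ultimately show ?thesis
      using \<phi>(2)[OF zW] by (simp only: transformation_system_def simp_thms)
  qed
  have "\<forall>\<^sub>F z in nhds ?z0. z \<in> S"
    using eventually_nhds_in_open[OF \<open>open S\<close>, of ?z0] z0 U(2) by (simp add: S_def)
  then have "\<forall>\<^sub>F z in nhds ?z0. transformation_system f \<phi> \<psi> z"
    by eventually_elim (rule sys)
  with pt show ?thesis by blast
qed

theorem theorem2p1:
  fixes f :: "jet \<Rightarrow> real" and \<Omega> :: "jet set" and x0 u0 p0 q0 :: real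
  assumes "open \<Omega>" and "smooth_on \<Omega> f" and "(x0, u0, p0, q0) \<in> \<Omega>"
  shows
    "((\<exists>s \<phi> \<psi>. linearizing f s \<phi> \<psi> (x0, u0, p0, q0)) \<longleftrightarrow>
        invariants_vanish_near f (x0, u0, p0, q0)) \<and>
     (invariants_vanish_near f (x0, u0, p0, q0) \<longrightarrow>
        (\<forall>s \<phi> \<psi>. linearizing f s \<phi> \<psi> (x0, u0, p0, q0) \<longrightarrow>
           (\<forall>\<^sub>F z in nhds (x0, u0, p0, q0). transformation_system f \<phi> \<psi> z)) \<and>
        (\<forall>\<phi> \<psi>. point_transformation_near \<phi> \<psi> (x0, u0) \<longrightarrow>
           (\<forall>\<^sub>F z in nhds (x0, u0, p0, q0). transformation_system f \<phi> \<psi> z) \<longrightarrow>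
           (\<exists>T g. open T \<and> \<phi> (x0, u0) \<in> T \<and> smooth_on T (g :: real \<Rightarrow> real) \<and>
              linearizing f (K f (x0, u0, p0, q0)) \<phi> (\<lambda>w. \<psi> w + g (\<phi> w)) (x0, u0, p0, q0))) \<and>
        (\<forall>s \<phi> \<psi>. linearizing f s \<phi> \<psi> (x0, u0, p0, q0) \<longrightarrow>
           (\<forall>\<^sub>F z in nhds (x0, u0, p0, q0). K f z = s)))"
proof (intro conjI impI allI iffI)
  let ?z0 = "(x0, u0, p0, q0)"
  show "invariants_vanish_near f ?z0" if "\<exists>s \<phi> \<psi>. linearizing f s \<phi> \<psi> ?z0"
    using that linearizing_imp(1)[OF assms] by blast
  show "\<forall>\<^sub>F z in nhds ?z0. transformation_system f \<phi> \<psi> z" "\<forall>\<^sub>F z in nhds ?z0. K f z = s"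
    if "linearizing f s \<phi> \<psi> ?z0" for s \<phi> \<psi>
    by (rule linearizing_imp(2)[OF assms that], rule linearizing_imp(3)[OF assms that])
  assume inv: "invariants_vanish_near f ?z0"
  show *: "\<exists>T g. open T \<and> \<phi> (x0, u0) \<in> T \<and> smooth_on T (g :: real \<Rightarrow> real) \<and>
      linearizing f (K f ?z0) \<phi> (\<lambda>w. \<psi> w + g (\<phi> w)) ?z0"
    if "point_transformation_near \<phi> \<psi> (x0, u0)"
      "\<forall>\<^sub>F z in nhds ?z0. transformation_system f \<phi> \<psi> z" for \<phi> \<psi>
    by (rule system_imp_linearizing[OF assms inv that])
  show "\<exists>s \<phi> \<psi>. linearizing f s \<phi> \<psi> ?z0"
    using system_solvable[OF assms inv] * by blast
qed

end
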